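(* Assume the Riemann Hypothesis. Let $\rho''=\beta''+i\gamma''$ be a non-real zero of $\zeta''(s)$ with $\beta''>1/2$ and $\gamma''>0$, and let $\rho'$ be the zero of $\zeta'(s)$ canonically associated to $\rho''$. Then \[ \operatorname{Re}\left(\frac{1}{\rho''-\rho'}\right)+\sum_{\lambda'\ne\rho'}\operatorname{Re}\left(\frac{1}{\rho''-\lambda'}\right)=\frac{\log(\gamma''/\pi)}{2}+O\!\left(\frac{1}{\gamma''}\right), \] where the sum is over all non-real zeros $\lambda'\neq\rho'$ of $\zeta'(s)$.
   Context: $\zeta$ is the Riemann zeta function. The zero $\rho'$ of $\zeta'$ (with $\operatorname{Re}\rho'>1/2$) canonically associated to a zero $\rho''$ of $\zeta''$ (with $\operatorname{Re}\rho''>1/2$) is the one joined to $\rho''$ by a level curve $\arg(\zeta''(s)/\zeta'(s))=0$, i.e. a curve in the preimage of the positive real axis under $\zeta''/\zeta'$; this association is a bijection between the zeros of $\zeta'$ and of $\zeta''$ in $\operatorname{Re}(s)>1/2$. The sum over $\lambda'$ runs over the non-real zeros of $\zeta'$ in both half planes, counted with multiplicity; it is understood that $\zeta'(\rho'')\ne 0$. The implied constant is absolute. *)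

theory Defs
  imports "HOL-Complex_Analysis.Complex_Analysis"
begin

text \<open>
  The Riemann zeta function as the unique holomorphic continuation of its Dirichlet series
  to the plane without the point 1. The value at the pole is set to 0 only to make the
  description unique. Note that the derivatives of \<open>zeta\<close> at 1 are meaningless, which is
  why the point 1 is excluded explicitly below.
\<close>
definition zeta :: "complex \<Rightarrow> complex" where
  "zeta = (THE f. f holomorphic_on - {1} \<and>
                  (\<forall>s. Re s > 1 \<longrightarrow> (\<lambda>n. of_nat (Suc n) powr (- s)) sums f s) \<and>
                  f 1 = 0)"

abbreviation zeta' :: "complex \<Rightarrow> complex" where
  "zeta' \<equiv> deriv zeta"

abbreviation zeta'' :: "complex \<Rightarrow> complex" where
  "zeta'' \<equiv> deriv zeta'"

definition riemann_hypothesis :: bool where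
  "riemann_hypothesis \<longleftrightarrow>
     (\<forall>s. zeta s = 0 \<and> 0 < Re s \<and> Re s < 1 \<longrightarrow> Re s = 1 / 2)"

text \<open>
  The two zeros are joined by a curve on which \<open>zeta'' / zeta'\<close> is real and positive.
  This is required only in the interior of the curve: the quotient vanishes at one end and
  has a pole at the other. Since \<open>x / 0 = 0\<close>, positivity also forces \<open>zeta'\<close> to be
  nonzero in the interior.
\<close>
definition canonically_associated :: "complex \<Rightarrow> complex \<Rightarrow> bool" where
  "canonically_associated \<rho>'' \<rho>' \<longleftrightarrow>
     \<rho>'' \<noteq> 1 \<and> zeta'' \<rho>'' = 0 \<and> Re \<rho>'' > 1 / 2 \<and>
     \<rho>' \<noteq> 1 \<and> zeta' \<rho>' = 0 \<and> Re \<rho>' > 1 / 2 \<and>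
     (\<exists>g. path g \<and> pathstart g = \<rho>'' \<and> pathfinish g = \<rho>' \<and> 1 \<notin> path_image g \<and>
        (\<forall>t\<in>{0<..<1}. \<exists>r::real. r > 0 \<and> zeta'' (g t) / zeta' (g t) = of_real r))"

text \<open>
  The non-real zeros of \<open>zeta'\<close> listed with multiplicity: a zero \<open>z\<close> of order \<open>m\<close> occurs
  as \<open>(z, 0), \<dots>, (z, m - 1)\<close>. Removing just \<open>(z, 0)\<close> omits one occurrence of \<open>z\<close>.
\<close>
definition nonreal_zeros :: "(complex \<times> nat) set" where
  "nonreal_zeros = {(z, k). zeta' z = 0 \<and> Im z \<noteq> 0 \<and> k < nat (zorder zeta' z)}"

end

theory Submission
  imports Defs "HOL-Real_Asymp.Real_Asymp"
begin

text \<open>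
  The function \<open>(s - 1)\<^sup>2 \<zeta>'(s)\<close> is entire of order less than 2, so its logarithmic derivative is a sum
  over its zeros. This writes \<open>Re (\<zeta>''/\<zeta>')(s)\<close> as the sum \<open>H(s)\<close> of \<open>Re (1 / (s - \<lambda>'))\<close> over the non-real
  zeros, which all lie in a vertical strip, plus a contribution \<open>L(s)\<close> of the real zeros. By the functional
  equation all zeros far to the left are real and simple, with exactly one between consecutive even
  integers, so comparing them with the even integers gives \<open>L(s) = c - ln \<bar>s\<bar> / 2 + O(1 / \<bar>Im s\<bar>)\<close> via the
  digamma function. At a zero of \<open>\<zeta>''\<close> the left-hand side vanishes, whence \<open>H = ln \<gamma>'' / 2 - c + O(1 / \<gamma>'')\<close>.
  
  The constant is found by comparing \<open>s = x (1 + i)\<close> with \<open>s = x (-1 + i)\<close> as \<open>x \<rightarrow> \<infinity>\<close>: the two values of \<open>H\<close>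
  cancel in the limit because the zeros lie in a strip, while \<open>\<zeta>''/\<zeta>'\<close> is known at the first point from the
  Dirichlet series and at the second from the functional equation. The result is \<open>c = ln \<pi> / 2\<close>.
\<close>

text \<open>What is known about the zeros is that the sum of
  \<open>1 / \<bar>\<lambda>' - 1\<bar>\<^sup>2\<close> converges, so the partial fractions carry a
  compensating term \<open>1 / (\<lambda>' - 1)\<close> for every zero. For non-real zeros only its
  real part is split off: in a vertical strip it is
  \<open>O(1 / \<bar>\<lambda>' - 1\<bar>\<^sup>2)\<close>. Hence the argument speaks of real parts
  and must confine these zeros to a strip. The base point is 1 because
  \<open>(s - 1)\<^sup>2 * zeta' s\<close> takes the value -1 there.

  As \<open>zeta\<close> is given by a description, its continuation, functional equation and growth
  are derived from the Dirichlet series. The functional equation is proved for real s between -1/2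
  and 0, where all integrands are nonnegative, and then extended by the identity theorem.

  The expansion has error \<open>O(1 / \<bar>Im s\<bar>)\<close> for
  \<open>\<bar>Im s\<bar> \<ge> 2\<close>. Zeros of \<open>zeta''\<close> have bounded real part on
  the right, so \<open>ln \<bar>s\<bar>\<close> may be replaced by the logarithm of the ordinate,
  and those with \<open>Re s > 1 / 2\<close> and \<open>0 < Im s < 2\<close> are finitely many,
  which costs only a constant.\<close>

section \<open>The zeta function to the right of the line Re s = -1/2\<close>

text \<open>
  The error of the trapezoidal rule for \<open>u powr (- s)\<close> on \<open>[n + 1, n + 2]\<close>, multiplied by \<open>s - 1\<close> so that
  nothing is singular at 1. It is \<open>O(n powr (- Re s - 2))\<close>, which is what continues the Dirichlet series.
\<close>

definition trapezoid_term :: "nat \<Rightarrow> complex \<Rightarrow> complex" where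
  "trapezoid_term n s = (s - 1) * (of_nat (Suc n) powr (-s) + of_nat (Suc (Suc n)) powr (-s)) / 2
     - of_nat (Suc n) powr (1 - s) + of_nat (Suc (Suc n)) powr (1 - s)"

text \<open>This is \<open>(s - 1) * zeta s\<close>. The \<open>1\<close> comes from the integral of
  \<open>u powr (- s)\<close> over \<open>u \<ge> 1\<close>, and \<open>(s - 1) / 2\<close> from the
  half weight that the trapezoidal rule gives to the term at 1.\<close>

definition zeta_right :: "complex \<Rightarrow> complex" where
  "zeta_right s = 1 + (s - 1) / 2 + (\<Sum>n. trapezoid_term n s)"

lemma summable_Suc_powr_three_halves: "summable (\<lambda>n. real (Suc n) powr (- 3 / 2))"
  using summable_real_powr_iff[of "-3/2"] by (subst summable_Suc_iff) simp

text \<open>Peano's argument: \<open>\<phi> t\<close> is the scaled trapezoid error between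
  \<open>n + 1\<close> and \<open>n + 1 + t\<close>. Both \<open>\<phi>\<close> and its derivative
  \<open>\<psi>\<close> vanish at 0, and \<open>\<psi>\<close> has derivative
  \<open>(s - 1) / 2 * (s * (s + 1) * (t * (A + t) powr (- s - 2)))\<close>. Applying the mean value
  inequality twice carries the bound over to \<open>\<phi> 1\<close>.\<close>

lemma trapezoid_term_bound:
  assumes s: "Re s \<ge> - 1 / 2"
  shows "cmod (trapezoid_term n s) \<le> cmod (s - 1) * cmod s * cmod (s + 1) / 2 * real (Suc n) powr (- 3 / 2)"
proof -
  define a where "a = real (Suc n)"
  have a: "a \<ge> 1" by (simp add: a_def)
  define A where "A = complex_of_real a"
  define B where "B = cmod (s - 1) * cmod s * cmod (s + 1) / 2 * a powr (- 3 / 2)"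
  have B: "B \<ge> 0" by (simp add: B_def)
  \<comment> \<open>A complex segment instead of a real interval, since the mean value inequality
    used below is about complex derivatives.\<close>
  define S where "S = closed_segment (0::complex) 1"
  have conv: "convex S" by (simp add: S_def)
  have S: "\<exists>t. 0 \<le> t \<and> t \<le> 1 \<and> u = complex_of_real t" if "u \<in> S" for u
    using that by (auto simp: S_def in_segment scaleR_conv_of_real)
  have S01: "0 \<in> S" "1 \<in> S" by (auto simp: S_def)
  have pw: "((\<lambda>t. (A + t) powr w) has_field_derivative w * (A + u) powr (w - 1)) (at u within S)"
    if u: "u \<in> S" for u w
  proof -
    obtain t where t: "0 \<le> t" "t \<le> 1" "u = complex_of_real t" using S[OF u] by blast
    have "A + u \<notin> \<real>\<^sub>\<le>\<^sub>0" using t a by (auto simp: A_def complex_nonpos_Reals_iff)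
    thus ?thesis by (auto intro!: derivative_eq_intros)
  qed
  define \<psi> where "\<psi> = (\<lambda>t. (s - 1) / 2 * (A powr (-s) - (A + t) powr (-s) - s * (t * (A + t) powr (-s - 1))))"
  define \<phi> where "\<phi> = (\<lambda>t. (s - 1) / 2 * (t * (A powr (-s) + (A + t) powr (-s))) - A powr (1 - s) + (A + t) powr (1 - s))"
  have d\<psi>: "(\<psi> has_field_derivative ((s - 1) / 2 * (s * (s + 1) * (u * (A + u) powr (- s - 2))))) (at u within S)"
    if u: "u \<in> S" for u
  proof -
    have "(\<psi> has_field_derivative ((s - 1) / 2 * (0 - (-s) * (A + u) powr (-s - 1)
          - s * (1 * (A + u) powr (-s - 1) + (-s - 1) * (A + u) powr (-s - 1 - 1) * u)))) (at u within S)"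
      unfolding \<psi>_def
      by (intro DERIV_cmult DERIV_diff DERIV_const DERIV_mult pw u DERIV_ident)
    thus ?thesis by (simp add: algebra_simps)
  qed
  have d\<phi>: "(\<phi> has_field_derivative \<psi> u) (at u within S)"
    if u: "u \<in> S" for u
  proof -
    have "(\<phi> has_field_derivative ((s - 1) / 2 * (1 * (A powr (-s) + (A + u) powr (-s)) + (0 + (-s) * (A + u) powr (-s - 1)) * u)
         - 0 + (1 - s) * (A + u) powr (1 - s - 1))) (at u within S)"
      unfolding \<phi>_def
      by (intro DERIV_cmult DERIV_add DERIV_diff DERIV_const DERIV_mult pw u DERIV_ident)
    moreover have eq: "(s - 1) / 2 * (1 * (A powr (-s) + X) + (0 + (-s) * Y) * u)
         - 0 + (1 - s) * X = (s - 1) / 2 * (A powr (-s) - X - s * (u * Y))" for X Y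
      by (simp add: field_simps)
    moreover have e1: "1 - s - 1 = - s" by simp
    ultimately show ?thesis unfolding \<psi>_def e1 eq by blast
  qed
  have n\<psi>: "cmod (\<psi> u) \<le> B" if u: "u \<in> S" for u
  proof -
    have "cmod (\<psi> u - \<psi> 0) \<le> B * cmod (u - 0)"
    proof (rule field_differentiable_bound[OF conv d\<psi> _ u S01(1)])
      fix v assume v: "v \<in> S"
      obtain t where t: "0 \<le> t" "t \<le> 1" "v = complex_of_real t" using S[OF v] by blast
      have "cmod ((A + v) powr (- s - 2)) = (a + t) powr (- Re s - 2)"
        unfolding t(3) A_def of_real_add[symmetric] using a t by (subst norm_powr_real_powr) auto
      \<comment> \<open>This is where \<open>Re s \<ge> - 1 / 2\<close> enters; the exponent
        \<open>- 3 / 2\<close> still gives a summable series over \<open>n\<close>.\<close>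
      also have "\<dots> \<le> (a + t) powr (- 3 / 2)"
      proof (rule powr_mono)
        show "- Re s - 2 \<le> - 3 / 2" using s by argo
      qed (use a t in auto)
      also have "\<dots> \<le> a powr (- 3 / 2)" using a t by (intro powr_mono2') auto
      finally have "t * cmod ((A + v) powr (- s - 2)) \<le> 1 * a powr (- 3 / 2)"
        using t by (intro mult_mono) auto
      hence "cmod (s - 1) * cmod s * cmod (s + 1) / 2 * (t * cmod ((A + v) powr (- s - 2))) \<le> B"
        unfolding B_def by (intro mult_left_mono) auto
      thus "cmod ((s - 1) / 2 * (s * (s + 1) * (v * (A + v) powr (- s - 2)))) \<le> B"
        using t by (simp add: norm_mult norm_divide mult_ac)
    qed
    moreover have "\<psi> 0 = 0" by (simp add: \<psi>_def)
    moreover have "B * cmod (u - 0) \<le> B * 1" using S[OF u] B by (intro mult_left_mono) auto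
    ultimately show ?thesis by simp
  qed
  have "cmod (\<phi> 1 - \<phi> 0) \<le> B * cmod (1 - 0)"
    by (rule field_differentiable_bound[OF conv d\<phi> n\<psi> S01(2,1)])
  moreover have "\<phi> 0 = 0" by (simp add: \<phi>_def)
  moreover have "\<phi> 1 = trapezoid_term n s"
    by (simp add: \<phi>_def trapezoid_term_def A_def a_def add_ac)
  ultimately show ?thesis by (simp add: B_def a_def)
qed

lemma summable_trapezoid_term:
  assumes s: "Re s \<ge> - 1 / 2"
  shows "summable (\<lambda>n. trapezoid_term n s)"
  by (rule summable_comparison_test[OF _ summable_mult[OF summable_Suc_powr_three_halves]])
     (use trapezoid_term_bound[OF s] in blast)

lemma zeta_right_bound:
  obtains K where "K > 0" "\<And>s. Re s \<ge> - 1 / 2 \<Longrightarrow> cmod (zeta_right s) \<le> K * (1 + cmod s) ^ 3"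
proof -
  define b where "b = (\<Sum>n. real (Suc n) powr (- 3 / 2))"
  have b: "b \<ge> 0" unfolding b_def by (intro suminf_nonneg summable_Suc_powr_three_halves) auto
  show ?thesis
  proof (rule that[of "2 + b"])
    fix s :: complex assume s: "Re s \<ge> - 1 / 2"
    define c where "c = cmod (s - 1) * cmod s * cmod (s + 1) / 2"
    have s1: "cmod (s - 1) \<le> 1 + cmod s" "cmod (s + 1) \<le> 1 + cmod s"
      using norm_triangle_ineq4[of s 1] norm_triangle_ineq[of s 1] by auto
    have "cmod (s - 1) * cmod s * cmod (s + 1) \<le> (1 + cmod s) * (1 + cmod s) * (1 + cmod s)"
      using s1 by (intro mult_mono) auto
    moreover have "0 \<le> (1 + cmod s) ^ 3" by simp
    ultimately have c: "c \<le> (1 + cmod s) ^ 3" unfolding c_def power3_eq_cube by linarith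
    have "cmod (\<Sum>n. trapezoid_term n s) \<le> (\<Sum>n. c * real (Suc n) powr (- 3 / 2))"
      unfolding c_def
      by (rule norm_suminf_le[OF trapezoid_term_bound[OF s] summable_mult[OF summable_Suc_powr_three_halves]])
    also have "\<dots> = c * b" unfolding b_def by (rule suminf_mult[OF summable_Suc_powr_three_halves])
    also have "\<dots> \<le> (1 + cmod s) ^ 3 * b" using b c by (intro mult_right_mono)
    finally have 1: "cmod (\<Sum>n. trapezoid_term n s) \<le> (1 + cmod s) ^ 3 * b" .
    have "cmod (1 + (s - 1) / 2) \<le> 1 + cmod (s - 1) / 2"
      using norm_triangle_ineq[of 1 "(s - 1) / 2"] by (simp add: norm_divide)
    also have "\<dots> \<le> 2 * (1 + cmod s) ^ 1" using s1 norm_ge_zero[of s] unfolding power_one_right by argo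
    also have "\<dots> \<le> 2 * (1 + cmod s) ^ 3" by (intro mult_left_mono power_increasing) auto
    finally have "cmod (1 + (s - 1) / 2) \<le> 2 * (1 + cmod s) ^ 3" .
    moreover have "cmod (zeta_right s) \<le> cmod (1 + (s - 1) / 2) + cmod (\<Sum>n. trapezoid_term n s)"
      unfolding zeta_right_def by (rule norm_triangle_ineq)
    ultimately show "cmod (zeta_right s) \<le> (2 + b) * (1 + cmod s) ^ 3" using 1 by (simp add: algebra_simps)
  qed (use b in auto)
qed

lemma holomorphic_trapezoid_term: "trapezoid_term n holomorphic_on A"
  unfolding trapezoid_term_def by (intro holomorphic_intros) (auto simp del: of_nat_Suc)

lemma zeta_right_holomorphic: "zeta_right holomorphic_on {s. Re s > - 1 / 2}"
proof -
  define S where "S = {s. Re s > - 1 / 2}"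
  have open_S: "open S" unfolding S_def by (rule open_halfspace_Re_gt)
  have "(\<lambda>s. \<Sum>n. trapezoid_term n s) holomorphic_on S"
  proof (rule holomorphic_uniform_sequence[OF open_S])
    show "(\<lambda>s. \<Sum>n<m. trapezoid_term n s) holomorphic_on S" for m
      by (intro holomorphic_intros holomorphic_trapezoid_term)
    fix x assume "x \<in> S"
    then obtain d where d: "d > 0" "cball x d \<subseteq> S" using open_S open_contains_cball by blast
    define c where "c = (1 + (cmod x + d)) * (cmod x + d) * (cmod x + d + 1) / 2"
    have "uniform_limit (cball x d) (\<lambda>m s. \<Sum>n<m. trapezoid_term n s) (\<lambda>s. \<Sum>n. trapezoid_term n s) sequentially"
    proof (rule Weierstrass_m_test[of _ _ "\<lambda>n. c * real (Suc n) powr (- 3 / 2)"])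
      fix n y assume y: "y \<in> cball x d"
      hence yS: "Re y \<ge> - 1 / 2" using d(2) by (auto simp: S_def)
      have ny: "cmod y \<le> cmod x + d" using y norm_triangle_ineq2[of y x] by (simp add: dist_norm norm_minus_commute)
      have "cmod (y - 1) * cmod y * cmod (y + 1) / 2 \<le> c" unfolding c_def
        using ny norm_triangle_ineq4[of y 1] norm_triangle_ineq[of y 1] d(1)
        by (intro divide_right_mono mult_mono) auto
      hence "cmod (y - 1) * cmod y * cmod (y + 1) / 2 * real (Suc n) powr (- 3 / 2) \<le> c * real (Suc n) powr (- 3 / 2)"
        by (intro mult_right_mono) auto
      thus "norm (trapezoid_term n y) \<le> c * real (Suc n) powr (- 3 / 2)"
        using trapezoid_term_bound[OF yS, of n] by linarith
    qed (intro summable_mult summable_Suc_powr_three_halves)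
    thus "\<exists>d>0. cball x d \<subseteq> S \<and> uniform_limit (cball x d) (\<lambda>m s. \<Sum>n<m. trapezoid_term n s)
       (\<lambda>s. \<Sum>n. trapezoid_term n s) sequentially"
      using d by blast
  qed
  thus ?thesis unfolding zeta_right_def S_def by (intro holomorphic_intros) auto
qed

lemma zeta_right_1: "zeta_right 1 = 1"
proof -
  have "trapezoid_term n 1 = 0" for n by (simp add: trapezoid_term_def del: of_nat_Suc)
  thus ?thesis by (simp add: zeta_right_def)
qed

text \<open>The half weights combine to full terms except at the two ends, and the powers with
  exponent \<open>1 - s\<close> telescope. The leftover powers of \<open>m + 1\<close> vanish in the
  limit because \<open>Re s > 1\<close>.\<close>

lemma Dirichlet_series_sums_zeta_right:
  assumes s: "Re s > 1"
  shows "(\<lambda>n. of_nat (Suc n) powr (-s)) sums (zeta_right s / (s - 1))"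
proof -
  have s1: "s - 1 \<noteq> 0" using s by auto
  have ps: "(\<Sum>n<m. trapezoid_term n s) = (s - 1) * ((\<Sum>n<m. of_nat (Suc n) powr (-s))
      + (of_nat (Suc m) powr (-s) - 1) / 2) - 1 + of_nat (Suc m) powr (1 - s)" for m
  proof -
    define a :: "nat \<Rightarrow> complex" where "a = (\<lambda>n. of_nat (Suc n) powr (-s))"
    define b :: "nat \<Rightarrow> complex" where "b = (\<lambda>n. of_nat (Suc n) powr (1 - s))"
    have tt: "trapezoid_term n s = (s - 1) * (a n + a (Suc n)) / 2 - b n + b (Suc n)" for n
      by (simp only: trapezoid_term_def a_def b_def)
    have "a 0 = 1" "b 0 = 1" by (auto simp: a_def b_def)
    hence "(\<Sum>n<m. trapezoid_term n s) = (s - 1) * ((\<Sum>n<m. a n) + (a m - 1) / 2) - 1 + b m"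
    proof (induction m)
      case (Suc m)
      show ?case unfolding sum.lessThan_Suc Suc.IH[OF Suc.prems] by (simp add: tt field_simps)
    qed auto
    thus ?thesis by (simp only: a_def b_def)
  qed
  have to0: "(\<lambda>m. of_nat (Suc m) powr w) \<longlonglongrightarrow> 0" if w: "Re w < 0" for w :: complex
  proof (rule tendsto_norm_zero_cancel)
    have "norm (of_nat (Suc m) powr w) = real (Suc m) powr Re w" for m
      by (subst norm_powr_real_powr) (auto simp del: of_nat_Suc)
    moreover have "(\<lambda>m. real (Suc m) powr Re w) \<longlonglongrightarrow> 0" using w by real_asymp
    ultimately show "(\<lambda>m. norm (of_nat (Suc m) powr w :: complex)) \<longlonglongrightarrow> 0" by simp
  qed
  have "(\<lambda>m. ((\<Sum>n<m. trapezoid_term n s) + 1 - of_nat (Suc m) powr (1 - s)) / (s - 1)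
       - (of_nat (Suc m) powr (-s) - 1) / 2) \<longlonglongrightarrow> ((\<Sum>n. trapezoid_term n s) + 1 - 0) / (s - 1) - (0 - 1) / 2"
    using s s1 by (intro tendsto_intros to0 summable_LIMSEQ summable_trapezoid_term) auto
  also have "(\<lambda>m. ((\<Sum>n<m. trapezoid_term n s) + 1 - of_nat (Suc m) powr (1 - s)) / (s - 1)
       - (of_nat (Suc m) powr (-s) - 1) / 2) = (\<lambda>m. \<Sum>n<m. of_nat (Suc n) powr (-s))"
    unfolding ps using s1 by (auto simp: field_simps simp del: of_nat_Suc)
  also have "((\<Sum>n. trapezoid_term n s) + 1 - 0) / (s - 1) - (0 - 1) / 2 = zeta_right s / (s - 1)"
    using s1 by (simp add: zeta_right_def field_simps)
  finally show ?thesis by (simp only: sums_def)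
qed


section \<open>The functional equation on a real interval\<close>

lemma nn_integral_Gamma:
  fixes \<alpha> u :: real
  assumes \<alpha>: "\<alpha> > 0" and u: "u > 0"
  shows "(\<integral>\<^sup>+x. ennreal (x powr (\<alpha> - 1) * exp (- (u * x))) * indicator {0<..} x \<partial>lborel)
     = ennreal (Gamma \<alpha> * u powr (-\<alpha>))"
proof -
  define f where "f = (\<lambda>x::real. ennreal (x powr (\<alpha> - 1) / exp x) * indicator {0<..} x)"
  have "(\<integral>\<^sup>+x. ennreal (x powr (\<alpha> - 1) / exp x) * indicator {0..} x \<partial>lborel) = ennreal (Gamma \<alpha>)"
    by (rule nn_integral_has_integral_lebesgue'[OF _ Gamma_integral_real[OF \<alpha>]]) auto
  also have "(\<integral>\<^sup>+x. ennreal (x powr (\<alpha> - 1) / exp x) * indicator {0..} x \<partial>lborel) = integral\<^sup>N lborel f"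
    unfolding f_def by (intro nn_integral_cong) (auto simp: indicator_def)
  also have "integral\<^sup>N lborel f = ennreal \<bar>u\<bar> * (\<integral>\<^sup>+x. f (0 + u * x) \<partial>lborel)"
    unfolding f_def using u by (intro nn_integral_real_affine) auto
  also have "(\<integral>\<^sup>+x. f (0 + u * x) \<partial>lborel) =
      (\<integral>\<^sup>+x. ennreal (u powr (\<alpha> - 1)) * (ennreal (x powr (\<alpha> - 1) * exp (- (u * x))) * indicator {0<..} x) \<partial>lborel)"
    unfolding f_def using u
    by (intro nn_integral_cong)
       (auto simp: indicator_def powr_mult exp_minus field_simps zero_less_mult_iff ennreal_mult[symmetric])
  also have "\<dots> = ennreal (u powr (\<alpha> - 1)) * (\<integral>\<^sup>+x. ennreal (x powr (\<alpha> - 1) * exp (- (u * x))) * indicator {0<..} x \<partial>lborel)"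
    (is "_ = _ * ?I") by (rule nn_integral_cmult) auto
  finally have "ennreal (u powr \<alpha>) * ?I = ennreal (Gamma \<alpha>)"
    using u by (simp add: mult.assoc[symmetric] ennreal_mult[symmetric] powr_diff)
  hence "ennreal (u powr (-\<alpha>)) * (ennreal (u powr \<alpha>) * ?I) = ennreal (u powr (-\<alpha>)) * ennreal (Gamma \<alpha>)" by simp
  also have "ennreal (u powr (-\<alpha>)) * (ennreal (u powr \<alpha>) * ?I) = ?I"
    using u by (simp add: mult.assoc[symmetric] ennreal_mult[symmetric] powr_add[symmetric])
  finally show ?thesis using \<alpha> by (simp add: ennreal_mult[symmetric] mult.commute)
qed

lemma lborel_Fubini:
  fixes f :: "real \<Rightarrow> real \<Rightarrow> ennreal"
  assumes "case_prod f \<in> borel_measurable (borel \<Otimes>\<^sub>M borel)"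
  shows "(\<integral>\<^sup>+y. (\<integral>\<^sup>+x. f x y \<partial>lborel) \<partial>lborel) = (\<integral>\<^sup>+x. (\<integral>\<^sup>+y. f x y \<partial>lborel) \<partial>lborel)"
  by (rule lborel_pair.Fubini') (use assms in \<open>simp cong: measurable_cong_sets\<close>)

text \<open>Write \<open>1 / (1 + y)\<close> as the integral of \<open>exp (-((1 + y) * t))\<close>
  over \<open>t > 0\<close>; after the interchange both integrations are Gamma integrals.\<close>

lemma nn_integral_Beta_half_line:
  fixes q :: real
  assumes q: "0 < q" "q < 1"
  shows "(\<integral>\<^sup>+y. ennreal (y powr (- q) / (1 + y)) * indicator {0<..} y \<partial>lborel) = ennreal (Gamma (1 - q) * Gamma q)"
proof -
  define f where "f = (\<lambda>t y::real. ennreal (y powr (- q) * exp (-((1 + y) * t))) * indicator {0<..} t * indicator {0<..} y)"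
  have "(\<integral>\<^sup>+y. ennreal (y powr (- q) / (1 + y)) * indicator {0<..} y \<partial>lborel) = (\<integral>\<^sup>+y. (\<integral>\<^sup>+t. f t y \<partial>lborel) \<partial>lborel)"
  proof (rule nn_integral_cong)
    fix y :: real
    show "ennreal (y powr (- q) / (1 + y)) * indicator {0<..} y = (\<integral>\<^sup>+t. f t y \<partial>lborel)"
    proof (cases "y > 0")
      case True
      have "(\<integral>\<^sup>+t. f t y \<partial>lborel) = (\<integral>\<^sup>+t. ennreal (y powr (- q)) * (ennreal (t powr (1 - 1) * exp (-((1 + y) * t))) * indicator {0<..} t) \<partial>lborel)"
        unfolding f_def using True by (intro nn_integral_cong) (auto simp: indicator_def ennreal_mult)
      also have "\<dots> = ennreal (y powr (- q)) * (\<integral>\<^sup>+t. ennreal (t powr (1 - 1) * exp (-((1 + y) * t))) * indicator {0<..} t \<partial>lborel)"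
        by (rule nn_integral_cmult) auto
      also have "\<dots> = ennreal (y powr (- q)) * ennreal (Gamma 1 * (1 + y) powr (-1))"
        using True by (subst nn_integral_Gamma) auto
      also have "\<dots> = ennreal (y powr (- q) / (1 + y))"
        using True by (simp add: ennreal_mult[symmetric] powr_minus_divide)
      finally show ?thesis using True by simp
    qed (auto simp: f_def)
  qed
  also have "\<dots> = (\<integral>\<^sup>+t. (\<integral>\<^sup>+y. f t y \<partial>lborel) \<partial>lborel)"
    by (rule lborel_Fubini) (unfold f_def, measurable)
  also have "\<dots> = (\<integral>\<^sup>+t. ennreal (Gamma (1 - q)) * (ennreal (t powr (q - 1) * exp (- (1 * t))) * indicator {0<..} t) \<partial>lborel)"
  proof (rule nn_integral_cong)
    fix t :: real
    show "(\<integral>\<^sup>+y. f t y \<partial>lborel) = ennreal (Gamma (1 - q)) * (ennreal (t powr (q - 1) * exp (- (1 * t))) * indicator {0<..} t)"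
    proof (cases "t > 0")
      case True
      have "(\<integral>\<^sup>+y. f t y \<partial>lborel) = (\<integral>\<^sup>+y. ennreal (exp (- t)) * (ennreal (y powr (1 - q - 1) * exp (-(t * y))) * indicator {0<..} y) \<partial>lborel)"
        unfolding f_def using True
        by (intro nn_integral_cong) (auto simp: indicator_def ennreal_mult[symmetric] exp_add[symmetric] algebra_simps)
      also have "\<dots> = ennreal (exp (- t)) * (\<integral>\<^sup>+y. ennreal (y powr (1 - q - 1) * exp (-(t * y))) * indicator {0<..} y \<partial>lborel)"
        by (rule nn_integral_cmult) auto
      also have "\<dots> = ennreal (exp (- t)) * ennreal (Gamma (1 - q) * t powr (- (1 - q)))"
        using True q by (subst nn_integral_Gamma) auto
      finally show ?thesis using True q by (simp add: ennreal_mult[symmetric] mult_ac)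
    qed (auto simp: f_def)
  qed
  also have "\<dots> = ennreal (Gamma (1 - q)) * (\<integral>\<^sup>+t. ennreal (t powr (q - 1) * exp (- (1 * t))) * indicator {0<..} t \<partial>lborel)"
    by (rule nn_integral_cmult) auto
  also have "\<dots> = ennreal (Gamma (1 - q) * Gamma q)"
    using q by (subst nn_integral_Gamma) (auto simp: ennreal_mult[symmetric])
  finally show ?thesis .
qed

lemma Gamma_reflection_real:
  fixes q :: real
  shows "Gamma q * Gamma (1 - q) = pi / sin (pi * q)"
proof -
  have "complex_of_real (Gamma q * Gamma (1 - q)) = Gamma (of_real q) * Gamma (1 - of_real q)"
    by (simp flip: Gamma_complex_of_real)
  also have "\<dots> = complex_of_real (pi / sin (pi * q))"
    unfolding Gamma_reflection_complex by (simp flip: sin_of_real)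
  finally show ?thesis by (simp only: of_real_eq_iff)
qed

text \<open>The substitution \<open>y = x\<^sup>2 / a\<^sup>2\<close> leads to the Beta integral
  with \<open>q = (p + 1) / 2\<close>, whose value \<open>pi / sin (pi * q)\<close> equals
  \<open>pi / cos (pi * p / 2)\<close>.\<close>

lemma nn_integral_powr_over_quadratic:
  fixes p a :: real
  assumes p: "0 < p" "p < 1" and a: "a > 0"
  shows "(\<integral>\<^sup>+x. ennreal (x powr (- p) / (x\<^sup>2 + a\<^sup>2)) * indicator {0<..} x \<partial>lborel)
     = ennreal (pi / (2 * cos (pi * p / 2)) * a powr (- p - 1))"
proof -
  define q where "q = (p + 1) / 2"
  have q: "0 < q" "q < 1" using p by (auto simp: q_def)
  define b where "b = Gamma (1 - q) * Gamma q"
  have b: "b = pi / cos (pi * p / 2)"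
    using Gamma_reflection_real[of q] by (simp add: b_def mult.commute q_def ring_distribs add_divide_distrib sin_add)
  have b0: "b > 0" unfolding b_def using q by (intro mult_pos_pos Gamma_real_pos) auto
  define f where "f = (\<lambda>y::real. y powr (- q) / (1 + y))"
  define g where "g = (\<lambda>x::real. x\<^sup>2 / a\<^sup>2)"
  have fi: "((\<lambda>y. f y * indicator {0<..} y) has_integral b) UNIV"
    by (rule nn_integral_has_integral)
       (use nn_integral_Beta_half_line[OF q] b0 in
         \<open>auto simp: f_def b_def indicator_def intro!: nn_integral_cong arg_cong[where f = ennreal] elim!: trans[rotated]\<close>)
  have "(f has_integral b) {0<..}"
  proof (rule has_integral_restrict_UNIV[THEN iffD1])
    have "(\<lambda>x. if x \<in> {0<..} then f x else 0) = (\<lambda>y. f y * indicator {0<..} y)" by auto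
    thus "((\<lambda>x. if x \<in> {0<..} then f x else 0) has_integral b) UNIV" using fi by simp
  qed
  moreover have "f absolutely_integrable_on {0<..}"
    by (rule nonnegative_absolutely_integrable_1) (use calculation in \<open>auto simp: f_def\<close>)
  moreover have img: "g ` {0<..} = {0<..}"
  proof -
    have "y \<in> g ` {0<..}" if "y > 0" for y
      using that a by (intro image_eqI[of _ _ "a * sqrt y"]) (auto simp: g_def power_mult_distrib)
    thus ?thesis using a by (auto simp: g_def)
  qed
  ultimately have "f absolutely_integrable_on (g ` {0<..}) \<and> integral (g ` {0<..}) f = b"
    by (auto intro!: integral_unique)
  hence "(\<lambda>x. \<bar>2 * x / a\<^sup>2\<bar> * f (g x)) absolutely_integrable_on {0<..} \<and>
           integral {0<..} (\<lambda>x. \<bar>2 * x / a\<^sup>2\<bar> * f (g x)) = b"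
  proof (rule has_absolute_integral_change_of_variables_1'[THEN iffD2, rotated 3])
    show "inj_on g {0<..}" using a by (auto simp: inj_on_def g_def power2_eq_iff)
    show "(g has_field_derivative 2 * x / a\<^sup>2) (at x within {0<..})" for x
    proof -
      have "((\<lambda>x. x\<^sup>2 / a\<^sup>2) has_field_derivative 2 * x ^ (2 - 1) * 1 / a\<^sup>2) (at x within {0<..})"
        by (intro DERIV_cdivide) (auto intro!: derivative_eq_intros)
      thus ?thesis by (simp add: g_def)
    qed
  qed auto
  hence hi: "((\<lambda>x. \<bar>2 * x / a\<^sup>2\<bar> * f (g x)) has_integral b) {0<..}"
    using set_lebesgue_integral_eq_integral(1) has_integral_integral by blast
  have eq: "\<bar>2 * x / a\<^sup>2\<bar> * f (g x) = 2 * a powr (p + 1) * (x powr (- p) / (x\<^sup>2 + a\<^sup>2))" if x: "x > 0" for x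
  proof -
    have "g x powr (- q) = x powr (- p - 1) / a powr (- p - 1)"
    proof -
      have "g x = (x / a) powr 2" using a x by (simp add: g_def power_divide)
      hence "g x powr (- q) = (x / a) powr (2 * (- q))" by (simp only: powr_powr)
      also have "2 * (- q) = - p - 1" by (simp add: q_def field_simps)
      finally show ?thesis using a x by (simp add: powr_divide)
    qed
    moreover have "x powr (- p - 1) = x powr (- p) / x" using x by (simp add: powr_diff)
    moreover have "a powr (- p - 1) = 1 / a powr (p + 1)" using powr_minus_divide[of a "p + 1"] by simp
    moreover have "1 + g x = (x\<^sup>2 + a\<^sup>2) / a\<^sup>2" using a by (simp add: g_def field_simps)
    ultimately have "f (g x) = x powr (- p) / x * a powr (p + 1) / ((x\<^sup>2 + a\<^sup>2) / a\<^sup>2)" by (simp add: f_def)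
    moreover have "\<bar>2 * x / a\<^sup>2\<bar> * (X / x * B / (Q / a\<^sup>2)) = 2 * B * (X / Q)" if "Q > 0" for X B Q
      using a x that by (simp add: field_simps)
    ultimately show ?thesis using a x by (simp add: add_pos_pos)
  qed
  have "((\<lambda>x. 2 * a powr (p + 1) * (x powr (- p) / (x\<^sup>2 + a\<^sup>2))) has_integral b) {0<..}"
    by (rule has_integral_eq[OF _ hi]) (use eq in auto)
  from has_integral_mult_right[OF this, of "1 / (2 * a powr (p + 1))"]
  have "((\<lambda>x. x powr (- p) / (x\<^sup>2 + a\<^sup>2)) has_integral b / (2 * a powr (p + 1))) {0<..}"
    using a by simp
  from nn_integral_has_integral_lebesgue'[OF _ this]
  have "(\<integral>\<^sup>+x. ennreal (x powr (- p) / (x\<^sup>2 + a\<^sup>2)) * indicator {0<..} x \<partial>lborel) = ennreal (b / (2 * a powr (p + 1)))"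
    by simp
  also have "b / (2 * a powr (p + 1)) = pi / (2 * cos (pi * p / 2)) * a powr (- p - 1)"
    using powr_minus_divide[of a "p + 1"] by (simp add: b)
  finally show ?thesis .
qed

section \<open>Reflection for the digamma function and partial fractions of coth\<close>

lemma Digamma_reflection:
  fixes z :: complex
  assumes z: "z \<notin> \<int>"
  shows "Digamma (1 - z) - Digamma z = of_real pi * cot (of_real pi * z)"
proof -
  have nz: "z \<notin> \<int>\<^sub>\<le>\<^sub>0" "1 - z \<notin> \<int>\<^sub>\<le>\<^sub>0"
    using z nonpos_Ints_Int Ints_diff[of 1 "1 - z"] by fastforce+
  have s: "sin (of_real pi * z) \<noteq> 0"
    using z by (subst sin_eq_0) auto
  have G: "Gamma z * Gamma (1 - z) = of_real pi / sin (of_real pi * z)" by (rule Gamma_reflection_complex)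
  have "((\<lambda>z. Gamma z * Gamma (1 - z)) has_field_derivative
      Gamma z * Gamma (1 - z) * (Digamma z - Digamma (1 - z))) (at z)"
    using nz by (auto intro!: derivative_eq_intros simp: algebra_simps)
  moreover have "((\<lambda>z. of_real pi / sin (of_real pi * z)) has_field_derivative
      - (of_real pi / sin (of_real pi * z) * (of_real pi * cot (of_real pi * z)))) (at z)"
    using s by (auto intro!: derivative_eq_intros simp: cot_def field_simps)
  ultimately have "Gamma z * Gamma (1 - z) * (Digamma z - Digamma (1 - z)) =
     - (of_real pi / sin (of_real pi * z) * (of_real pi * cot (of_real pi * z)))"
    unfolding Gamma_reflection_complex by (rule DERIV_unique)
  hence "of_real pi / sin (of_real pi * z) * (Digamma z - Digamma (1 - z)) =
     of_real pi / sin (of_real pi * z) * (- (of_real pi * cot (of_real pi * z)))"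
    unfolding G by simp
  hence "Digamma z - Digamma (1 - z) = - (of_real pi * cot (of_real pi * z))"
    using s by (subst (asm) mult_left_cancel) auto
  thus ?thesis by (simp add: algebra_simps)
qed

text \<open>The value is \<open>coth (x / 2) / 2 - 1 / x\<close>. It comes from digamma reflection
  at the imaginary point \<open>z = \<i> * x / (2 * pi)\<close>: subtracting the series at
  \<open>1 + z\<close> from that at \<open>1 - z\<close> pairs conjugate terms, and the recurrence
  from \<open>z\<close> to \<open>1 + z\<close> produces the \<open>1 / x\<close>.\<close>

lemma coth_partial_fractions:
  fixes x :: real
  assumes x: "x > 0"
  shows "(\<lambda>k. 2 * x / (x\<^sup>2 + (2 * pi * real (Suc k))\<^sup>2)) sums ((1 + exp (- x)) / (2 * (1 - exp (- x))) - 1 / x)"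
proof -
  define y where "y = x / (2 * pi)"
  have y: "y > 0" using x by (simp add: y_def)
  define z where "z = \<i> * of_real y"
  have z0: "z \<noteq> 0" "1 + z \<noteq> 0" "1 - z \<noteq> 0" using y by (auto simp: z_def complex_eq_iff)
  have zI: "z \<notin> \<int>"
  proof
    assume "z \<in> \<int>"
    then obtain n where "z = of_int n" by (auto elim: Ints_cases)
    hence "Im z = 0" by simp
    thus False using y by (simp add: z_def)
  qed
  have D: "(\<lambda>k. inverse (of_nat (Suc k)) - inverse (w + of_nat k)) sums (Digamma w + euler_mascheroni)"
    if "w \<noteq> 0" for w :: complex
    using summable_sums[OF summable_Digamma[OF that]] by (simp add: Digamma_def)
  have "(\<lambda>k. (inverse (of_nat (Suc k)) - inverse (1 - z + of_nat k)) - (inverse (of_nat (Suc k)) - inverse (1 + z + of_nat k)))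
     sums ((Digamma (1 - z) + euler_mascheroni) - (Digamma (1 + z) + euler_mascheroni))"
    by (intro sums_diff D z0)
  also have "(Digamma (1 - z) + euler_mascheroni) - (Digamma (1 + z) + euler_mascheroni) =
      of_real pi * cot (of_real pi * z) - 1 / z"
    using Digamma_plus1[OF z0(1)] Digamma_reflection[OF zI] by (simp add: add.commute algebra_simps)
  also have "of_real pi * cot (of_real pi * z) = - \<i> * of_real (pi * ((1 + exp (- x)) / (1 - exp (- x))))"
  proof -
    define E where "E = exp (- x / 2)"
    have E: "E > 0" "E < 1" using x by (auto simp: E_def)
    have 1: "\<i> * (of_real pi * z) = complex_of_real (- x / 2)" by (simp add: z_def y_def)
    have e1: "exp (\<i> * (of_real pi * z)) = of_real E" unfolding 1 E_def exp_of_real ..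
    have e2: "exp (- (\<i> * (of_real pi * z))) = of_real (1 / E)" unfolding exp_minus e1 by (simp add: inverse_eq_divide)
    have "cot (of_real pi * z) = ((of_real E + of_real (1 / E)) / 2) / ((of_real E - of_real (1 / E)) / (2 * \<i>))"
      unfolding cot_def sin_exp_eq cos_exp_eq e1 e2 ..
    also have "\<dots> = \<i> * of_real ((E + 1 / E) / (E - 1 / E))"
    proof -
      have "(A / 2) / (B / (2 * \<i>)) = \<i> * (A / B)" for A B :: complex
        by (cases "B = 0") (simp_all add: field_simps)
      thus ?thesis by (simp only: of_real_add of_real_diff of_real_divide)
    qed
    also have "(E + 1 / E) / (E - 1 / E) = - ((1 + E\<^sup>2) / (1 - E\<^sup>2))"
    proof -
      have "E\<^sup>2 < 1" using E by (simp add: power_less_one_iff)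
      hence "1 - E\<^sup>2 \<noteq> 0" by simp
      moreover have "E + 1 / E = (1 + E\<^sup>2) / E" "E - 1 / E = - (1 - E\<^sup>2) / E"
        using E by (simp_all add: field_simps power2_eq_square)
      moreover have "(X / E) / (- Y / E) = - (X / Y)" for X Y using E by simp
      ultimately show ?thesis by (simp only:)
    qed
    also have "E\<^sup>2 = exp (- x)" by (simp add: E_def exp_double[symmetric])
    finally show ?thesis by simp
  qed
  finally have "(\<lambda>k. Im ((inverse (of_nat (Suc k)) - inverse (1 - z + of_nat k)) - (inverse (of_nat (Suc k)) - inverse (1 + z + of_nat k))))
     sums Im (- \<i> * of_real (pi * ((1 + exp (- x)) / (1 - exp (- x)))) - 1 / z)"
    by (rule sums_Im)
  also have "Im (- \<i> * of_real (pi * ((1 + exp (- x)) / (1 - exp (- x)))) - 1 / z) =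
     - (pi * ((1 + exp (- x)) / (1 - exp (- x)))) + 1 / y"
    using y by (simp add: z_def Im_divide power2_eq_square)
  also have "(\<lambda>k. Im ((inverse (of_nat (Suc k)) - inverse (1 - z + of_nat k)) - (inverse (of_nat (Suc k)) - inverse (1 + z + of_nat k)))) =
     (\<lambda>k. - 2 * y / ((real (Suc k))\<^sup>2 + y\<^sup>2))"
    by (rule ext) (simp add: z_def Im_divide inverse_eq_divide add_ac)
  finally have "(\<lambda>k. - 1 / (2 * pi) * (- 2 * y / ((real (Suc k))\<^sup>2 + y\<^sup>2))) sums
      (- 1 / (2 * pi) * (- (pi * ((1 + exp (- x)) / (1 - exp (- x)))) + 1 / y))"
    by (rule sums_mult)
  moreover have "- 1 / (2 * pi) * (- 2 * y / ((real (Suc k))\<^sup>2 + y\<^sup>2)) = 2 * x / (x\<^sup>2 + (2 * pi * real (Suc k))\<^sup>2)" for k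
  proof -
    have "x = 2 * pi * y" by (simp add: y_def)
    hence "x\<^sup>2 + (2 * pi * real (Suc k))\<^sup>2 = (2 * pi)\<^sup>2 * ((real (Suc k))\<^sup>2 + y\<^sup>2)"
      by (simp only: power_mult_distrib) (simp add: algebra_simps)
    hence "2 * x / (x\<^sup>2 + (2 * pi * real (Suc k))\<^sup>2) = 2 * (2 * pi * y) / ((2 * pi)\<^sup>2 * ((real (Suc k))\<^sup>2 + y\<^sup>2))"
      using \<open>x = _\<close> by simp
    also have "\<dots> = - 1 / (2 * pi) * (- 2 * y / ((real (Suc k))\<^sup>2 + y\<^sup>2))"
      by (simp only: power2_eq_square[of "2 * pi"] mult.assoc) simp
    finally show ?thesis by simp
  qed
  moreover have "- 1 / (2 * pi) * (- (pi * ((1 + exp (- x)) / (1 - exp (- x)))) + 1 / y) =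
      (1 + exp (- x)) / (2 * (1 - exp (- x))) - 1 / x"
    using x by (simp add: y_def field_simps)
  ultimately show ?thesis by simp
qed

text \<open>
  The Peano kernel form of the error of the trapezoidal rule for \<open>u powr p\<close> on \<open>[n, n + 1]\<close>.
\<close>

lemma nn_integral_trapezoid_kernel:
  fixes p :: real
  assumes p: "0 < p" "p < 1"
  shows "(\<integral>\<^sup>+t. ennreal (p * (1 - p) / 2 * (t * (1 - t) * (real n + t) powr (p - 2))) * indicator {0..1} t \<partial>lborel)
    = ennreal (((real n + 1) powr (p + 1) - real n powr (p + 1)) / (p + 1) - (real n powr p + (real n + 1) powr p) / 2)"
proof -
  \<comment> \<open>Two integrations by parts give this antiderivative. The product
    \<open>t * (real n + t) powr (p - 1)\<close> is written as a difference, so that for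
    \<open>n = 0\<close> the part that is singular at 0 carries the factor 0. The integrand itself
    may be singular at 0, hence the interior form of the fundamental theorem.\<close>
  define h where "h = (\<lambda>t. - p * (1 - t) / 2 * ((real n + t) powr p - real n * (real n + t) powr (p - 1))
     + (1 - 2 * t) / 2 * (real n + t) powr p + (real n + t) powr (p + 1) / (p + 1))"
  have "((\<lambda>t. p * (1 - p) / 2 * (t * (1 - t) * (real n + t) powr (p - 2))) has_integral (h 1 - h 0)) {0..1}"
  proof (rule fundamental_theorem_of_calculus_interior)
    define A where "A = (\<lambda>t. (real n + t) powr p)"
    define B where "B = (\<lambda>t. real n * (real n + t) powr (p - 1))"
    define D where "D = (\<lambda>t. (real n + t) powr (p + 1))"
    have c: "continuous_on {0..1} A" "continuous_on {0..1} D"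
      unfolding A_def D_def by (intro continuous_on_powr' continuous_intros; use p in auto)+
    have "continuous_on {0..1} B"
    proof (cases "n = 0")
      case False
      hence "real n + t \<noteq> 0" if "t \<in> {0..1}" for t using that by auto
      thus ?thesis unfolding B_def by (intro continuous_intros) auto
    qed (auto simp: B_def)
    moreover have "h = (\<lambda>t. - p * (1 - t) / 2 * (A t - B t) + (1 - 2 * t) / 2 * A t + D t / (p + 1))"
      by (simp add: h_def A_def B_def D_def)
    ultimately show "continuous_on {0..1} h" using p c
      by (auto intro!: continuous_intros)
    fix t :: real assume t: "t \<in> {0<..<1}"
    define w where "w = real n + t"
    have w: "w > 0" using t by (simp add: w_def add_nonneg_pos)
    have "(h has_real_derivative
       (p / 2 * (w powr p - real n * w powr (p - 1)) - p * (1 - t) / 2 * (p * w powr (p - 1) - real n * ((p - 1) * w powr (p - 2))))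
       + (- (w powr p) + (1 - 2 * t) / 2 * (p * w powr (p - 1))) + w powr p) (at t)"
    proof -
      have dA: "((\<lambda>t. (real n + t) powr r) has_real_derivative r * w powr (r - 1)) (at t)" for r
        using w unfolding w_def by (auto intro!: derivative_eq_intros)
      have e: "p - 1 - 1 = p - 2" "p + 1 - 1 = p" by simp_all
      have "(h has_real_derivative
         ((p / 2) * (w powr p - real n * w powr (p - 1)) + (p * w powr (p - 1) - real n * ((p - 1) * w powr (p - 1 - 1))) * (- p * (1 - t) / 2))
         + ((- 1) * w powr p + (p * w powr (p - 1)) * ((1 - 2 * t) / 2)) + (p + 1) * w powr (p + 1 - 1) / (p + 1)) (at t)"
        unfolding h_def w_def
        by (intro DERIV_add DERIV_mult DERIV_diff DERIV_cdivide DERIV_cmult dA[unfolded w_def])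
           (auto intro!: derivative_eq_intros)
      moreover have eq: "((p / 2) * (X - real n * Y) + (p * Y - real n * ((p - 1) * V)) * (- p * (1 - t) / 2))
         + ((- 1) * X + (p * Y) * ((1 - 2 * t) / 2)) + (p + 1) * X / (p + 1)
         = (p / 2 * (X - real n * Y) - p * (1 - t) / 2 * (p * Y - real n * ((p - 1) * V)))
       + (- X + (1 - 2 * t) / 2 * (p * Y)) + X" for X Y V
        using p by (simp add: field_simps)
      ultimately show ?thesis unfolding e eq by blast
    qed
    also have "(p / 2 * (w powr p - real n * w powr (p - 1)) - p * (1 - t) / 2 * (p * w powr (p - 1) - real n * ((p - 1) * w powr (p - 2))))
       + (- (w powr p) + (1 - 2 * t) / 2 * (p * w powr (p - 1))) + w powr p = p * (1 - p) / 2 * (t * (1 - t) * w powr (p - 2))"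
    proof -
      define W where "W = w powr (p - 2)"
      have W1: "w powr (p - 1) = w * W" using w by (simp add: W_def powr_diff power2_eq_square)
      have W2: "w powr p = w * (w * W)" using w by (simp add: W_def powr_diff power2_eq_square)
      have n: "real n = w - t" by (simp add: w_def)
      show ?thesis unfolding W1 W2 W_def[symmetric] n by (simp add: field_simps)
    qed
    finally show "(h has_vector_derivative p * (1 - p) / 2 * (t * (1 - t) * (real n + t) powr (p - 2))) (at t)"
      by (simp add: has_real_derivative_iff_has_vector_derivative w_def)
  qed simp
  from nn_integral_has_integral_lebesgue'[OF _ this]
  have "(\<integral>\<^sup>+t. ennreal (p * (1 - p) / 2 * (t * (1 - t) * (real n + t) powr (p - 2))) * indicator {0..1} t \<partial>lborel)
    = ennreal (h 1 - h 0)" using p by simp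
  also have "h 1 - h 0 = ((real n + 1) powr (p + 1) - real n powr (p + 1)) / (p + 1) - (real n powr p + (real n + 1) powr p) / 2"
  proof -
    have "real n powr p - real n * real n powr (p - 1) = 0"
      by (cases "n = 0") (auto simp: powr_diff)
    thus ?thesis by (simp add: h_def add_divide_distrib diff_divide_distrib add.commute)
  qed
  finally show ?thesis .
qed

text \<open>The factor \<open>1 - exp (- x)\<close> is split off on purpose: it cancels against the
  geometric series over \<open>n\<close> and leaves the function expanded in
  \<open>coth_partial_fractions\<close>.\<close>

lemma nn_integral_exp_kernel:
  fixes x :: real
  assumes x: "x > 0"
  shows "(\<integral>\<^sup>+t. ennreal (t * (1 - t) * exp (- (t * x))) * indicator {0..1} t \<partial>lborel)
    = ennreal (2 / x\<^sup>2 * (1 - exp (- x)) * ((1 + exp (- x)) / (2 * (1 - exp (- x))) - 1 / x))"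
proof -
  define g where "g = (\<lambda>t. exp (- (t * x)) * (- (t * (1 - t)) / x - (1 - 2 * t) / x\<^sup>2 + 2 / x ^ 3))"
  have "((\<lambda>t. t * (1 - t) * exp (- (t * x))) has_integral (g 1 - g 0)) {0..1}"
  proof (rule fundamental_theorem_of_calculus)
    fix t :: real
    have "(g has_real_derivative (t * (1 - t) * exp (- (t * x)))) (at t within {0..1})"
      unfolding g_def using x
      by (auto intro!: derivative_eq_intros simp: field_simps power2_eq_square power3_eq_cube)
    thus "(g has_vector_derivative t * (1 - t) * exp (- (t * x))) (at t within {0..1})"
      by (simp add: has_real_derivative_iff_has_vector_derivative)
  qed simp
  from nn_integral_has_integral_lebesgue'[OF _ this]
  have "(\<integral>\<^sup>+t. ennreal (t * (1 - t) * exp (- (t * x))) * indicator {0..1} t \<partial>lborel) = ennreal (g 1 - g 0)"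
    by simp
  also have "g 1 - g 0 = 2 / x\<^sup>2 * (1 - exp (- x)) * ((1 + exp (- x)) / (2 * (1 - exp (- x))) - 1 / x)"
  proof -
    define E where "E = exp (- x)"
    have "1 - E \<noteq> 0" using x by (simp add: E_def)
    thus ?thesis using x unfolding g_def mult_1 E_def[symmetric]
      by (simp add: divide_simps power2_eq_square power3_eq_cube) (simp add: algebra_simps)
  qed
  finally show ?thesis .
qed

lemma suminf_exp_geometric:
  fixes x :: real
  assumes x: "x > 0"
  shows "(\<Sum>n. ennreal (exp (- (real n * x)))) = ennreal (1 / (1 - exp (- x)))"
proof -
  have "(\<lambda>n. exp (- x) ^ n) sums (1 / (1 - exp (- x)))" using x by (intro geometric_sums) auto
  hence "(\<lambda>n. exp (- (real n * x))) sums (1 / (1 - exp (- x)))" by (simp add: exp_of_nat_mult[symmetric])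
  thus ?thesis by (intro suminf_ennreal_eq) auto
qed

text \<open>
  The Peano kernel is nonnegative, so Tonelli's theorem justifies every interchange: inserting the Gamma
  integral for \<open>(n + t) powr (p - 2)\<close> and summing the geometric series over \<open>n\<close> leaves a hyperbolic cotangent,
  whose partial fractions produce the series for \<open>\<zeta>(1 + p)\<close>.
\<close>

lemma trapezoid_errors_sum:
  fixes p :: real
  assumes p: "0 < p" "p < 1"
  defines "d \<equiv> (\<lambda>n. ((real n + 1) powr (p + 1) - real n powr (p + 1)) / (p + 1) - (real n powr p + (real n + 1) powr p) / 2)"
  shows "d sums (2 * Gamma (1 + p) * sin (pi * p / 2) * (2 * pi) powr (- p - 1) * (\<Sum>k. real (Suc k) powr (- p - 1)))"
proof -
  \<comment> \<open>The constant of the Peano kernel, divided by the Gamma value that appears when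
    \<open>(n + t) powr (p - 2)\<close> is written as a Gamma integral.\<close>
  define \<kappa> where "\<kappa> = p * (1 - p) / 2 / Gamma (2 - p)"
  have Gpos: "Gamma (2 - p) > 0" "Gamma (1 - p) > 0" using p by (auto intro!: Gamma_real_pos)
  have \<kappa>: "\<kappa> > 0" using p Gpos by (simp add: \<kappa>_def)
  \<comment> \<open>The kernel identity holds in \<open>ennreal\<close>, which would turn a negative
    \<open>d n\<close> into 0. So the sign is obtained by showing that the integral of the kernel
    does not vanish.\<close>
  have d0: "d n \<ge> 0" for n
  proof -
    define h where "h = (\<lambda>t. p * (1 - p) / 2 * (t * (1 - t) * (real n + t) powr (p - 2)))"
    show ?thesis
    proof (rule ccontr)
      assume "\<not> d n \<ge> 0"
      hence "ennreal (d n) = 0" by (simp add: ennreal_neg)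
      hence "(\<integral>\<^sup>+t. ennreal (h t) * indicator {0..1} t \<partial>lborel) = 0"
        using nn_integral_trapezoid_kernel[OF p, of n] by (simp add: h_def d_def)
      hence "AE t in lborel. ennreal (h t) * indicator {0..1} t = 0"
        by (subst (asm) nn_integral_0_iff_AE) (auto simp: h_def)
      hence "AE t in lborel. t \<notin> {0<..<1::real}"
      proof (rule AE_mp, intro AE_I2 impI)
        fix t assume *: "ennreal (h t) * indicator {0..1} t = 0"
        show "t \<notin> {0<..<1::real}"
        proof
          assume t: "t \<in> {0<..<1::real}"
          hence "h t > 0" using p unfolding h_def by (intro mult_pos_pos) (auto simp: add_nonneg_pos)
          thus False using * t by (simp add: indicator_def)
        qed
      qed
      hence "emeasure lborel {t\<in>space lborel. \<not> (t \<notin> {0<..<1::real})} = 0"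
        by (subst (asm) AE_iff_measurable[OF _ refl]) auto
      also have "{t\<in>space lborel. \<not> (t \<notin> {0<..<1::real})} = {0<..<1}" by auto
      finally show False by simp
    qed
  qed
  \<comment> \<open>The result of integrating out \<open>t\<close>; the index \<open>n\<close>
    survives only in the exponential, ready for the geometric series.\<close>
  define F where "F = (\<lambda>n x. ennreal (\<kappa> * x powr (1 - p)) * ennreal (exp (- (real n * x))) *
     ennreal (2 / x\<^sup>2 * (1 - exp (- x)) * ((1 + exp (- x)) / (2 * (1 - exp (- x))) - 1 / x)) * indicator {0<..} x)"
  have dn: "ennreal (d n) = (\<integral>\<^sup>+x. F n x \<partial>lborel)" for n
  proof -
    define f where "f = (\<lambda>x t. ennreal (\<kappa> * (t * (1 - t)) * (x powr (1 - p) * exp (- ((real n + t) * x)))) * indicator {0<..} x * indicator {0..1} t)"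
    have "ennreal (d n) = (\<integral>\<^sup>+t. (\<integral>\<^sup>+x. f x t \<partial>lborel) \<partial>lborel)"
      unfolding d_def nn_integral_trapezoid_kernel[OF p, of n, symmetric]
    proof (rule nn_integral_cong)
      fix t :: real
      show "ennreal (p * (1 - p) / 2 * (t * (1 - t) * (real n + t) powr (p - 2))) * indicator {0..1} t = (\<integral>\<^sup>+x. f x t \<partial>lborel)"
      proof (cases "t \<in> {0<..1}")
        case True
        hence nt: "real n + t > 0" by (auto simp: add_nonneg_pos)
        have "(\<integral>\<^sup>+x. f x t \<partial>lborel) = (\<integral>\<^sup>+x. ennreal (\<kappa> * (t * (1 - t))) *
            (ennreal (x powr ((2 - p) - 1) * exp (- ((real n + t) * x))) * indicator {0<..} x) \<partial>lborel)"
          unfolding f_def using True \<kappa> by (intro nn_integral_cong) (auto simp: indicator_def ennreal_mult[symmetric])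
        also have "\<dots> = ennreal (\<kappa> * (t * (1 - t))) * (\<integral>\<^sup>+x.
            (ennreal (x powr ((2 - p) - 1) * exp (- ((real n + t) * x))) * indicator {0<..} x) \<partial>lborel)"
          by (rule nn_integral_cmult) auto
        also have "\<dots> = ennreal (\<kappa> * (t * (1 - t))) * ennreal (Gamma (2 - p) * (real n + t) powr (-(2 - p)))"
          using nt p by (subst nn_integral_Gamma) auto
        also have "\<dots> = ennreal (\<kappa> * (t * (1 - t)) * (Gamma (2 - p) * (real n + t) powr (-(2 - p))))"
          using True Gpos \<kappa> by (subst ennreal_mult[symmetric]) (auto intro!: mult_nonneg_nonneg)
        also have "\<kappa> * (t * (1 - t)) * (Gamma (2 - p) * X) = p * (1 - p) / 2 * (t * (1 - t) * X)" for X
          using Gpos by (simp add: \<kappa>_def)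
        also have "- (2 - p) = p - 2" by simp
        finally show ?thesis using True by simp
      qed (auto simp: f_def indicator_def)
    qed
    also have "\<dots> = (\<integral>\<^sup>+x. (\<integral>\<^sup>+t. f x t \<partial>lborel) \<partial>lborel)"
      by (rule lborel_Fubini) (unfold f_def, measurable)
    also have "\<dots> = (\<integral>\<^sup>+x. F n x \<partial>lborel)"
    proof (rule nn_integral_cong)
      fix x :: real
      show "(\<integral>\<^sup>+t. f x t \<partial>lborel) = F n x"
      proof (cases "x > 0")
        case True
        have "(\<integral>\<^sup>+t. f x t \<partial>lborel) = (\<integral>\<^sup>+t. ennreal (\<kappa> * x powr (1 - p)) * ennreal (exp (- (real n * x))) *
             (ennreal (t * (1 - t) * exp (- (t * x))) * indicator {0..1} t) \<partial>lborel)"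
        proof (rule nn_integral_cong)
          fix t :: real
          have "\<kappa> * (t * (1 - t)) * (x powr (1 - p) * exp (- ((real n + t) * x))) =
              \<kappa> * x powr (1 - p) * exp (- (real n * x)) * (t * (1 - t) * exp (- (t * x)))"
            by (simp add: ring_distribs exp_add[symmetric] exp_diff exp_minus) (simp add: exp_add field_simps)
          thus "f x t = ennreal (\<kappa> * x powr (1 - p)) * ennreal (exp (- (real n * x))) *
             (ennreal (t * (1 - t) * exp (- (t * x))) * indicator {0..1} t)"
            unfolding f_def using True \<kappa> by (auto simp: indicator_def ennreal_mult[symmetric])
        qed
        also have "\<dots> = ennreal (\<kappa> * x powr (1 - p)) * ennreal (exp (- (real n * x))) *
            (\<integral>\<^sup>+t. ennreal (t * (1 - t) * exp (- (t * x))) * indicator {0..1} t \<partial>lborel)"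
          by (rule nn_integral_cmult) auto
        finally show ?thesis unfolding nn_integral_exp_kernel[OF True] using True by (simp add: F_def)
      qed (auto simp: F_def f_def)
    qed
    finally show ?thesis .
  qed
  define G where "G = (\<lambda>k x. ennreal (4 * \<kappa>) * (ennreal (x powr (- p) / (x\<^sup>2 + (2 * pi * real (Suc k))\<^sup>2)) * indicator {0<..} x))"
  have FG: "(\<Sum>n. F n x) = (\<Sum>k. G k x)" for x
  proof (cases "x > 0")
    case True
    define c where "c = (1 + exp (- x)) / (2 * (1 - exp (- x))) - 1 / x"
    have cs: "(\<lambda>k. 2 * x / (x\<^sup>2 + (2 * pi * real (Suc k))\<^sup>2)) sums c"
      unfolding c_def by (rule coth_partial_fractions[OF True])
    have c0: "c \<ge> 0" by (rule sums_le[OF _ sums_zero cs]) (use True in auto)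
    have E: "1 - exp (- x) > 0" using True by simp
    have "(\<Sum>n. F n x) = (\<Sum>n. ennreal (\<kappa> * x powr (1 - p)) * (ennreal (exp (- (real n * x))) *
       ennreal (2 / x\<^sup>2 * (1 - exp (- x)) * c)))"
      unfolding F_def c_def using True by (simp add: mult.assoc)
    also have "\<dots> = ennreal (\<kappa> * x powr (1 - p)) * (ennreal (1 / (1 - exp (- x))) * ennreal (2 / x\<^sup>2 * (1 - exp (- x)) * c))"
      by (simp only: ennreal_suminf_cmult ennreal_suminf_multc suminf_exp_geometric[OF True])
    also have "\<dots> = ennreal (\<kappa> * x powr (1 - p) * (1 / (1 - exp (- x)) * (2 / x\<^sup>2 * (1 - exp (- x)) * c)))"
    proof -
      have "ennreal A * (ennreal B * ennreal C) = ennreal (A * (B * C))" if "A \<ge> 0" "B \<ge> 0" "C \<ge> 0" for A B C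
        using that by (simp add: ennreal_mult)
      thus ?thesis using E c0 \<kappa> True by (simp del: times_divide_eq_right times_divide_eq_left)
    qed
    also have "\<kappa> * x powr (1 - p) * (1 / (1 - exp (- x)) * (2 / x\<^sup>2 * (1 - exp (- x)) * c)) = \<kappa> * x powr (1 - p) * (2 / x\<^sup>2) * c"
    proof -
      have *: "A * (1 / B * (2 / x\<^sup>2 * B * c)) = A * (2 / x\<^sup>2) * c" if "B \<noteq> 0" for A B
        using that by simp
      show ?thesis by (rule *) (use E in simp)
    qed
    also have "\<dots> = (\<Sum>k. ennreal (\<kappa> * x powr (1 - p) * (2 / x\<^sup>2) * (2 * x / (x\<^sup>2 + (2 * pi * real (Suc k))\<^sup>2))))"
      by (rule suminf_ennreal_eq[OF _ sums_mult[OF cs], symmetric]) (use \<kappa> True in auto)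
    also have "\<dots> = (\<Sum>k. G k x)"
    proof (rule suminf_cong)
      fix k
      have "x powr (1 - p) * (2 / x\<^sup>2) * (2 * x / A) = 4 * (x powr (- p) / A)" for A
        using True by (simp add: powr_diff powr_minus power2_eq_square field_simps)
      hence "\<kappa> * x powr (1 - p) * (2 / x\<^sup>2) * (2 * x / A) = 4 * \<kappa> * (x powr (- p) / A)" for A
        by (metis (no_types, opaque_lifting) mult.assoc mult.commute)
      thus "ennreal (\<kappa> * x powr (1 - p) * (2 / x\<^sup>2) * (2 * x / (x\<^sup>2 + (2 * pi * real (Suc k))\<^sup>2))) = G k x"
        unfolding G_def using True \<kappa> by (simp only: ) (simp add: ennreal_mult[symmetric])
    qed
    finally show ?thesis .
  qed (auto simp: F_def G_def)
  define e where "e = (\<lambda>k. 4 * \<kappa> * (pi / (2 * cos (pi * p / 2)) * (2 * pi * real (Suc k)) powr (- p - 1)))"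
  have cosp: "cos (pi * p / 2) > 0" using p by (intro cos_gt_zero) (auto simp: field_simps)
  have Gk: "(\<integral>\<^sup>+x. G k x \<partial>lborel) = ennreal (e k)" for k
  proof -
    have "(\<integral>\<^sup>+x. G k x \<partial>lborel) = ennreal (4 * \<kappa>) * (\<integral>\<^sup>+x. ennreal (x powr (- p) / (x\<^sup>2 + (2 * pi * real (Suc k))\<^sup>2)) * indicator {0<..} x \<partial>lborel)"
      unfolding G_def by (rule nn_integral_cmult) auto
    also have "\<dots> = ennreal (e k)"
      using \<kappa> cosp unfolding e_def
      by (subst nn_integral_powr_over_quadratic[OF p]) (auto simp: ennreal_mult[symmetric])
    finally show ?thesis .
  qed
  have "(\<Sum>n. ennreal (d n)) = (\<integral>\<^sup>+x. (\<Sum>n. F n x) \<partial>lborel)"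
    unfolding dn by (rule nn_integral_suminf[symmetric]) (auto simp: F_def)
  also have "\<dots> = (\<integral>\<^sup>+x. (\<Sum>k. G k x) \<partial>lborel)" by (simp only: FG)
  also have "\<dots> = (\<Sum>k. ennreal (e k))"
    unfolding Gk[symmetric] by (rule nn_integral_suminf) (auto simp: G_def)
  finally have de: "(\<Sum>n. ennreal (d n)) = (\<Sum>k. ennreal (e k))" .
  have sz: "summable (\<lambda>k. real (Suc k) powr (- p - 1))"
    using summable_real_powr_iff[of "- p - 1"] p by (subst summable_Suc_iff) auto
  define S where "S = 2 * Gamma (1 + p) * sin (pi * p / 2) * (2 * pi) powr (- p - 1)"
  \<comment> \<open>The recurrence and the reflection formula turn \<open>Gamma (2 - p)\<close> into
    \<open>Gamma (1 + p) * sin (pi * p)\<close>; the double-angle formula then cancels the cosine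
    that stems from the integral over \<open>x\<close>.\<close>
  have eS: "e k = S * real (Suc k) powr (- p - 1)" for k
  proof -
    have nI: "1 - p \<notin> \<int>\<^sub>\<le>\<^sub>0" "p \<notin> \<int>\<^sub>\<le>\<^sub>0" using p by (auto dest!: nonpos_Ints_nonpos)
    have "Gamma (2 - p) = (1 - p) * Gamma (1 - p)"
      using Gamma_plus1[OF nI(1)] by (simp add: algebra_simps)
    hence "4 * \<kappa> = 2 * p / Gamma (1 - p)" using p by (simp add: \<kappa>_def)
    moreover have "p / Gamma (1 - p) = Gamma (1 + p) * sin (pi * p) / pi"
    proof -
      have "Gamma (1 + p) = p * Gamma p" using Gamma_plus1[OF nI(2)] by (simp add: add.commute)
      moreover have "sin (pi * p) > 0" using p by (intro sin_gt_zero) auto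
      moreover from this have "Gamma p * Gamma (1 - p) * sin (pi * p) = pi"
        using Gamma_reflection_real[of p] by simp
      ultimately have "p * pi = Gamma (1 + p) * sin (pi * p) * Gamma (1 - p)"
        by (simp add: mult_ac)
      thus ?thesis using Gpos by (simp add: divide_eq_eq eq_divide_eq)
    qed
    moreover have "sin (pi * p) = 2 * sin (pi * p / 2) * cos (pi * p / 2)"
      using sin_double[of "pi * p / 2"] by simp
    ultimately have "4 * \<kappa> = 2 * (Gamma (1 + p) * (2 * sin (pi * p / 2) * cos (pi * p / 2)) / pi)"
      by (metis times_divide_eq_right)
    hence "4 * \<kappa> * (pi / (2 * cos (pi * p / 2))) = 2 * Gamma (1 + p) * sin (pi * p / 2)"
      using cosp by simp
    moreover have "(2 * pi * real (Suc k)) powr (- p - 1) = (2 * pi) powr (- p - 1) * real (Suc k) powr (- p - 1)"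
      by (rule powr_mult)
    ultimately show ?thesis unfolding e_def S_def by (simp only: mult.assoc[symmetric])
  qed
  have es: "e sums (S * (\<Sum>k. real (Suc k) powr (- p - 1)))"
    unfolding eS[abs_def] by (intro sums_mult summable_sums sz)
  have e0: "e k \<ge> 0" for k using \<kappa> cosp by (simp add: e_def)
  have v: "(\<Sum>k. ennreal (e k)) = ennreal (S * (\<Sum>k. real (Suc k) powr (- p - 1)))"
    by (rule suminf_ennreal_eq[OF e0 es])
  have "summable d" by (rule summable_suminf_not_top[OF d0]) (simp add: de v)
  moreover have "ennreal (suminf d) = ennreal (S * (\<Sum>k. real (Suc k) powr (- p - 1)))"
    using suminf_ennreal2[OF d0 \<open>summable d\<close>] de v by simp
  hence "suminf d = S * (\<Sum>k. real (Suc k) powr (- p - 1))"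
    using sums_le[OF _ sums_zero es] e0 suminf_nonneg[OF \<open>summable d\<close> d0] by (subst (asm) ennreal_inj) auto
  ultimately show ?thesis unfolding S_def by (simp add: sums_iff)
qed


section \<open>Continuation to the plane\<close>

text \<open>
  The right-hand side of the functional equation, multiplied by \<open>s - 1\<close>.
\<close>

definition zeta_left :: "complex \<Rightarrow> complex" where
  "zeta_left s = (s - 1) * (2 * of_real (2 * pi) powr (s - 1) * sin (of_real pi * s / 2) * Gamma (1 - s))
     * (zeta_right (1 - s) / (- s))"

lemma zeta_left_holomorphic: "zeta_left holomorphic_on {s. Re s < 0}"
proof -
  have "(\<lambda>s. zeta_right (1 - s)) holomorphic_on {s. Re s < 0}"
    by (rule holomorphic_on_compose_gen[OF _ zeta_right_holomorphic, unfolded o_def])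
       (auto intro!: holomorphic_intros)
  moreover have "1 - s \<notin> \<int>\<^sub>\<le>\<^sub>0" if "s \<in> {s. Re s < 0}" for s
    using that by (auto elim!: nonpos_Ints_cases simp: complex_eq_iff)
  ultimately show ?thesis unfolding zeta_left_def
    by (intro holomorphic_intros) auto
qed

text \<open>At \<open>s = - p\<close> the trapezoid term of index \<open>n\<close> is
  \<open>(p + 1) * d (Suc n)\<close>. The missing error \<open>d 0\<close> on the unit interval
  accounts exactly for the summand \<open>1 + (s - 1) / 2\<close> in \<open>zeta_right\<close>, so
  the full sum of errors appears.\<close>

lemma zeta_right_eq_left_real:
  fixes p :: real
  assumes p: "0 < p" "p < 1 / 2"
  shows "zeta_right (- of_real p) = zeta_left (- of_real p)"
proof -
  define d where "d = (\<lambda>n. ((real n + 1) powr (p + 1) - real n powr (p + 1)) / (p + 1) - (real n powr p + (real n + 1) powr p) / 2)"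
  define S where "S = (\<Sum>k. real (Suc k) powr (- p - 1))"
  have ds: "d sums (2 * Gamma (1 + p) * sin (pi * p / 2) * (2 * pi) powr (- p - 1) * S)"
    unfolding d_def S_def using p by (intro trapezoid_errors_sum) auto
  have pw: "of_nat n powr complex_of_real r = complex_of_real (real n powr r)" for n r
    using powr_of_real[of "real n" r] by simp
  have tt: "trapezoid_term n (- of_real p) = of_real ((p + 1) * d (Suc n))" for n
  proof -
    have "trapezoid_term n (- of_real p) = of_real ((- p - 1) * (real (Suc n) powr p + real (Suc (Suc n)) powr p) / 2
        - real (Suc n) powr (1 + p) + real (Suc (Suc n)) powr (1 + p))"
    proof -
      have "1 - (- complex_of_real p) = of_real (1 + p)" "- (- complex_of_real p) = of_real p" by simp_all
      thus ?thesis unfolding trapezoid_term_def by (simp only: pw) (simp del: of_nat_Suc)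
    qed
    also have "(- p - 1) * (real (Suc n) powr p + real (Suc (Suc n)) powr p) / 2
        - real (Suc n) powr (1 + p) + real (Suc (Suc n)) powr (1 + p) = (p + 1) * d (Suc n)"
    proof -
      have "real (Suc (Suc n)) = real (Suc n) + 1" by simp
      moreover have "(- p - 1) * (X + Y) / 2 - U + V = (p + 1) * ((V - U) / (p + 1) - (X + Y) / 2)" for X Y U V
        using p by (simp add: field_simps)
      ultimately show ?thesis by (simp only: d_def add.commute[of p 1])
    qed
    finally show ?thesis .
  qed
  have "(\<lambda>n. trapezoid_term n (- of_real p)) sums of_real ((p + 1) * (suminf d - d 0))"
    unfolding tt using sums_split_initial_segment[OF ds, of 1] ds
    by (intro sums_of_real sums_mult) (simp add: sums_iff)
  hence "zeta_right (- of_real p) = 1 + (- of_real p - 1) / 2 + of_real ((p + 1) * (suminf d - d 0))"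
    by (simp add: zeta_right_def sums_iff)
  also have "\<dots> = of_real ((p + 1) * suminf d)"
  proof -
    have "d 0 = 1 / (p + 1) - 1 / 2" using p by (simp add: d_def)
    hence "1 + (- p - 1) / 2 + (p + 1) * (suminf d - d 0) = (p + 1) * suminf d"
      using p by (simp add: field_simps)
    from this[symmetric] show ?thesis by (simp only: of_real_add of_real_divide of_real_diff of_real_minus of_real_1 of_real_numeral)
  qed
  also have "suminf d = 2 * Gamma (1 + p) * sin (pi * p / 2) * (2 * pi) powr (- p - 1) * S"
    using ds by (simp add: sums_iff)
  finally have L: "zeta_right (- of_real p) = of_real ((p + 1) * (2 * Gamma (1 + p) * sin (pi * p / 2) * (2 * pi) powr (- p - 1) * S))" .
  have "(\<lambda>n. of_nat (Suc n) powr (- (1 + complex_of_real p))) sums (zeta_right (1 + of_real p) / of_real p)"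
    using Dirichlet_series_sums_zeta_right[of "1 + of_real p"] p by simp
  moreover have "of_nat (Suc n) powr (- (1 + complex_of_real p)) = of_real (real (Suc n) powr (- p - 1))" for n
  proof -
    have "- (1 + complex_of_real p) = of_real (- p - 1)" by simp
    thus ?thesis by (simp only: pw)
  qed
  ultimately have "(\<lambda>n. complex_of_real (real (Suc n) powr (- p - 1))) sums (zeta_right (1 + of_real p) / of_real p)" by (simp only:)
  moreover have "summable (\<lambda>k. real (Suc k) powr (- p - 1))"
    using summable_real_powr_iff[of "- p - 1"] p by (subst summable_Suc_iff) auto
  hence "(\<lambda>n. complex_of_real (real (Suc n) powr (- p - 1))) sums of_real S"
    unfolding S_def by (intro sums_of_real summable_sums)
  ultimately have R: "zeta_right (1 + of_real p) / of_real p = of_real S" using sums_unique2 by blast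
  have "of_real (2 * pi) powr (- of_real p - 1) = complex_of_real ((2 * pi) powr (- p - 1))"
    using powr_of_real[of "2 * pi" "- p - 1"] by simp
  moreover have "sin (of_real pi * (- of_real p) / 2) = complex_of_real (- sin (pi * p / 2))"
    by (simp flip: sin_of_real)
  moreover have "Gamma (1 - (- of_real p)) = complex_of_real (Gamma (1 + p))"
    by (simp flip: Gamma_complex_of_real)
  ultimately show ?thesis unfolding L zeta_left_def using R by (simp add: algebra_simps)
qed

lemma zeta_right_eq_left:
  assumes s: "- 1 / 2 < Re s" "Re s < 0"
  shows "zeta_right s = zeta_left s"
proof -
  define S where "S = {s. - 1 / 2 < Re s} \<inter> {s. Re s < 0}"
  define U where "U = (\<lambda>p. - complex_of_real p) ` {0<..<1/2}"
  have "zeta_right s - zeta_left s = 0"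
  proof (rule analytic_continuation[of "\<lambda>s. zeta_right s - zeta_left s" S U "- 1 / 4"])
    show "(\<lambda>s. zeta_right s - zeta_left s) holomorphic_on S"
      by (intro holomorphic_intros holomorphic_on_subset[OF zeta_right_holomorphic]
           holomorphic_on_subset[OF zeta_left_holomorphic]) (auto simp: S_def)
    show "open S" unfolding S_def by (intro open_Int open_halfspace_Re_gt open_halfspace_Re_lt)
    show "connected S" unfolding S_def
      by (intro convex_connected convex_Int convex_halfspace_Re_gt convex_halfspace_Re_lt)
    show "- 1 / 4 islimpt U" unfolding islimpt_approachable
    proof (intro allI impI)
      fix e :: real assume e: "e > 0"
      define m where "m = min (e / 2) (1 / 8)"
      have m: "0 < m" "m < e" "m \<le> 1 / 8" using e by (auto simp: m_def)
      show "\<exists>x'\<in>U. x' \<noteq> - 1 / 4 \<and> dist x' (- 1 / 4) < e"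
      proof (intro bexI[of _ "- complex_of_real (1 / 4 + m)"] conjI)
        have "dist (- complex_of_real (1 / 4 + m)) (- 1 / 4) = cmod (of_real (- m))"
          unfolding dist_norm by (rule arg_cong[where f = cmod]) simp
        thus "dist (- complex_of_real (1 / 4 + m)) (- 1 / 4) < e" using m by (simp only: norm_of_real)
        show "- complex_of_real (1 / 4 + m) \<in> U" unfolding U_def using m by (intro imageI) auto
      qed (use m in \<open>auto simp: complex_eq_iff\<close>)
    qed
  qed (use s zeta_right_eq_left_real in \<open>auto simp: S_def U_def\<close>)
  thus ?thesis by simp
qed

text \<open>Again \<open>(s - 1) * zeta s\<close>, now on the whole plane: the two formulas agree on
  the strip \<open>- 1 / 2 < Re s < 0\<close>.\<close>

definition entire_zeta :: "complex \<Rightarrow> complex" where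
  "entire_zeta s = (if Re s > - 1 / 2 then zeta_right s else zeta_left s)"

lemma entire_zeta_left: "Re s < 0 \<Longrightarrow> entire_zeta s = zeta_left s"
  using zeta_right_eq_left[of s] by (auto simp: entire_zeta_def)

lemma entire_zeta_holomorphic: "entire_zeta holomorphic_on UNIV"
proof -
  have "entire_zeta holomorphic_on {s. Re s > - 1 / 2}"
    using zeta_right_holomorphic by (subst holomorphic_cong[OF refl, of _ _ zeta_right]) (auto simp: entire_zeta_def)
  moreover have "entire_zeta holomorphic_on {s. Re s < 0}"
    using zeta_left_holomorphic by (subst holomorphic_cong[OF refl, of _ _ zeta_left]) (auto simp: entire_zeta_left)
  ultimately have "entire_zeta holomorphic_on ({s. Re s > - 1 / 2} \<union> {s. Re s < 0})"
    by (intro holomorphic_on_Un open_halfspace_Re_gt open_halfspace_Re_lt)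
  moreover have "{s. Re s > - 1 / 2} \<union> {s. Re s < 0} = UNIV" by auto
  ultimately show ?thesis by simp
qed

lemma entire_zeta_1: "entire_zeta 1 = 1"
  by (simp add: entire_zeta_def zeta_right_1)

text \<open>The construction satisfies the description that defines \<open>zeta\<close>. Uniqueness
  is the identity theorem on the connected punctured plane, applied to the half plane where the
  Dirichlet series converges.\<close>

lemma zeta_eq_entire_zeta: "zeta = (\<lambda>s. if s = 1 then 0 else entire_zeta s / (s - 1))"
  unfolding zeta_def
proof (rule the_equality, intro conjI allI impI)
  let ?z = "\<lambda>s. if s = 1 then 0 else entire_zeta s / (s - 1)"
  show hol: "?z holomorphic_on - {1}"
    by (subst holomorphic_cong[OF refl, of _ _ "\<lambda>s. entire_zeta s / (s - 1)"])
       (auto intro!: holomorphic_intros holomorphic_on_subset[OF entire_zeta_holomorphic])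
  have sums: "(\<lambda>n. of_nat (Suc n) powr (- s)) sums ?z s" if "Re s > 1" for s
    using Dirichlet_series_sums_zeta_right[OF that] that by (auto simp: entire_zeta_def)
  thus "(\<lambda>n. of_nat (Suc n) powr (- s)) sums ?z s" if "Re s > 1" for s using that .
  show "?z 1 = 0" by simp
  fix f assume f: "f holomorphic_on - {1} \<and> (\<forall>s. Re s > 1 \<longrightarrow> (\<lambda>n. of_nat (Suc n) powr (- s)) sums f s) \<and> f 1 = 0"
  show "f = ?z"
  proof
    fix s
    show "f s = ?z s"
    proof (cases "s = 1")
      case False
      have "f s - ?z s = 0"
      proof (rule analytic_continuation[of "\<lambda>s. f s - ?z s" "-{1}" "{s. Re s > 1}" 2])
        show "(\<lambda>s. f s - ?z s) holomorphic_on - {1}" using f hol by (intro holomorphic_intros) auto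
        show "connected (- {1::complex})" by (rule connected_punctured_universe) simp
        show "2 islimpt {s. 1 < Re s}" by (rule interior_limit_point) (simp add: interior_open open_halfspace_Re_gt)
        fix z assume "z \<in> {s. 1 < Re s}"
        hence "(\<lambda>n. of_nat (Suc n) powr (- z)) sums f z" "(\<lambda>n. of_nat (Suc n) powr (- z)) sums ?z z"
          using f sums by auto
        thus "f z - ?z z = 0" using sums_unique2 by auto
      qed (use False in auto)
      thus ?thesis by simp
    qed (use f in auto)
  qed
qed

lemma zeta_conv_entire: "s \<noteq> 1 \<Longrightarrow> zeta s = entire_zeta s / (s - 1)"
  by (simp add: zeta_eq_entire_zeta)

lemma zeta_holomorphic: "zeta holomorphic_on - {1}"
  by (subst holomorphic_cong[OF refl, of _ _ "\<lambda>s. entire_zeta s / (s - 1)"])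
     (auto simp: zeta_conv_entire intro!: holomorphic_intros holomorphic_on_subset[OF entire_zeta_holomorphic])

lemma zeta_sums: "Re s > 1 \<Longrightarrow> (\<lambda>n. of_nat (Suc n) powr (- s)) sums zeta s"
  using Dirichlet_series_sums_zeta_right[of s] by (auto simp: entire_zeta_def zeta_eq_entire_zeta)

lemma zeta_functional_equation:
  assumes "Re s < 0"
  shows "zeta s = 2 * of_real (2 * pi) powr (s - 1) * sin (of_real pi * s / 2) * Gamma (1 - s) * zeta (1 - s)"
proof -
  have "s \<noteq> 1" "1 - s \<noteq> 1" "s \<noteq> 0" using assms by auto
  thus ?thesis using assms entire_zeta_left[of s]
    by (simp add: zeta_conv_entire zeta_left_def entire_zeta_def[of "1 - s"])
qed

text \<open>Reflection principle: the coefficients of the Dirichlet series are real.\<close>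

lemma zeta_cnj: "zeta (cnj s) = cnj (zeta s)"
proof (cases "s = 1")
  case False
  have "cnj (zeta (cnj s)) - zeta s = 0"
  proof (rule analytic_continuation[of "\<lambda>s. cnj (zeta (cnj s)) - zeta s" "-{1}" "{s. Re s > 1}" 2])
    have "(cnj \<circ> zeta \<circ> cnj) holomorphic_on - {1}"
    proof (subst holomorphic_on_compose_cnj_cnj)
      have "x \<in> cnj ` (- {1})" if "x \<noteq> 1" for x
        using that by (intro image_eqI[of _ _ "cnj x"]) auto
      hence "cnj ` (- {1}) = - {1}" by auto
      thus "zeta holomorphic_on cnj ` (- {1})" using zeta_holomorphic by simp
    qed auto
    thus "(\<lambda>s. cnj (zeta (cnj s)) - zeta s) holomorphic_on - {1}"
      using zeta_holomorphic unfolding o_def by (intro holomorphic_intros)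
    show "connected (- {1::complex})" by (rule connected_punctured_universe) simp
    show "2 islimpt {s. 1 < Re s}" by (rule interior_limit_point) (simp add: interior_open open_halfspace_Re_gt)
    fix z assume "z \<in> {s. 1 < Re s}"
    hence z: "Re z > 1" by simp
    have "(\<lambda>n. cnj (of_nat (Suc n) powr (- cnj z))) sums cnj (zeta (cnj z))"
      using zeta_sums[of "cnj z"] z by (simp add: sums_cnj)
    moreover have "cnj (of_nat (Suc n) powr (- cnj z)) = of_nat (Suc n) powr (- z)" for n
      by (subst cnj_powr) (auto simp: complex_nonpos_Reals_iff simp del: of_nat_Suc)
    ultimately show "cnj (zeta (cnj z)) - zeta z = 0" using zeta_sums[OF z] sums_unique2 by auto
  qed (use False in auto)
  hence "cnj (zeta (cnj s)) = zeta s" by simp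
  thus ?thesis by (metis complex_cnj_cnj)
qed (simp add: zeta_eq_entire_zeta)

section \<open>Growth of (s - 1) zeta(s)\<close>

lemma norm_Gamma_le:
  assumes z: "Re z > 0"
  shows "cmod (Gamma z) \<le> Gamma (Re z)"
proof (rule LIMSEQ_le)
  show "(\<lambda>n. cmod (Gamma_series z n)) \<longlonglongrightarrow> cmod (Gamma z)" "Gamma_series (Re z) \<longlonglongrightarrow> Gamma (Re z)"
    by (intro tendsto_intros Gamma_series_LIMSEQ)+
  have "cmod (Gamma_series z n) \<le> Gamma_series (Re z) n" for n
  proof -
    have p: "pochhammer (Re z) (n + 1) > 0" using z by (intro pochhammer_pos)
    have "pochhammer (Re z) (n + 1) = (\<Prod>i<n+1. Re z + real i)" by (simp add: pochhammer_prod atLeast0LessThan)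
    also have "\<dots> \<le> (\<Prod>i<n+1. cmod (z + of_nat i))"
    proof (rule prod_mono, safe)
      fix i show "Re z + real i \<le> cmod (z + of_nat i)" using complex_Re_le_cmod[of "z + of_nat i"] by simp
    qed (use z in auto)
    also have "\<dots> = cmod (pochhammer z (n + 1))" by (simp add: pochhammer_prod prod_norm atLeast0LessThan)
    finally have "fact n * exp (Re z * ln (real n)) / cmod (pochhammer z (n + 1)) \<le> fact n * exp (Re z * ln (real n)) / pochhammer (Re z) (n + 1)"
      using p by (intro divide_left_mono mult_pos_pos) auto
    thus ?thesis by (simp add: Gamma_series_def norm_mult norm_divide)
  qed
  thus "\<exists>N. \<forall>n\<ge>N. cmod (Gamma_series z n) \<le> Gamma_series (Re z) n" by blast
qed

text \<open>A crude substitute for Stirling: compactness on the interval from 1 to 2, then the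
  recurrence. The loss of an exponential factor is harmless for a growth order below 2.\<close>

lemma Gamma_real_le_powr:
  obtains B :: real where "B > 0" "\<And>x. x \<ge> 1 \<Longrightarrow> Gamma x \<le> B * x powr x"
proof -
  have "compact (Gamma ` {1..2::real})"
    by (intro compact_continuous_image continuous_on_Gamma) (auto dest: nonpos_Ints_nonpos)
  then obtain B0 where B0: "\<And>x. x \<in> {1..2} \<Longrightarrow> \<bar>Gamma x\<bar> \<le> (B0 :: real)"
    using compact_imp_bounded[THEN bounded_iff[THEN iffD1]] by (force simp: real_norm_def)
  define B where "B = max 1 B0"
  have "Gamma x \<le> B * x powr x" if "1 \<le> x" "x \<le> real n + 2" for x n
    using that
  proof (induction n arbitrary: x)
    case 0
    have "Gamma x \<le> B" using B0[of x] 0 by (simp add: B_def)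
    also have "B * 1 \<le> B * x powr x"
      using 0 ge_one_powr_ge_zero[of x x] by (intro mult_left_mono) (auto simp: B_def)
    hence "B \<le> B * x powr x" by simp
    finally show ?case .
  next
    case (Suc n)
    show ?case
    proof (cases "x \<le> real n + 2")
      case False
      hence x: "x - 1 \<ge> 1" by simp
      have "Gamma x = (x - 1) * Gamma (x - 1)"
      proof -
        have "x - 1 \<notin> \<int>\<^sub>\<le>\<^sub>0" using x by (auto dest!: nonpos_Ints_nonpos)
        thus ?thesis using Gamma_plus1[of "x - 1"] by simp
      qed
      also have "\<dots> \<le> (x - 1) * (B * (x - 1) powr (x - 1))"
        using x Suc.prems by (intro mult_left_mono Suc.IH) auto
      also have "\<dots> \<le> x * (B * x powr (x - 1))"
        using x by (intro mult_mono powr_mono2) (auto simp: B_def)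
      also have "\<dots> = B * x powr x" using x by (simp add: powr_diff)
      finally show ?thesis .
    qed (use Suc in auto)
  qed
  hence "Gamma x \<le> B * x powr x" if "1 \<le> x" for x
    using that real_arch_simple[of x] by (metis add_increasing2 zero_le_numeral)
  thus ?thesis by (intro that[of B]) (auto simp: B_def)
qed

lemma norm_sin_le_exp: "cmod (sin z) \<le> exp \<bar>Im z\<bar>"
proof -
  have "cmod (sin z) = cmod (exp (- (\<i> * z)) - exp (\<i> * z)) / 2"
    unfolding sin_exp_eq' by (simp add: norm_mult norm_divide)
  also have "\<dots> \<le> (exp (Im z) + exp (- Im z)) / 2"
    using norm_triangle_ineq4[of "exp (- (\<i> * z))" "exp (\<i> * z)"] by (simp add: norm_exp_eq_Re)
  also have "\<dots> \<le> (exp \<bar>Im z\<bar> + exp \<bar>Im z\<bar>) / 2"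
    by (intro divide_right_mono add_mono) auto
  finally show ?thesis by simp
qed

text \<open>The Gamma factor grows like \<open>X powr X\<close>, so the exponent 1 is not enough;
  3/2 absorbs the logarithm through \<open>ln X \<le> 2 * sqrt X\<close> and stays below 2.\<close>

lemma entire_zeta_growth:
  obtains C :: real where "C > 0" "\<And>s. cmod (entire_zeta s) \<le> exp (C * (1 + cmod s) powr (3/2))"
proof -
  obtain K where K: "K > 0" "\<And>s. Re s \<ge> - 1 / 2 \<Longrightarrow> cmod (zeta_right s) \<le> K * (1 + cmod s) ^ 3"
    using zeta_right_bound by blast
  obtain B :: real where B: "B > 0" "\<And>x. x \<ge> 1 \<Longrightarrow> Gamma x \<le> B * x powr x"
    using Gamma_real_le_powr by blast
  \<comment> \<open>On the left, 48 collects the factor 2, the bound 3 for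
    \<open>(s - 1) / (- s)\<close> and the 8 from \<open>(2 * Y) ^ 3\<close>. The 7 in
    \<open>C\<close> adds the exponents 2, 2 and 3 of the sine, Gamma and zeta factors.\<close>
  define A where "A = max 1 (max K (48 * B * K))"
  define C where "C = 7 + ln A"
  have A: "A \<ge> 1" "A \<ge> K" "A \<ge> 48 * B * K" by (auto simp: A_def)
  have C: "C > 0" using A by (simp add: C_def add_pos_nonneg)
  have X: "X \<le> X powr (3/2)" "A \<le> exp (ln A * X powr (3/2))" "X ^ 3 \<le> exp (3 * X powr (3/2))"
     "X powr X \<le> exp (2 * X powr (3/2))" if X1: "X \<ge> 1" for X :: real
  proof -
    show le: "X \<le> X powr (3/2)" using powr_mono[of 1 "3/2" X] X1 by simp
    have "A = exp (ln A * 1)" using A by simp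
    also have "\<dots> \<le> exp (ln A * X powr (3/2))" using A le X1 by (subst exp_le_cancel_iff) (intro mult_left_mono, auto)
    finally show "A \<le> exp (ln A * X powr (3/2))" .
    have "X \<le> exp X" using exp_ge_add_one_self[of X] by linarith
    hence "X ^ 3 \<le> exp X ^ 3" using X1 by (intro power_mono) auto
    also have "\<dots> = exp (3 * X)" by (simp add: exp_of_nat_mult[symmetric])
    also have "\<dots> \<le> exp (3 * X powr (3/2))" using le by simp
    finally show "X ^ 3 \<le> exp (3 * X powr (3/2))" .
    have "ln X = 2 * ln (sqrt X)" using X1 by (simp add: ln_sqrt)
    also have "\<dots> \<le> 2 * sqrt X" using ln_bound[of "sqrt X"] X1 by simp
    finally have "X * ln X \<le> X * (2 * sqrt X)" using X1 by (intro mult_left_mono) auto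
    also have "\<dots> = 2 * X powr (3/2)"
    proof -
      have "X powr (3/2) = X powr (1 + 1/2)" by simp
      also have "\<dots> = X * sqrt X" unfolding powr_add using X1 by (simp add: powr_half_sqrt)
      finally show ?thesis by simp
    qed
    finally show "X powr X \<le> exp (2 * X powr (3/2))" using X1 by (simp add: powr_def)
  qed
  have "cmod (entire_zeta s) \<le> exp (C * (1 + cmod s) powr (3/2))" for s
  proof -
    define Y where "Y = 1 + cmod s"
    have Y: "Y \<ge> 1" by (simp add: Y_def)
    define T where "T = Y powr (3/2)"
    have T: "Y \<le> T" "A \<le> exp (ln A * T)" "Y ^ 3 \<le> exp (3 * T)" "Y powr Y \<le> exp (2 * T)"
      using X[OF Y] by (simp_all add: T_def)
    show ?thesis
    proof (cases "Re s > - 1 / 2")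
      case True
      have "cmod (entire_zeta s) \<le> K * Y ^ 3" using K(2)[of s] True by (simp add: entire_zeta_def Y_def)
      also have "\<dots> \<le> exp (ln A * T) * exp (3 * T)" using T A K(1) Y by (intro mult_mono) auto
      also have "\<dots> \<le> exp (C * T)" using T Y unfolding exp_add[symmetric] C_def by (simp add: algebra_simps)
      finally show ?thesis by (simp add: T_def Y_def)
    next
      case False
      hence Re: "Re s \<le> - 1 / 2" by simp
      have s12: "cmod s \<ge> 1 / 2" using abs_Re_le_cmod[of s] Re by simp
      have "s \<noteq> 0" using Re by auto
      have b1: "cmod ((s - 1) / (- s)) \<le> 3"
      proof -
        have "cmod (s - 1) \<le> cmod s + 1" using norm_triangle_ineq4[of s 1] by simp
        also have "\<dots> \<le> 3 * cmod s" using s12 by simp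
        finally show ?thesis using \<open>s \<noteq> 0\<close> by (simp add: norm_divide divide_simps)
      qed
      have b2: "cmod (of_real (2 * pi) powr (s - 1)) \<le> 1"
      proof -
        have "cmod (of_real (2 * pi) powr (s - 1)) = (2 * pi) powr (Re s - 1)"
          by (subst norm_powr_real_powr) auto
        also have "\<dots> \<le> (2 * pi) powr 0" using Re pi_gt3 by (intro powr_mono) auto
        finally show ?thesis by simp
      qed
      have b3: "cmod (sin (of_real pi * s / 2)) \<le> exp (2 * T)"
      proof -
        have "cmod (sin (of_real pi * s / 2)) \<le> exp \<bar>Im (of_real pi * s / 2)\<bar>" by (rule norm_sin_le_exp)
        also have "\<bar>Im (of_real pi * s / 2)\<bar> = pi / 2 * \<bar>Im s\<bar>" by (simp add: abs_mult)
        also have "\<dots> \<le> 2 * Y" using abs_Im_le_cmod[of s] pi_less_4 by (intro mult_mono) (auto simp: Y_def)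
        also have "\<dots> \<le> 2 * T" using T by simp
        finally show ?thesis by simp
      qed
      have b4: "cmod (Gamma (1 - s)) \<le> B * exp (2 * T)"
      proof -
        have "cmod (Gamma (1 - s)) \<le> Gamma (1 - Re s)" using norm_Gamma_le[of "1 - s"] Re by simp
        also have "\<dots> \<le> B * (1 - Re s) powr (1 - Re s)" using Re by (intro B) auto
        also have "(1 - Re s) powr (1 - Re s) \<le> Y powr (1 - Re s)"
          using Re abs_Re_le_cmod[of s] by (intro powr_mono2) (auto simp: Y_def)
        also have "\<dots> \<le> Y powr Y" using Re abs_Re_le_cmod[of s] Y by (intro powr_mono) (auto simp: Y_def)
        also have "\<dots> \<le> exp (2 * T)" by (rule T)
        finally show ?thesis using B(1) by simp
      qed
      have b5: "cmod (zeta_right (1 - s)) \<le> 8 * K * exp (3 * T)"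
      proof -
        have "cmod (1 - s) \<le> 1 + cmod s" using norm_triangle_ineq4[of 1 s] by simp
        hence "cmod (1 - s) \<le> 1 + 2 * cmod s" using norm_ge_zero[of s] by argo
        hence "K * (1 + cmod (1 - s)) ^ 3 \<le> K * (2 * Y) ^ 3" using K(1) by (intro mult_left_mono power_mono) (auto simp: Y_def)
        also have "\<dots> = 8 * K * Y ^ 3" by (simp add: power_mult_distrib)
        also have "\<dots> \<le> 8 * K * exp (3 * T)" using T K(1) by (intro mult_left_mono) auto
        finally show ?thesis using K(2)[of "1 - s"] Re by simp
      qed
      have "entire_zeta s = 2 * ((s - 1) / (- s)) * of_real (2 * pi) powr (s - 1) * sin (of_real pi * s / 2) * Gamma (1 - s) * zeta_right (1 - s)"
        using False by (simp add: entire_zeta_def zeta_left_def)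
      hence "cmod (entire_zeta s) = 2 * cmod ((s - 1) / (- s)) * cmod (of_real (2 * pi) powr (s - 1))
          * cmod (sin (of_real pi * s / 2)) * cmod (Gamma (1 - s)) * cmod (zeta_right (1 - s))"
        by (simp only: norm_mult norm_numeral)
      also have "\<dots> \<le> 2 * 3 * 1 * exp (2 * T) * (B * exp (2 * T)) * (8 * K * exp (3 * T))"
        using b1 b2 b3 b4 b5 K(1) B(1) by (intro mult_mono mult_nonneg_nonneg) auto
      also have "\<dots> = 48 * B * K * exp (7 * T)" by (simp add: exp_add[symmetric] algebra_simps)
      also have "\<dots> \<le> exp (ln A * T) * exp (7 * T)" using T A by (intro mult_right_mono) auto
      also have "\<dots> = exp (C * T)" by (simp add: C_def exp_add[symmetric] algebra_simps)
      finally show ?thesis by (simp add: T_def Y_def)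
    qed
  qed
  thus ?thesis using that C by blast
qed


section \<open>The logarithmic derivative of an entire function of order less than 2\<close>

definition zeros_with_mult :: "(complex \<Rightarrow> complex) \<Rightarrow> (complex \<times> nat) set" where
  "zeros_with_mult f = {(z, k). f z = 0 \<and> k < nat (zorder f z)}"

lemma divide_out_zero:
  fixes f :: "complex \<Rightarrow> complex"
  assumes f: "f holomorphic_on UNIV" and nz: "\<exists>w. f w \<noteq> 0" and n: "n = nat (zorder f z)"
  obtains g where "g holomorphic_on UNIV" "\<And>w. f w = g w * (w - z) ^ n" "g z \<noteq> 0"
proof -
  define p where "p = zor_poly f z"
  have "\<exists>r. r>0 \<and> cball z r \<subseteq> UNIV \<and> p holomorphic_on cball z r
    \<and> (\<forall>w\<in>cball z r. f w  = p w * (w-z) ^ n  \<and> p w \<noteq>0)"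
    using zorder_exist_zero[OF f open_UNIV connected_UNIV UNIV_I, of z] nz
    unfolding p_def n by blast
  then obtain r where r: "r > 0" "p holomorphic_on cball z r"
    "\<And>w. w \<in> cball z r \<Longrightarrow> f w = p w * (w-z) ^ n" "\<And>w. w \<in> cball z r \<Longrightarrow> p w \<noteq> 0" by blast
  define g where "g = (\<lambda>w. if w = z then p z else f w / (w - z) ^ n)"
  have gp: "g w = p w" if "w \<in> cball z r" for w
    using that r(3)[of w] by (auto simp: g_def)
  have "g holomorphic_on ball z r"
    using holomorphic_on_subset[OF r(2), of "ball z r"] gp
    by (subst holomorphic_cong[OF refl, of _ _ p]) auto
  moreover have "g holomorphic_on (- {z})"
    by (subst holomorphic_cong[OF refl, of _ _ "\<lambda>w. f w / (w - z) ^ n"])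
       (auto simp: g_def intro!: holomorphic_intros holomorphic_on_subset[OF f])
  ultimately have "g holomorphic_on (ball z r \<union> - {z})"
    by (intro holomorphic_on_Un) auto
  moreover have "ball z r \<union> - {z} = UNIV" using r(1) by auto
  ultimately have "g holomorphic_on UNIV" by simp
  moreover have "f w = g w * (w - z) ^ n" for w
    using r(1) r(3)[of z] by (auto simp: g_def)
  moreover have "g z \<noteq> 0" using r(1) r(4)[of z] by (simp add: g_def)
  ultimately show ?thesis using that by blast
qed

text \<open>The factors are normalised to \<open>1 - w / z\<close>, so that the quotient keeps the
  value at 0.\<close>

lemma divide_out_zeros:
  fixes f :: "complex \<Rightarrow> complex"
  assumes f: "f holomorphic_on UNIV" and f0: "f 0 \<noteq> 0" and "finite S" "\<And>z. z \<in> S \<Longrightarrow> f z = 0"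
  obtains g where "g holomorphic_on UNIV"
    "\<And>w. f w = g w * (\<Prod>(z,k)\<in>Sigma S (\<lambda>z. {..<nat (zorder f z)}). 1 - w / z)"
    "\<And>z. z \<in> S \<Longrightarrow> g z \<noteq> 0"
proof -
  have "\<exists>g. g holomorphic_on UNIV \<and>
     (\<forall>w. f w = g w * (\<Prod>(z,k)\<in>Sigma S (\<lambda>z. {..<nat (zorder f z)}). 1 - w / z)) \<and>
     (\<forall>z\<in>S. g z \<noteq> 0)"
    using assms(3,4)
  proof (induction S rule: finite_induct)
    case empty
    show ?case using f by (intro exI[of _ f]) auto
  next
    case (insert z S)
    define P where "P = (\<lambda>S w. \<Prod>(z,k)\<in>Sigma S (\<lambda>z. {..<nat (zorder f z)}). 1 - w / z)"
    have P: "P S w = (\<Prod>z\<in>S. (1 - w / z) ^ nat (zorder f z))" if "finite S" for S w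
      unfolding P_def using that by (subst prod.Sigma[symmetric]) auto
    from insert obtain g where g: "g holomorphic_on UNIV" "\<And>w. f w = g w * P S w"
      "\<And>z. z \<in> S \<Longrightarrow> g z \<noteq> 0" unfolding P_def by auto
    define n where "n = nat (zorder g z)"
    have "\<exists>w. g w \<noteq> 0" using g(2)[of 0] f0 by auto
    then obtain h where h: "h holomorphic_on UNIV" "\<And>w. g w = h w * (w - z) ^ n" "h z \<noteq> 0"
      using divide_out_zero[OF g(1) _ n_def] by metis
    have z0: "z \<noteq> 0" using f0 insert.prems[of z] by auto
    have nz: "v \<noteq> 0" if "v \<in> S" for v using f0 insert.prems[of v] that by auto
    have Pz: "P S z \<noteq> 0"
      using insert(1,2) nz by (auto simp: P field_simps)
    have Ph: "P S holomorphic_on UNIV"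
      by (subst P[OF insert(1), abs_def]) (auto intro!: holomorphic_intros simp: nz)
    \<comment> \<open>The product over the zeros already removed does not vanish at
      \<open>z\<close>, so the quotient still has the full multiplicity there.\<close>
    have "zorder f z = int n"
    proof (rule zorder_eqI[of UNIV _ "\<lambda>w. h w * P S w"])
      have "(\<lambda>w. h w * P S w) holomorphic_on UNIV" using h Ph by (intro holomorphic_on_mult) auto
      thus "(\<lambda>w. h w * P S w) holomorphic_on UNIV" .
    qed (use h g Pz in \<open>auto simp: power_int_def\<close>)
    hence n: "nat (zorder f z) = n" by simp
    have "(\<lambda>w. h w * (-z) ^ n) holomorphic_on UNIV \<and> (\<forall>w. f w = h w * (-z) ^ n * P (insert z S) w)
        \<and> (\<forall>v\<in>insert z S. h v * (-z) ^ n \<noteq> 0)"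
    proof (intro conjI allI ballI)
      show "(\<lambda>w. h w * (-z) ^ n) holomorphic_on UNIV" using h by (intro holomorphic_intros)
      fix w
      have "(w - z) ^ n = (-z) ^ n * (1 - w / z) ^ n"
        using z0 by (simp add: power_mult_distrib[symmetric] field_simps)
      thus "f w = h w * (-z) ^ n * P (insert z S) w"
        using insert(1,2) by (simp add: P g(2) h(2) n)
    next
      fix v assume "v \<in> insert z S"
      thus "h v * (-z) ^ n \<noteq> 0" using h z0 g(3)[of v] by auto
    qed
    thus ?case unfolding P_def by (intro exI[of _ "\<lambda>w. h w * (-z) ^ n"])
  qed
  thus ?thesis using that by blast
qed

text \<open>The map \<open>g / (2 * M - g)\<close> sends the half plane \<open>Re g < M\<close> into
  the unit disc and fixes 0; the Schwarz lemma at radius 1/2 then gives the bound.\<close>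

lemma Borel_Caratheodory_half:
  fixes g :: "complex \<Rightarrow> complex"
  assumes g: "g holomorphic_on ball 0 R" and R: "R > 0" and g0: "g 0 = 0"
    and M: "\<And>z. z \<in> ball 0 R \<Longrightarrow> Re (g z) < M" and z: "cmod z \<le> R / 2"
  shows "cmod (g z) \<le> 2 * M"
proof -
  have M0: "M > 0" using M[of 0] g0 R by simp
  define \<phi> where "\<phi> = (\<lambda>z. g (of_real R * z) / (2 * of_real M - g (of_real R * z)))"
  have inb: "of_real R * w \<in> ball (0::complex) R" if "cmod w < 1" for w
    using that R by (simp add: norm_mult)
  have nz: "2 * of_real M - g v \<noteq> 0" if "v \<in> ball 0 R" for v
  proof
    assume "2 * of_real M - g v = 0"
    hence "Re (g v) = 2 * M" by (auto simp: complex_eq_iff)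
    thus False using M[OF that] M0 by simp
  qed
  have le: "cmod (\<phi> w) \<le> cmod w" if w: "cmod w < 1" for w
  proof (rule Schwarz_Lemma(1)[OF _ _ _ w])
    have "g \<circ> (\<lambda>z. of_real R * z) holomorphic_on ball 0 1"
      by (rule holomorphic_on_compose_gen[OF _ g]) (auto intro!: holomorphic_intros inb simp del: of_real_mult)
    thus "\<phi> holomorphic_on ball 0 1"
      unfolding \<phi>_def o_def using nz inb by (auto intro!: holomorphic_intros)
    show "\<phi> 0 = 0" by (simp add: \<phi>_def g0)
    fix z assume "cmod z < 1"
    note * = inb[OF this]
    have "(cmod (g (of_real R * z)))\<^sup>2 < (cmod (2 * of_real M - g (of_real R * z)))\<^sup>2"
      using mult_strict_left_mono[OF M[OF *] M0] unfolding cmod_power2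
      by (simp add: power2_eq_square algebra_simps)
    hence "cmod (g (of_real R * z)) < cmod (2 * of_real M - g (of_real R * z))"
      by (rule power2_less_imp_less) simp
    thus "cmod (\<phi> z) < 1" using nz[OF *] by (simp add: \<phi>_def norm_divide)
  qed
  define w where "w = z / of_real R"
  have w: "cmod w \<le> 1/2" using z R by (simp add: w_def norm_divide field_simps)
  have Rw: "of_real R * w = z" using R by (simp add: w_def)
  have "cmod (\<phi> w) \<le> 1/2" using le[of w] w by simp
  hence "cmod (g z) \<le> cmod (2 * of_real M - g z) / 2"
    using nz[of z] z R unfolding \<phi>_def Rw by (simp add: norm_divide field_simps)
  also have "\<dots> \<le> (2 * M + cmod (g z)) / 2"
    using norm_triangle_ineq4[of "2 * of_real M" "g z"] M0 by (simp add: norm_mult)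
  finally show ?thesis by simp
qed

locale entire_growth =
  fixes F :: "complex \<Rightarrow> complex" and C :: real
  assumes hol: "F holomorphic_on UNIV" and F0: "F 0 \<noteq> 0" and C0: "C > 0"
    and growth: "\<And>z. cmod (F z) \<le> exp (C * (1 + cmod z) powr (3/2))"
begin

definition zero_disc :: "real \<Rightarrow> (complex \<times> nat) set" where
  "zero_disc R = {p \<in> zeros_with_mult F. cmod (fst p) \<le> R}"

text \<open>The logarithm of the growth bound at radius \<open>3 * R\<close>, relative to
  \<open>F 0\<close>. It controls both the number of zeros up to \<open>R\<close> and the real part
  of the logarithm of the zero-free quotient.\<close>

definition M :: "real \<Rightarrow> real" where
  "M R = C * (1 + 3 * R) powr (3/2) - ln (cmod (F 0))"

lemma finite_zeros: "finite {z. F z = 0 \<and> cmod z \<le> R}"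
proof -
  have "finite {z \<in> cball 0 R. F z = 0}"
  proof (cases "F constant_on UNIV")
    case True
    hence "F z = F 0" for z by (auto simp: constant_on_def)
    hence "F z \<noteq> 0" for z using F0 by metis
    thus ?thesis by simp
  next
    case False
    show ?thesis by (rule holomorphic_compact_finite_zeros[OF hol _ _ _ _ False]) auto
  qed
  thus ?thesis by (rule rev_finite_subset) auto
qed

lemma zero_disc_eq:
  "zero_disc R = Sigma {z. F z = 0 \<and> cmod z \<le> R} (\<lambda>z. {..<nat (zorder F z)})"
  by (auto simp: zero_disc_def zeros_with_mult_def)

lemma finite_zero_disc: "finite (zero_disc R)"
  unfolding zero_disc_eq using finite_zeros by auto

lemma zero_disc_nz: "p \<in> zero_disc R \<Longrightarrow> fst p \<noteq> 0"
  using F0 by (auto simp: zero_disc_eq)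

text \<open>On the circle of radius \<open>3 * R\<close> each factor \<open>1 - w / fst p\<close>
  has modulus at least 2, because the zeros lie within \<open>R\<close>. The maximum principle
  brings the gained power of 2 into the disc, which replaces Jensen's formula.\<close>

lemma factor_disc:
  assumes R: "R > 0"
  obtains g where "g holomorphic_on UNIV"
    "\<And>w. F w = g w * (\<Prod>p\<in>zero_disc R. 1 - w / fst p)"
    "\<And>w. cmod w \<le> R \<Longrightarrow> g w \<noteq> 0" "g 0 = F 0"
    "\<And>w. cmod w \<le> 3 * R \<Longrightarrow> cmod (g w) * 2 ^ card (zero_disc R) \<le> exp (C * (1 + 3 * R) powr (3/2))"
proof -
  obtain g where g: "g holomorphic_on UNIV"
    "\<And>w. F w = g w * (\<Prod>(z,k)\<in>zero_disc R. 1 - w / z)"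
    "\<And>z. z \<in> {z. F z = 0 \<and> cmod z \<le> R} \<Longrightarrow> g z \<noteq> 0"
  proof -
    have "F z = 0" if "z \<in> {z. F z = 0 \<and> cmod z \<le> R}" for z using that by auto
    note d = divide_out_zeros[OF hol F0 finite_zeros[of R] this, folded zero_disc_eq]
    show ?thesis by (rule d) (assumption, rule that)
  qed
  have g2: "F w = g w * (\<Prod>p\<in>zero_disc R. 1 - w / fst p)" for w
    by (subst g(2)) (simp add: case_prod_unfold)
  have g3: "g w \<noteq> 0" if "cmod w \<le> R" for w
    using g(3)[of w] that g2[of w] by auto
  have bd: "cmod (g w) \<le> exp (C * (1 + 3 * R) powr (3/2)) / 2 ^ card (zero_disc R)"
    if w: "cmod w \<le> 3 * R" for w
  proof (rule maximum_modulus_frontier[of g "cball 0 (3*R)"])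
    fix z :: complex assume "z \<in> frontier (cball 0 (3 * R))"
    hence z: "cmod z = 3 * R" using R by simp
    have "2 ^ card (zero_disc R) = (\<Prod>p\<in>zero_disc R. (2::real))" by simp
    also have "\<dots> \<le> (\<Prod>p\<in>zero_disc R. cmod (1 - z / fst p))"
    proof (rule prod_mono, safe)
      fix a b assume *: "(a, b) \<in> zero_disc R"
      hence a: "a \<noteq> 0" "cmod a \<le> R" using zero_disc_nz[OF *] by (auto simp: zero_disc_def)
      have "3 \<le> cmod (z / a)" using a z by (simp add: norm_divide field_simps)
      moreover have "cmod (z / a) \<le> cmod (1 - z / a) + 1"
        using norm_triangle_ineq4[of 1 "1 - z / a"] by simp
      ultimately show "2 \<le> cmod (1 - z / fst (a, b))" by simp
    qed simp
    also have "\<dots> = cmod (\<Prod>p\<in>zero_disc R. 1 - z / fst p)" by (simp add: prod_norm)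
    finally have 1: "2 ^ card (zero_disc R) \<le> cmod (\<Prod>p\<in>zero_disc R. 1 - z / fst p)" .
    have "cmod (g z) * 2 ^ card (zero_disc R) \<le> cmod (g z) * cmod (\<Prod>p\<in>zero_disc R. 1 - z / fst p)"
      using 1 by (intro mult_left_mono) auto
    also have "\<dots> = cmod (F z)" by (subst g2) (simp add: norm_mult)
    also have "\<dots> \<le> exp (C * (1 + 3 * R) powr (3/2))" using growth[of z] z by simp
    finally show "cmod (g z) \<le> exp (C * (1 + 3 * R) powr (3/2)) / 2 ^ card (zero_disc R)"
      by (simp add: field_simps)
  qed (use w g(1) in \<open>auto intro!: holomorphic_on_imp_continuous_on holomorphic_on_subset[OF g(1)]\<close>)
  have "g 0 = F 0" using g2[of 0] by simp
  thus ?thesis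
    using bd by (intro that[of g] g(1) g2 g3) (simp_all add: field_simps)
qed

text \<open>The bound of \<open>factor_disc\<close> at the centre, where the quotient has the known
  value \<open>F 0\<close>.\<close>

lemma card_zero_disc:
  assumes R: "R > 0"
  shows "real (card (zero_disc R)) * ln 2 \<le> M R"
proof -
  obtain g where g: "g 0 = F 0"
    "\<And>w. cmod w \<le> 3 * R \<Longrightarrow> cmod (g w) * 2 ^ card (zero_disc R) \<le> exp (C * (1 + 3 * R) powr (3/2))"
    using factor_disc[OF R] by metis
  have "cmod (F 0) * 2 ^ card (zero_disc R) \<le> exp (C * (1 + 3 * R) powr (3/2))"
    using g(2)[of 0] g(1) R by simp
  hence "ln (cmod (F 0) * 2 ^ card (zero_disc R)) \<le> C * (1 + 3 * R) powr (3/2)"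
    using F0 by (subst (asm) ln_le_cancel_iff[symmetric]) auto
  thus ?thesis using F0 by (simp add: M_def ln_mult ln_realpow)
qed

text \<open>
  The number of zeros up to \<open>R\<close> is \<open>O(R powr (3/2))\<close>, and \<open>1 / \<bar>z\<bar>\<^sup>2\<close> is dominated by the sum of \<open>4 / 4 ^ j\<close> over
  those \<open>j\<close> with \<open>\<bar>z\<bar> \<le> 2 ^ j\<close>.
\<close>

lemma zeros_inverse_square_summable:
  "(\<lambda>p. 1 / (cmod (fst p))\<^sup>2) summable_on zeros_with_mult F"
proof -
  \<comment> \<open>\<open>M (2 ^ n)\<close> grows like \<open>(2 powr (3/2)) ^ n\<close>, so
    \<open>M (2 ^ n) / 4 ^ n\<close> is controlled by the geometric series with ratio
    \<open>q\<close>.\<close>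
  define q :: real where "q = 2 powr (3/2) / 4"
  have "(2::real) powr (3/2) < 2 powr 2" by (intro powr_less_mono) auto
  hence q: "0 < q" "q < 1" by (auto simp: q_def)
  have "(\<lambda>n. M (2 ^ n) / 4 ^ n) \<in> O(\<lambda>n. q ^ n)"
    unfolding M_def q_def power_divide using C0
    by real_asymp
  hence summ: "summable (\<lambda>n. M (2 ^ n) / 4 ^ n)"
    by (rule summable_comparison_test_bigo[rotated]) (use q in \<open>auto simp: summable_geometric\<close>)
  define B where "B = (\<Sum>n. M (2 ^ n) / 4 ^ n)"
  have Mnn: "M (2 ^ n) \<ge> 0" for n
    using card_zero_disc[of "2 ^ n"] by (smt (verit) mult_nonneg_nonneg ln_gt_zero of_nat_0_le_iff zero_less_power)
  \<comment> \<open>Finitely many zeros in the closed unit disc are set aside: outside it the least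
    \<open>j\<close> with modulus at most \<open>2 ^ j\<close> is positive and has a predecessor,
    which bounds the modulus from below.\<close>
  define Z where "Z = zeros_with_mult F - zero_disc 1"
  have "(\<lambda>p. 1 / (cmod (fst p))\<^sup>2) summable_on Z"
  proof (rule nonneg_bounded_partial_sums_imp_summable_on)
    show "eventually (\<lambda>X. sum (\<lambda>p. 1 / (cmod (fst p))\<^sup>2) X \<le> 4 * B / ln 2) (finite_subsets_at_top Z)"
    proof (rule eventually_finite_subsets_at_top_weakI)
      fix X assume X: "finite X" "X \<subseteq> Z"
      obtain r where r: "\<And>p. p \<in> X \<Longrightarrow> cmod (fst p) \<le> r"
        using finite_imp_bounded[of "fst ` X"] X(1) by (auto simp: bounded_iff)
      obtain J :: nat where J: "r < 2 ^ J" using real_arch_pow[of 2 r] by auto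
      have pt: "1 / (cmod (fst p))\<^sup>2 \<le> (\<Sum>j\<le>J. if cmod (fst p) \<le> 2 ^ j then 4 / 4 ^ j else 0)"
        if p: "p \<in> X" for p
      proof -
        define j where "j = (LEAST j. cmod (fst p) \<le> 2 ^ j)"
        have ex: "cmod (fst p) \<le> 2 ^ J" using r[OF p] J by linarith
        have j: "cmod (fst p) \<le> 2 ^ j" unfolding j_def by (rule LeastI[of _ J]) (rule ex)
        have jJ: "j \<le> J" unfolding j_def by (rule Least_le) (rule ex)
        have gt1: "cmod (fst p) > 1" using p X by (auto simp: Z_def zero_disc_def)
        have "j \<noteq> 0" using j gt1 by (cases "j = 0") auto
        then obtain i where i: "j = Suc i" by (cases j) auto
        have "\<not> cmod (fst p) \<le> 2 ^ i" using i unfolding j_def by (intro not_less_Least) simp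
        hence "(2 ^ i)\<^sup>2 \<le> (cmod (fst p))\<^sup>2" by (intro power_mono) auto
        moreover have "(2 ^ i)\<^sup>2 = (4::real) ^ i" by (simp add: power2_eq_square flip: power_mult_distrib)
        ultimately have "4 ^ i \<le> (cmod (fst p))\<^sup>2" by simp
        hence "1 / (cmod (fst p))\<^sup>2 \<le> 1 / 4 ^ i" using gt1 by (intro divide_left_mono) (auto intro!: mult_pos_pos)
        also have "\<dots> = (\<Sum>j\<in>{j}. if cmod (fst p) \<le> 2 ^ j then 4 / 4 ^ j else 0)"
          using j by (simp add: i)
        also have "\<dots> \<le> (\<Sum>j\<le>J. if cmod (fst p) \<le> 2 ^ j then 4 / 4 ^ j else 0)"
          using jJ by (intro sum_mono2) auto
        finally show ?thesis .
      qed
      have "sum (\<lambda>p. 1 / (cmod (fst p))\<^sup>2) X \<le> (\<Sum>p\<in>X. \<Sum>j\<le>J. if cmod (fst p) \<le> 2 ^ j then 4 / 4 ^ j else 0)"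
        by (rule sum_mono) (rule pt)
      also have "\<dots> = (\<Sum>j\<le>J. \<Sum>p\<in>X. if cmod (fst p) \<le> 2 ^ j then 4 / 4 ^ j else 0)"
        by (rule sum.swap)
      also have "\<dots> \<le> (\<Sum>j\<le>J. 4 * (M (2 ^ j) / 4 ^ j) / ln 2)"
      proof (rule sum_mono)
        fix j
        have "(\<Sum>p\<in>X. if cmod (fst p) \<le> 2 ^ j then 4 / 4 ^ j else 0 :: real)
            = (\<Sum>p\<in>{p\<in>X. cmod (fst p) \<le> 2 ^ j}. 4 / 4 ^ j)"
          using X(1) by (subst sum.inter_filter) auto
        also have "\<dots> = real (card {p\<in>X. cmod (fst p) \<le> 2 ^ j}) * (4 / 4 ^ j)" by simp
        also have "\<dots> \<le> real (card (zero_disc (2 ^ j))) * (4 / 4 ^ j)"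
          using X by (intro mult_right_mono of_nat_mono card_mono finite_zero_disc)
             (auto simp: Z_def zero_disc_def)
        also have "\<dots> \<le> M (2 ^ j) / ln 2 * (4 / 4 ^ j)"
          using card_zero_disc[of "2 ^ j"] by (intro mult_right_mono) (auto simp: field_simps)
        finally show "(\<Sum>p\<in>X. if cmod (fst p) \<le> 2 ^ j then 4 / 4 ^ j else 0) \<le> 4 * (M (2 ^ j) / 4 ^ j) / ln 2"
          by (simp add: field_simps)
      qed
      also have "\<dots> = 4 * (\<Sum>j\<le>J. M (2 ^ j) / 4 ^ j) / ln 2"
        by (simp add: sum_distrib_left sum_divide_distrib)
      also have "\<dots> \<le> 4 * B / ln 2" unfolding B_def
        using Mnn by (intro divide_right_mono mult_left_mono sum_le_suminf summ) auto
      finally show "sum (\<lambda>p. 1 / (cmod (fst p))\<^sup>2) X \<le> 4 * B / ln 2" .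
    qed
  qed auto
  moreover have "(\<lambda>p. 1 / (cmod (fst p))\<^sup>2) summable_on zero_disc 1"
    using finite_zero_disc by (rule summable_on_finite)
  ultimately have "(\<lambda>p. 1 / (cmod (fst p))\<^sup>2) summable_on (Z \<union> zero_disc 1)"
    by (rule summable_on_Un_disjoint) (auto simp: Z_def)
  moreover have "Z \<union> zero_disc 1 = zeros_with_mult F" by (auto simp: Z_def zero_disc_def)
  ultimately show ?thesis by simp
qed

text \<open>
  After dividing out the zeros up to \<open>R\<close>, the function has a holomorphic logarithm on the disc, whose real
  part is \<open>O(R powr (3/2))\<close>; by Borel--Caratheodory and Cauchy its second derivative is then small near 0.
\<close>

lemma logderiv_near_sum:
  assumes R: "R > 0" and s: "cmod s < R / 4" "F s \<noteq> 0"
  shows "cmod (deriv F s / F s - deriv F 0 / F 0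
     - (\<Sum>p\<in>zero_disc R. 1 / (s - fst p) + 1 / fst p)) \<le> cmod s * (64 * (M R + 1) / R\<^sup>2)"
proof -
  obtain g where g: "g holomorphic_on UNIV"
    "\<And>w. F w = g w * (\<Prod>p\<in>zero_disc R. 1 - w / fst p)"
    "\<And>w. cmod w \<le> R \<Longrightarrow> g w \<noteq> 0" "g 0 = F 0"
    "\<And>w. cmod w \<le> 3 * R \<Longrightarrow> cmod (g w) * 2 ^ card (zero_disc R) \<le> exp (C * (1 + 3 * R) powr (3/2))"
    using factor_disc[OF R] by metis
  have gd: "(g has_field_derivative deriv g z) (at z)" for z
    using g(1) by (rule holomorphic_derivI) auto
  obtain l0 where l0: "l0 holomorphic_on ball 0 R" "\<And>x. x \<in> ball 0 R \<Longrightarrow> exp (l0 x) = g x"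
    using holomorphic_logarithm_exists[of "ball 0 R" g 0] g(3) R holomorphic_on_subset[OF g(1)]
    by (metis convex_ball open_ball centre_in_ball mem_ball_0 less_imp_le subset_UNIV)
  \<comment> \<open>Normalised to vanish at 0 for Borel--Caratheodory; the \<open>+ 1\<close> below
    provides its strict inequality.\<close>
  define l where "l = (\<lambda>z. l0 z - l0 0)"
  have l: "l holomorphic_on ball 0 R" "l 0 = 0" unfolding l_def using l0 by (auto intro!: holomorphic_intros)
  have Rel: "Re (l z) < M R + 1" if z: "z \<in> ball 0 R" for z
  proof -
    have "cmod (g z) * 1 \<le> cmod (g z) * 2 ^ card (zero_disc R)" by (intro mult_left_mono) auto
    also have "\<dots> \<le> exp (C * (1 + 3 * R) powr (3/2))" using z R by (intro g(5)) auto
    finally have "exp (Re (l0 z)) \<le> exp (C * (1 + 3 * R) powr (3/2))"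
      using l0(2)[OF z] by (metis norm_exp_eq_Re mult.right_neutral)
    hence 1: "Re (l0 z) \<le> C * (1 + 3 * R) powr (3/2)" by simp
    have "exp (Re (l0 0)) = cmod (F 0)" using l0(2)[of 0] R g(4) by (metis norm_exp_eq_Re centre_in_ball)
    hence "Re (l0 0) = ln (cmod (F 0))" using F0 by (metis ln_exp)
    thus ?thesis using 1 by (simp add: l_def M_def)
  qed
  have lb: "cmod (l z) \<le> 2 * (M R + 1)" if "cmod z \<le> R / 2" for z
    by (rule Borel_Caratheodory_half[OF l(1) R l(2) Rel that])
  have dl: "deriv l z = deriv g z / g z" if z: "z \<in> ball 0 R" for z
  proof -
    have "(l has_field_derivative deriv l z) (at z)" using l(1) z by (intro holomorphic_derivI) auto
    hence "((\<lambda>z. exp (l z + l0 0)) has_field_derivative exp (l z + l0 0) * deriv l z) (at z)"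
      by (auto intro!: derivative_eq_intros)
    moreover have "((\<lambda>z. exp (l z + l0 0)) has_field_derivative deriv g z) (at z)"
      by (rule has_field_derivative_transform_within_open[OF gd, of "ball 0 R"])
         (use z l0 in \<open>auto simp: l_def\<close>)
    ultimately have "exp (l0 z) * deriv l z = deriv g z"
      using DERIV_unique by (fastforce simp: l_def)
    thus ?thesis using l0(2)[OF z] by (metis exp_not_eq_zero nonzero_mult_div_cancel_left)
  qed
  \<comment> \<open>Cauchy's inequality on circles of radius \<open>R / 4\<close>, which stay where
    \<open>lb\<close> applies: \<open>2 * 2 * 16 = 64\<close>.\<close>
  have d2: "cmod (deriv (deriv l) z) \<le> 64 * (M R + 1) / R\<^sup>2" if z: "cmod z \<le> R / 4" for z
  proof -
    have sub: "cmod w \<le> R / 2" if "dist z w \<le> R / 4" for w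
      using that z norm_triangle_ineq2[of w z] by (simp add: dist_norm norm_minus_commute)
    have "cmod ((deriv ^^ 2) l z) \<le> fact 2 * (2 * (M R + 1)) / (R / 4) ^ 2"
    proof (rule Cauchy_inequality)
      have "cball z (R/4) \<subseteq> ball 0 R" using sub R by (force simp: subset_iff)
      thus "l holomorphic_on ball z (R/4)" "continuous_on (cball z (R/4)) l"
        by (auto intro!: holomorphic_on_imp_continuous_on holomorphic_on_subset[OF l(1)])
    qed (use R sub lb in \<open>auto simp: dist_norm\<close>)
    thus ?thesis by (simp add: numeral_2_eq_2 field_simps)
  qed
  have "cmod (deriv l s - deriv l 0) \<le> 64 * (M R + 1) / R\<^sup>2 * cmod (s - 0)"
  proof (rule field_differentiable_bound[of "cball 0 (R/4)" _ "deriv (deriv l)"])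
    fix z :: complex assume z: "z \<in> cball 0 (R/4)"
    have "(deriv l has_field_derivative deriv (deriv l) z) (at z)"
      using z R l(1) by (intro holomorphic_derivI[of _ "ball 0 R"] holomorphic_deriv) auto
    thus "(deriv l has_field_derivative deriv (deriv l) z) (at z within cball 0 (R / 4))"
      by (rule has_field_derivative_at_within)
  qed (use d2 s R in auto)
  moreover have ld: "deriv F z / F z = deriv g z / g z + (\<Sum>p\<in>zero_disc R. 1 / (z - fst p))"
    if Fz: "F z \<noteq> 0" for z
  proof -
    define P where "P = (\<lambda>w. \<Prod>p\<in>zero_disc R. 1 - w / fst p)"
    have nz: "g z \<noteq> 0" "P z \<noteq> 0" using Fz g(2)[of z] by (auto simp: P_def)
    have nz': "1 - z / fst p \<noteq> 0" if "p \<in> zero_disc R" for p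
      using nz(2) that finite_zero_disc[of R] by (auto simp: P_def)
    have "(P has_field_derivative (P z * (\<Sum>p\<in>zero_disc R. (- 1 / fst p) / (1 - z / fst p)))) (at z)"
      unfolding P_def
      by (rule has_field_derivative_prod') (use nz' zero_disc_nz in \<open>auto intro!: derivative_eq_intros\<close>)
    also have "(\<Sum>p\<in>zero_disc R. (- 1 / fst p) / (1 - z / fst p)) = (\<Sum>p\<in>zero_disc R. 1 / (z - fst p))"
    proof (rule sum.cong[OF refl])
      fix p assume p: "p \<in> zero_disc R"
      thus "(- 1 / fst p) / (1 - z / fst p) = 1 / (z - fst p)"
        using nz'[OF p] zero_disc_nz[OF p] by (simp add: divide_simps)
    qed
    finally have "((\<lambda>w. g w * P w) has_field_derivative
        deriv g z * P z + (P z * (\<Sum>p\<in>zero_disc R. 1 / (z - fst p))) * g z) (at z)"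
      by (intro DERIV_mult gd)
    hence "deriv F z = deriv g z * P z + (P z * (\<Sum>p\<in>zero_disc R. 1 / (z - fst p))) * g z"
      using g(2) unfolding P_def by (intro DERIV_imp_deriv) (metis (no_types, lifting) ext)
    moreover have "F z = g z * P z" using g(2) by (simp add: P_def)
    ultimately show ?thesis using nz by (simp add: field_simps)
  qed
  have "deriv F s / F s - deriv F 0 / F 0 - (\<Sum>p\<in>zero_disc R. 1 / (s - fst p) + 1 / fst p)
        = deriv l s - deriv l 0"
    using ld[OF s(2)] ld[OF F0] dl[of s] dl[of 0] R s(1)
    by (simp add: sum.distrib sum_negf)
  ultimately show ?thesis by (simp add: mult.commute)
qed

text \<open>Each term equals \<open>s / ((s - z) * z)\<close>, so the inverse squares of the zeros
  give absolute summability. The value may then be computed along the discs of radius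
  \<open>n\<close>, where \<open>logderiv_near_sum\<close> leaves an error of order
  \<open>n powr (- 1 / 2)\<close>.\<close>

theorem logderiv_has_sum:
  assumes s: "F s \<noteq> 0"
  shows "((\<lambda>p. 1 / (s - fst p) + 1 / fst p) has_sum (deriv F s / F s - deriv F 0 / F 0))
    (zeros_with_mult F)"
proof -
  define f where "f = (\<lambda>p::complex\<times>nat. 1 / (s - fst p) + 1 / fst p)"
  define Z where "Z = zeros_with_mult F"
  have fin: "filterlim (\<lambda>n. zero_disc (real n)) (finite_subsets_at_top Z) sequentially"
    unfolding filterlim_finite_subsets_at_top
  proof safe
    fix X assume X: "finite X" "X \<subseteq> Z"
    obtain r where r: "\<And>p. p \<in> X \<Longrightarrow> cmod (fst p) \<le> r"
      using finite_imp_bounded[of "fst ` X"] X(1) by (auto simp: bounded_iff)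
    show "\<forall>\<^sub>F n in sequentially. finite (zero_disc (real n)) \<and> X \<subseteq> zero_disc (real n) \<and> zero_disc (real n) \<subseteq> Z"
      using eventually_ge_at_top[of "nat \<lceil>r\<rceil>"]
    proof eventually_elim
      case (elim n)
      hence "r \<le> real n" by linarith
      thus ?case using X r finite_zero_disc by (force simp: zero_disc_def Z_def)
    qed
  qed
  have "f summable_on Z"
  proof -
    define Z1 where "Z1 = Z - zero_disc (2 * cmod s)"
    have "(\<lambda>p. 2 * cmod s * (1 / (cmod (fst p))\<^sup>2)) summable_on Z1"
      by (intro summable_on_cmult_right summable_on_subset[OF zeros_inverse_square_summable])
         (auto simp: Z1_def Z_def)
    hence "(\<lambda>p. norm (f p)) summable_on Z1"
    proof (rule summable_on_comparison_test)
      fix p assume p: "p \<in> Z1"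
      define z where "z = fst p"
      have z: "cmod z > 2 * cmod s" using p by (auto simp: Z1_def Z_def zero_disc_def z_def)
      hence z0: "z \<noteq> 0" using norm_ge_zero[of s] by auto
      have "cmod z \<le> 2 * cmod (s - z)" using norm_triangle_ineq2[of z s] z by (simp add: norm_minus_commute)
      hence sz: "cmod z / 2 \<le> cmod (s - z)" by simp
      hence nz: "s \<noteq> z" using z0 by auto
      have "f p = s / ((s - z) * z)" using z0 nz by (simp add: f_def z_def[symmetric] field_simps)
      hence "norm (f p) = cmod s / (cmod (s - z) * cmod z)" by (simp add: norm_divide norm_mult)
      also have "\<dots> \<le> cmod s / (cmod z / 2 * cmod z)"
        using sz z0 nz by (intro divide_left_mono mult_right_mono mult_pos_pos) auto
      finally show "norm (f p) \<le> 2 * cmod s * (1 / (cmod (fst p))\<^sup>2)"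
        by (simp add: z_def power2_eq_square field_simps)
    qed auto
    hence "f summable_on Z1" by (rule abs_summable_summable)
    moreover have "f summable_on zero_disc (2 * cmod s)" using finite_zero_disc by (rule summable_on_finite)
    ultimately have "f summable_on (Z1 \<union> zero_disc (2 * cmod s))"
      by (rule summable_on_Un_disjoint) (auto simp: Z1_def)
    moreover have "Z1 \<union> zero_disc (2 * cmod s) = Z" by (auto simp: Z1_def Z_def zero_disc_def)
    ultimately show ?thesis by simp
  qed
  then obtain a where a: "(f has_sum a) Z" by (auto simp: summable_on_def)
  have "(\<lambda>n. sum f (zero_disc (real n))) \<longlonglongrightarrow> a"
    using filterlim_compose[OF a[unfolded has_sum_def] fin] .
  moreover have "(\<lambda>n. sum f (zero_disc (real n))) \<longlonglongrightarrow> deriv F s / F s - deriv F 0 / F 0"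
  proof (rule LIM_zero_cancel, rule Lim_null_comparison)
    show "(\<lambda>n. cmod s * (64 * (M (real n) + 1) / (real n)\<^sup>2)) \<longlonglongrightarrow> 0"
      unfolding M_def by real_asymp
    show "\<forall>\<^sub>F n in sequentially. norm (sum f (zero_disc (real n)) - (deriv F s / F s - deriv F 0 / F 0)) \<le> cmod s * (64 * (M (real n) + 1) / (real n)\<^sup>2)"
      using eventually_gt_at_top[of "nat \<lceil>4 * cmod s\<rceil>"]
    proof eventually_elim
      case (elim n)
      hence "real n > 4 * cmod s" by linarith
      moreover from this have "real n > 0" using norm_ge_zero[of s] by linarith
      ultimately show ?case using logderiv_near_sum[of "real n" s] s
        unfolding f_def by (subst norm_minus_commute) auto
    qed
  qed
  ultimately show ?thesis using a LIMSEQ_unique unfolding f_def Z_def by blast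
qed

end


section \<open>The digamma function and sums over arithmetic progressions\<close>

text \<open>
  Along \<open>t = x + 2 n\<close> the right-hand side telescopes, whatever the sign of \<open>x\<close>.
\<close>

lemma inverse_le_arctan_diff:
  fixes t y :: real
  assumes y: "y \<ge> 1"
  shows "1 / (t\<^sup>2 + y\<^sup>2) \<le> 3 / (2 * y) * (arctan ((t + 1) / y) - arctan ((t - 1) / y))"
proof -
  have "\<exists>z. t - 1 < z \<and> z < t + 1 \<and> arctan ((t + 1) / y) - arctan ((t - 1) / y)
      = (t + 1 - (t - 1)) * (inverse (1 + (z / y)\<^sup>2) * (1 / y))"
    using y by (intro MVT2) (auto intro!: derivative_eq_intros simp: power2_eq_square field_simps)
  then obtain z where z: "t - 1 < z" "z < t + 1" and
    eq: "arctan ((t + 1) / y) - arctan ((t - 1) / y) = 2 * (inverse (1 + (z / y)\<^sup>2) * (1 / y))"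
    by auto
  have "z\<^sup>2 \<le> (\<bar>t\<bar> + 1)\<^sup>2" using z by (intro abs_le_square_iff[THEN iffD1]) auto
  also have "\<dots> \<le> 2 * t\<^sup>2 + 2"
    using sum_squares_bound[of "\<bar>t\<bar>" 1] by (simp add: power2_eq_square algebra_simps)
  finally have "z\<^sup>2 \<le> 2 * t\<^sup>2 + 2" .
  hence z2: "z\<^sup>2 + y\<^sup>2 \<le> 3 * (t\<^sup>2 + y\<^sup>2)"
  proof -
    have "c + q \<le> 3 * (p + q)" if "c \<le> 2 * p + 2" "1 \<le> q" "0 \<le> p" for c p q :: real
      using that by simp
    thus ?thesis using one_le_power[OF y, of 2] \<open>z\<^sup>2 \<le> 2 * t\<^sup>2 + 2\<close> zero_le_power2[of t] by blast
  qed
  have pos: "t\<^sup>2 + y\<^sup>2 > 0" "z\<^sup>2 + y\<^sup>2 > 0" using y by (auto intro!: add_nonneg_pos)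
  have "1 / (t\<^sup>2 + y\<^sup>2) \<le> 3 / (z\<^sup>2 + y\<^sup>2)" using z2 pos by (simp add: divide_simps)
  also have "3 / (z\<^sup>2 + y\<^sup>2) = 3 / (2 * y) * (2 * (inverse (1 + (z / y)\<^sup>2) * (1 / y)))"
    using y pos by (simp add: field_simps power2_eq_square)
  finally show ?thesis unfolding eq .
qed

text \<open>The arctangent varies by less than \<open>pi\<close> in total, and
  \<open>3 / 2 * pi < 5\<close>. The bound does not depend on \<open>x\<close>, which is why the
  later error terms depend on \<open>Im s\<close> alone, also far to the left.\<close>

lemma inverse_square_grid_sum:
  fixes x y :: real
  assumes y: "\<bar>y\<bar> \<ge> 1"
  shows "summable (\<lambda>n. 1 / ((x + 2 * real n)\<^sup>2 + y\<^sup>2))"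
    and "(\<Sum>n. 1 / ((x + 2 * real n)\<^sup>2 + y\<^sup>2)) \<le> 5 / \<bar>y\<bar>"
proof -
  define g where "g = (\<lambda>n. arctan ((x + 2 * real n - 1) / \<bar>y\<bar>))"
  have "(\<Sum>n<m. 1 / ((x + 2 * real n)\<^sup>2 + y\<^sup>2)) \<le> 5 / \<bar>y\<bar>" for m
  proof -
    have "(\<Sum>n<m. 1 / ((x + 2 * real n)\<^sup>2 + y\<^sup>2)) \<le> (\<Sum>n<m. 3 / (2 * \<bar>y\<bar>) * (g (Suc n) - g n))"
    proof (rule sum_mono)
      fix n
      have e: "x + 2 * real (Suc n) - 1 = (x + 2 * real n) + 1" by simp
      show "1 / ((x + 2 * real n)\<^sup>2 + y\<^sup>2) \<le> 3 / (2 * \<bar>y\<bar>) * (g (Suc n) - g n)"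
        using inverse_le_arctan_diff[OF y, of "x + 2 * real n"] unfolding g_def e power2_abs .
    qed
    also have "\<dots> = 3 / (2 * \<bar>y\<bar>) * (g m - g 0)"
      by (simp only: sum_distrib_left[symmetric] sum_lessThan_telescope)
    also have "\<dots> \<le> 3 / (2 * \<bar>y\<bar>) * pi"
      using arctan_bounded[of "(x + 2 * real m - 1) / \<bar>y\<bar>"] arctan_bounded[of "(x + 2 * real 0 - 1) / \<bar>y\<bar>"] y
      by (intro mult_left_mono) (auto simp: g_def)
    also have "\<dots> \<le> 3 / (2 * \<bar>y\<bar>) * (10 / 3)"
      using pi_less_4 pi_approx y by (intro mult_left_mono) auto
    finally show ?thesis using y by (simp add: field_simps)
  qed
  note * = this
  show "summable (\<lambda>n. 1 / ((x + 2 * real n)\<^sup>2 + y\<^sup>2))"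
    by (rule summableI_nonneg_bounded[OF _ *]) auto
  thus "(\<Sum>n. 1 / ((x + 2 * real n)\<^sup>2 + y\<^sup>2)) \<le> 5 / \<bar>y\<bar>"
    by (rule suminf_le_const) (rule *)
qed

text \<open>The left-hand side is the integral of \<open>1 / (w + t) - 1 / w\<close> over the unit
  interval. The parameter \<open>k\<close> measures how much \<open>w + t\<close> can shrink: 1/2
  serves for \<open>\<bar>Im w\<bar> \<ge> 1\<close> and 1 for \<open>Re w > 1\<close>.\<close>

lemma Ln_Suc_diff_bound:
  assumes k: "k > 0" and w: "w \<noteq> 0"
    and dom: "\<And>t. 0 \<le> t \<Longrightarrow> t \<le> 1 \<Longrightarrow> w + complex_of_real t \<notin> \<real>\<^sub>\<le>\<^sub>0"
    and le: "\<And>t. 0 \<le> t \<Longrightarrow> t \<le> 1 \<Longrightarrow> k * cmod w \<le> cmod (w + of_real t)"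
  shows "cmod (Ln (w + 1) - Ln w - 1 / w) \<le> 1 / (k * (cmod w)\<^sup>2)"
proof -
  define S where "S = closed_segment (0::complex) 1"
  have S: "\<exists>t. 0 \<le> t \<and> t \<le> 1 \<and> u = complex_of_real t" if "u \<in> S" for u
    using that by (auto simp: S_def in_segment scaleR_conv_of_real)
  have "cmod ((Ln (w + 1) - 1 / w) - (Ln (w + 0) - 0 / w)) \<le> 1 / (k * (cmod w)\<^sup>2) * cmod (1 - 0)"
  proof (rule field_differentiable_bound[of S _ "\<lambda>u. 1 / (w + u) - 1 / w"])
    fix u assume "u \<in> S"
    then obtain t where t: "0 \<le> t" "t \<le> 1" "u = complex_of_real t" using S by blast
    have "((\<lambda>u. Ln (w + u)) has_field_derivative 1 / (w + u)) (at u within S)"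
      using dom[OF t(1,2)] t(3) by (auto intro!: derivative_eq_intros simp: divide_simps)
    moreover have "((\<lambda>u. u / w) has_field_derivative 1 / w) (at u within S)"
      by (rule DERIV_cdivide) (rule DERIV_ident)
    ultimately show "((\<lambda>u. Ln (w + u) - u / w) has_field_derivative 1 / (w + u) - 1 / w) (at u within S)"
      by (rule DERIV_diff)
    have nz: "w + u \<noteq> 0" using dom[OF t(1,2)] t(3) by auto
    have "1 / (w + u) - 1 / w = - u / (w * (w + u))" using nz w by (simp add: field_simps)
    hence "cmod (1 / (w + u) - 1 / w) = t / (cmod w * cmod (w + u))"
      using t by (simp add: norm_divide norm_mult)
    also have "\<dots> \<le> 1 / (cmod w * (k * cmod w))"
      using t nz w k le[OF t(1,2)] by (intro frac_le mult_left_mono mult_pos_pos) auto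
    finally show "cmod (1 / (w + u) - 1 / w) \<le> 1 / (k * (cmod w)\<^sup>2)"
      by (simp add: power2_eq_square mult_ac)
  qed (auto simp: S_def)
  thus ?thesis by (simp add: algebra_simps)
qed

text \<open>\<open>Digamma z - Ln z\<close> is the sum of the differences
  \<open>Ln (z + n + 1) - Ln (z + n) - 1 / (z + n)\<close>: the logarithms telescope and the
  reciprocals form the limit formula for \<open>Digamma\<close>.\<close>

lemma Digamma_minus_Ln_bound:
  assumes z: "z \<noteq> 0" and a: "summable a"
    and le: "\<And>n. cmod (Ln (z + of_nat n + 1) - Ln (z + of_nat n) - 1 / (z + of_nat n)) \<le> a n"
  shows "cmod (Digamma z - Ln z) \<le> suminf a"
proof -
  define d where "d = (\<lambda>n. Ln (z + of_nat n + 1) - Ln (z + of_nat n) - 1 / (z + of_nat n))"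
  have sum_d: "(\<Sum>n<m. d n) = Ln (z + of_nat m) - Ln z - (\<Sum>n<m. inverse (z + of_nat n))" for m
    by (induction m) (auto simp: d_def add_ac field_simps)
  have sd: "summable d" by (rule summable_comparison_test[OF _ a]) (use le in \<open>auto simp: d_def\<close>)
  \<comment> \<open>\<open>Ln (z + m) - ln m\<close> tends to 0; extracting the positive factor
    \<open>m\<close> causes no jump between branches.\<close>
  have "(\<lambda>m. Ln (1 + z / of_nat m)) \<longlonglongrightarrow> Ln (1 + 0)"
    by (intro tendsto_intros lim_const_over_n) auto
  moreover have "\<forall>\<^sub>F m in sequentially. Ln (1 + z / of_nat m) = Ln (z + of_nat m) - of_real (ln (real m))"
    using eventually_gt_at_top[of "nat \<lceil>cmod z\<rceil>"]
  proof eventually_elim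
    case (elim m)
    hence m: "real m > cmod z" by linarith
    hence m0: "real m > 0" using norm_ge_zero[of z] by linarith
    have "1 + z / of_nat m \<noteq> 0"
    proof
      assume "1 + z / of_nat m = 0"
      hence "z = - of_nat m" using m0 by (simp add: field_simps eq_neg_iff_add_eq_0)
      thus False using m by simp
    qed
    hence "Ln (of_real (real m) * (1 + z / of_nat m)) = of_real (ln (real m)) + Ln (1 + z / of_nat m)"
      using m0 by (subst Ln_times_of_real) auto
    also have "of_real (real m) * (1 + z / of_nat m) = z + of_nat m" using m0 by (simp add: field_simps)
    finally show ?case by simp
  qed
  ultimately have 1: "(\<lambda>m. Ln (z + of_nat m) - of_real (ln (real m))) \<longlonglongrightarrow> 0"
    using Lim_transform_eventually by fastforce
  have "(\<lambda>m. (of_real (ln (real m)) - (\<Sum>n<m. inverse (z + of_nat n)))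
      + (Ln (z + of_nat m) - of_real (ln (real m)))) \<longlonglongrightarrow> Digamma z + 0"
    by (intro tendsto_add Digamma_LIMSEQ[OF z] 1)
  hence "(\<lambda>m. (\<Sum>n<m. d n) + Ln z) \<longlonglongrightarrow> Digamma z" by (simp add: sum_d algebra_simps)
  moreover have "(\<lambda>m. (\<Sum>n<m. d n) + Ln z) \<longlonglongrightarrow> suminf d + Ln z"
    by (intro tendsto_intros summable_LIMSEQ sd)
  ultimately have "Digamma z - Ln z = suminf d" using LIMSEQ_unique by fastforce
  also have "cmod \<dots> \<le> suminf a" by (rule norm_suminf_le[OF _ a]) (use le in \<open>auto simp: d_def\<close>)
  finally show ?thesis .
qed

lemma Digamma_minus_Ln_Im:
  assumes z: "\<bar>Im z\<bar> \<ge> 1"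
  shows "cmod (Digamma z - Ln z) \<le> 20 / \<bar>Im z\<bar>"
proof -
  \<comment> \<open>All is doubled to fit the spacing 2 of \<open>inverse_square_grid_sum\<close>;
    \<open>a n\<close> is \<open>2 / (cmod (z + of_nat n))\<^sup>2\<close>.\<close>
  define a where "a = (\<lambda>n. 8 * (1 / ((2 * Re z + 2 * real n)\<^sup>2 + (2 * Im z)\<^sup>2)))"
  have z2: "\<bar>2 * Im z\<bar> \<ge> 1" using z by simp
  have sa: "summable a" unfolding a_def by (intro summable_mult inverse_square_grid_sum z2)
  have "cmod (Digamma z - Ln z) \<le> suminf a"
  proof (rule Digamma_minus_Ln_bound[OF _ sa])
    fix n
    define w where "w = z + of_nat n"
    have w: "Im w = Im z" "Re w = Re z + real n" by (auto simp: w_def)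
    have "cmod (Ln (w + 1) - Ln w - 1 / w) \<le> 1 / (1 / 2 * (cmod w)\<^sup>2)"
    proof (rule Ln_Suc_diff_bound)
      fix t :: real assume t: "0 \<le> t" "t \<le> 1"
      have i: "Im (w + of_real t) = Im z" by (simp add: w)
      thus "w + complex_of_real t \<notin> \<real>\<^sub>\<le>\<^sub>0" using z by (auto simp: complex_nonpos_Reals_iff)
      have "1 \<le> cmod (w + of_real t)" using abs_Im_le_cmod[of "w + of_real t"] z i by linarith
      moreover have "cmod w \<le> cmod (w + of_real t) + t"
        using norm_triangle_ineq4[of "w + of_real t" "of_real t"] t by simp
      ultimately show "1 / 2 * cmod w \<le> cmod (w + of_real t)" using t by simp
    qed (use z w in auto)
    also have "1 / (1 / 2 * (cmod w)\<^sup>2) = a n"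
    proof -
      have "(2 * Re z + 2 * real n)\<^sup>2 + (2 * Im z)\<^sup>2 = 4 * (cmod w)\<^sup>2"
        unfolding cmod_power2 w by (simp add: power2_eq_square algebra_simps)
      thus ?thesis by (simp add: a_def)
    qed
    finally show "cmod (Ln (z + of_nat n + 1) - Ln (z + of_nat n) - 1 / (z + of_nat n)) \<le> a n"
      by (simp add: w_def)
  qed (use z in auto)
  also have "suminf a \<le> 8 * (5 / \<bar>2 * Im z\<bar>)" unfolding a_def
    by (subst suminf_mult[OF inverse_square_grid_sum(1)[OF z2]]) (intro mult_left_mono inverse_square_grid_sum z2, simp)
  finally show ?thesis by (simp add: field_simps)
qed

text \<open>The counterpart for large real part, uniform in the imaginary part down to the real
  axis: \<open>1 / x\<^sup>2\<close> is at most \<open>1 / (x - 1) - 1 / x\<close>, which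
  telescopes.\<close>

lemma Digamma_minus_Ln_Re:
  assumes z: "Re z > 1"
  shows "cmod (Digamma z - Ln z) \<le> 1 / (Re z - 1)"
proof -
  define a where "a = (\<lambda>n. 1 / (Re z + real n - 1) - 1 / (Re z + real (Suc n) - 1))"
  have sa: "a sums (1 / (Re z + real 0 - 1) - 0)" unfolding a_def
    by (rule telescope_sums') real_asymp
  have "cmod (Digamma z - Ln z) \<le> suminf a"
  proof (rule Digamma_minus_Ln_bound[OF _ sums_summable[OF sa]])
    fix n
    define w where "w = z + of_nat n"
    have w: "Re w = Re z + real n" by (auto simp: w_def)
    have "cmod (Ln (w + 1) - Ln w - 1 / w) \<le> 1 / (1 * (cmod w)\<^sup>2)"
    proof (rule Ln_Suc_diff_bound)
      fix t :: real assume t: "0 \<le> t" "t \<le> 1"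
      show "w + complex_of_real t \<notin> \<real>\<^sub>\<le>\<^sub>0" using z t by (auto simp: complex_nonpos_Reals_iff w)
      have "(Re w)\<^sup>2 \<le> (Re w + t)\<^sup>2" using z w t by (intro power_mono) auto
      hence "(cmod w)\<^sup>2 \<le> (cmod (w + of_real t))\<^sup>2" unfolding cmod_power2 by simp
      thus "1 * cmod w \<le> cmod (w + of_real t)" using power2_le_imp_le by auto
    qed (use z w in auto)
    also have "\<dots> \<le> 1 / (Re w)\<^sup>2"
      using z w by (auto intro!: divide_left_mono mult_pos_pos simp: cmod_power2 add_pos_nonneg)
    also have "\<dots> \<le> a n" using z unfolding a_def w by (simp add: divide_simps power2_eq_square)
    finally show "cmod (Ln (z + of_nat n + 1) - Ln (z + of_nat n) - 1 / (z + of_nat n)) \<le> a n"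
      by (simp add: w_def)
  qed (use z in auto)
  also have "suminf a = 1 / (Re z - 1)" using sa by (simp add: sums_iff)
  finally show ?thesis .
qed

lemma ln_diff_bound:
  fixes a b :: real
  assumes "m > 0" "a \<ge> m" "b \<ge> m"
  shows "\<bar>ln a - ln b\<bar> \<le> \<bar>a - b\<bar> / m"
proof -
  have *: "ln a - ln b \<le> \<bar>a - b\<bar> / m" if "a \<ge> m" "b \<ge> m" for a b :: real
  proof -
    have "ln a - ln b \<le> (a - b) / b"
      using ln_diff_le[of a b] that assms(1) by simp
    also have "\<dots> \<le> \<bar>a - b\<bar> / b" using that assms(1) by (intro divide_right_mono) auto
    also have "\<dots> \<le> \<bar>a - b\<bar> / m" using that assms(1) by (intro divide_left_mono) auto
    finally show ?thesis .
  qed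
  show ?thesis using *[OF assms(2,3)] *[OF assms(3,2)] by (simp add: abs_minus_commute abs_le_iff)
qed

text \<open>
  Replacing \<open>a n\<close> by \<open>- 2 (n + N)\<close> costs \<open>O(1 / \<bar>Im s\<bar>)\<close> in total and turns the sum into the digamma function
  at \<open>s / 2 + N\<close>.
\<close>

lemma real_zeros_sum_asymp:
  fixes a :: "nat \<Rightarrow> real"
  assumes N: "N \<ge> 1"
    and a: "\<And>n. - 2 * real (n + N) \<le> a n" "\<And>n. a n \<le> - 2 * real (n + N) + 1"
  obtains c K where "K > 0" "\<And>s. \<bar>Im s\<bar> \<ge> 2 \<Longrightarrow>
     summable (\<lambda>n. Re (1 / (s - of_real (a n)) - 1 / (1 - of_real (a n))))"
    "\<And>s. \<bar>Im s\<bar> \<ge> 2 \<Longrightarrow>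
     \<bar>(\<Sum>n. Re (1 / (s - of_real (a n)) - 1 / (1 - of_real (a n)))) - (c - ln (cmod s) / 2)\<bar> \<le> K / \<bar>Im s\<bar>"
proof -
  \<comment> \<open>Each term is split into three: \<open>u\<close> is the cost of moving
    \<open>a n\<close> to an even integer, \<open>v\<close> is a digamma series, and
    \<open>w\<close> does not involve \<open>s\<close>.\<close>
  define u where "u = (\<lambda>s n. 1 / (s - complex_of_real (a n)) - 1 / (s + of_real (2 * (real n + real N))))"
  define v where "v = (\<lambda>s n. 1 / (s + complex_of_real (2 * (real n + real N))) - 1 / of_real (2 * real n + 2))"
  define w where "w = (\<lambda>n. 1 / complex_of_real (2 * real n + 2) - 1 / (1 - of_real (a n)))"
  have sw: "summable w"
  proof (rule summable_comparison_test)
    show "\<exists>M. \<forall>n\<ge>M. norm (w n) \<le> real N * (1 / (1 + real n) ^ 2)"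
    proof (intro exI allI impI)
      fix n :: nat
      have p: "2 * real n + 2 \<le> 1 - a n" using a(2)[of n] N by simp
      have "w n = of_real (1 / (2 * real n + 2) - 1 / (1 - a n))" by (simp add: w_def)
      hence "norm (w n) = \<bar>1 / (2 * real n + 2) - 1 / (1 - a n)\<bar>" by (simp only: norm_of_real)
      also have "\<dots> = (1 - a n - (2 * real n + 2)) / ((2 * real n + 2) * (1 - a n))"
      proof -
        have "\<bar>1 / q - 1 / r\<bar> = (r - q) / (q * r)" if "0 < q" "q \<le> r" for q r :: real
        proof -
          have "1 / q - 1 / r = (r - q) / (q * r)" using that by (simp add: divide_simps)
          thus ?thesis using that by simp
        qed
        thus ?thesis using p by simp
      qed
      also have "\<dots> \<le> (2 * real N) / ((2 * real n + 2) * (2 * real n + 2))"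
        using p a(1)[of n] by (intro frac_le mult_left_mono) auto
      also have "(2 * real n + 2) * (2 * real n + 2) = 4 * (1 + real n) ^ 2"
        by (simp add: power2_eq_square algebra_simps)
      also have "2 * real N / (4 * (1 + real n) ^ 2) \<le> real N * (1 / (1 + real n) ^ 2)"
        by (simp add: divide_simps)
      finally show "norm (w n) \<le> real N * (1 / (1 + real n) ^ 2)" .
    qed
    have "summable (\<lambda>n. 1 / (real (Suc n)) ^ 2)"
      using inverse_power_summable[of 2, where 'a = real] summable_Suc_iff[of "\<lambda>n. inverse (real n ^ 2)"]
      by (simp add: inverse_eq_divide)
    thus "summable (\<lambda>n. real N * (1 / (1 + real n) ^ 2))" by (intro summable_mult) simp
  qed
  have u: "summable (u s)" "cmod (suminf (u s)) \<le> 10 / \<bar>Im s\<bar>" if s: "\<bar>Im s\<bar> \<ge> 2" for s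
  proof -
    define b where "b = (\<lambda>n. 2 * (1 / ((Re s + 2 * real N + 2 * real n)\<^sup>2 + (Im s)\<^sup>2)))"
    have s1: "\<bar>Im s\<bar> \<ge> 1" using s by simp
    have sb: "summable b" unfolding b_def by (intro summable_mult inverse_square_grid_sum s1)
    have le: "norm (u s n) \<le> b n" for n
    proof -
      define p where "p = s - complex_of_real (a n)"
      define q where "q = s + complex_of_real (2 * (real n + real N))"
      have p1: "1 \<le> cmod p" using abs_Im_le_cmod[of p] s by (simp add: p_def)
      have q1: "1 \<le> cmod q" using abs_Im_le_cmod[of q] s by (simp add: q_def)
      have "q - p = of_real (a n + 2 * (real n + real N))" by (simp add: p_def q_def)
      hence qp: "cmod (q - p) \<le> 1" using a[of n] by (simp only: norm_of_real) auto
      have "cmod q \<le> cmod p + cmod (q - p)" using norm_triangle_ineq[of p "q - p"] by simp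
      hence "cmod q \<le> 2 * cmod p" using p1 qp by simp
      moreover have "u s n = (q - p) / (p * q)" using p1 q1 unfolding u_def p_def[symmetric] q_def[symmetric]
        by (subst diff_frac_eq) auto
      hence "norm (u s n) = cmod (q - p) / (cmod p * cmod q)" by (simp add: norm_divide norm_mult)
      moreover have "\<dots> \<le> 1 / (cmod q / 2 * cmod q)"
        using calculation(1) p1 q1 qp by (intro frac_le mult_right_mono mult_pos_pos) auto
      moreover have "\<dots> = b n"
        by (simp add: b_def q_def cmod_power2[symmetric] power2_eq_square[symmetric] cmod_def add_ac distrib_left)
      ultimately show ?thesis by linarith
    qed
    show "summable (u s)" by (rule summable_comparison_test[OF _ sb]) (use le in auto)
    have "cmod (suminf (u s)) \<le> suminf b" by (rule norm_suminf_le[OF le sb])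
    also have "\<dots> \<le> 2 * (5 / \<bar>Im s\<bar>)" unfolding b_def
      by (subst suminf_mult[OF inverse_square_grid_sum(1)[OF s1]]) (intro mult_left_mono inverse_square_grid_sum s1, simp)
    finally show "cmod (suminf (u s)) \<le> 10 / \<bar>Im s\<bar>" by simp
  qed
  have v: "v s sums (- (Digamma (s / 2 + of_nat N) + euler_mascheroni) / 2)" if s: "\<bar>Im s\<bar> \<ge> 2" for s
  proof -
    have nz: "s / 2 + of_nat N \<noteq> 0" using s by (auto simp: complex_eq_iff)
    have "(\<lambda>n. (- 1 / 2) * (inverse (of_nat (Suc n)) - inverse (s / 2 + of_nat N + of_nat n))) sums
       ((- 1 / 2) * (Digamma (s / 2 + of_nat N) + euler_mascheroni))"
      using summable_sums[OF summable_Digamma[OF nz]] by (intro sums_mult) (simp add: Digamma_def)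
    moreover have "(- 1 / 2) * (inverse (of_nat (Suc n)) - inverse (s / 2 + of_nat N + of_nat n)) = v s n" for n
    proof -
      have nz2: "s + 2 * of_nat N + 2 * of_nat n \<noteq> 0" using s by (auto simp: complex_eq_iff)
      have "s / 2 + of_nat N + of_nat n = (s + 2 * of_nat N + 2 * of_nat n) / 2" by simp
      hence "inverse (s / 2 + of_nat N + of_nat n) = 2 / (s + 2 * of_nat N + 2 * of_nat n)"
        by (simp only: inverse_divide)
      moreover have "complex_of_real (2 * real n + 2) = 2 * of_nat (Suc n)"
        "s + complex_of_real (2 * (real n + real N)) = s + 2 * of_nat N + 2 * of_nat n" by simp_all
      moreover have "(- 1 / 2) * (inverse A - 2 / X) = 1 / X - 1 / (2 * A)" for A X :: complex
        by (simp add: algebra_simps inverse_eq_divide)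
      ultimately show ?thesis unfolding v_def by (simp only:)
    qed
    ultimately have "v s sums ((- 1 / 2) * (Digamma (s / 2 + of_nat N) + euler_mascheroni))" by (simp only:)
    moreover have "(- 1 / 2) * (Digamma (s / 2 + of_nat N) + euler_mascheroni) =
       - (Digamma (s / 2 + of_nat N) + euler_mascheroni) / 2" by (simp add: add_divide_distrib)
    ultimately show ?thesis by (simp only:)
  qed
  have eq: "1 / (s - of_real (a n)) - 1 / (1 - of_real (a n)) = u s n + v s n + w n" for s n
    by (simp add: u_def v_def w_def)
  \<comment> \<open>The \<open>ln 2 / 2\<close> arises because the digamma function is taken near
    \<open>s / 2\<close>. In \<open>K\<close>, 10 comes from \<open>u\<close>, 20 from
    \<open>Digamma - Ln\<close>, and \<open>real N\<close> from the shift by \<open>N\<close> inside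
    the logarithm.\<close>
  define c where "c = Re (suminf w) - Re euler_mascheroni / 2 + ln 2 / 2"
  define K where "K = 30 + real N"
  have sums: "(\<lambda>n. Re (1 / (s - of_real (a n)) - 1 / (1 - of_real (a n)))) sums
     Re (suminf (u s) + (- (Digamma (s / 2 + of_nat N) + euler_mascheroni) / 2) + suminf w)"
    if s: "\<bar>Im s\<bar> \<ge> 2" for s unfolding eq
    by (intro sums_Re sums_add summable_sums sw u v s)
  show ?thesis
  proof (rule that[of K c])
    show "K > 0" by (simp add: K_def)
    fix s assume s: "\<bar>Im s\<bar> \<ge> 2"
    show "summable (\<lambda>n. Re (1 / (s - of_real (a n)) - 1 / (1 - of_real (a n))))"
      using sums[OF s] by (rule sums_summable)
    define z where "z = s / 2 + of_nat N"
    have Imz: "Im z = Im s / 2" by (simp add: z_def)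
    hence absz: "\<bar>Im z\<bar> = \<bar>Im s\<bar> / 2" by simp
    have z0: "z \<noteq> 0" using Imz s by auto
    have D: "\<bar>Re (Digamma z) - ln (cmod z)\<bar> \<le> 40 / \<bar>Im s\<bar>"
    proof -
      have "\<bar>Re (Digamma z - Ln z)\<bar> \<le> 20 / \<bar>Im z\<bar>"
        using Digamma_minus_Ln_Im[of z] abs_Re_le_cmod[of "Digamma z - Ln z"] s absz by linarith
      also have "20 / \<bar>Im z\<bar> = 40 / \<bar>Im s\<bar>" unfolding absz by simp
      finally show ?thesis using z0 by (simp add: Re_Ln)
    qed
    have "\<bar>ln (cmod z) - ln (cmod (s / 2))\<bar> \<le> \<bar>cmod z - cmod (s / 2)\<bar> / (\<bar>Im s\<bar> / 2)"
      using abs_Im_le_cmod[of z] abs_Im_le_cmod[of "s/2"] s by (intro ln_diff_bound) (auto simp: Imz)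
    also have "\<dots> \<le> real N / (\<bar>Im s\<bar> / 2)"
      using norm_triangle_ineq3[of z "s/2"] by (intro divide_right_mono) (auto simp: z_def)
    finally have E: "\<bar>ln (cmod z) - ln (cmod (s / 2))\<bar> \<le> 2 * real N / \<bar>Im s\<bar>" by (simp add: mult.commute)
    have F: "ln (cmod (s / 2)) = ln (cmod s) - ln 2"
      using s by (subst norm_divide, subst ln_div) auto
    have U: "\<bar>Re (suminf (u s))\<bar> \<le> 10 / \<bar>Im s\<bar>" using u(2)[OF s] abs_Re_le_cmod[of "suminf (u s)"] by linarith
    have "(\<Sum>n. Re (1 / (s - of_real (a n)) - 1 / (1 - of_real (a n)))) =
       Re (suminf (u s)) - (Re (Digamma z) + Re euler_mascheroni) / 2 + Re (suminf w)"
      by (subst sums_unique[OF sums[OF s], symmetric]) (simp add: z_def add_divide_distrib)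
    hence "\<bar>(\<Sum>n. Re (1 / (s - of_real (a n)) - 1 / (1 - of_real (a n)))) - (c - ln (cmod s) / 2)\<bar>
       = \<bar>Re (suminf (u s)) - (Re (Digamma z) - ln (cmod z)) / 2 - (ln (cmod z) - ln (cmod (s / 2))) / 2\<bar>"
      unfolding c_def F by (simp add: field_simps)
    also have "\<dots> \<le> 10 / \<bar>Im s\<bar> + (40 / \<bar>Im s\<bar>) / 2 + (2 * real N / \<bar>Im s\<bar>) / 2"
    proof -
      have "\<bar>A - B / 2 - C / 2\<bar> \<le> a + b / 2 + c / 2" if "\<bar>A\<bar> \<le> a" "\<bar>B\<bar> \<le> b" "\<bar>C\<bar> \<le> c" for A B C a b c :: real
        using that by linarith
      thus ?thesis using U D E by blast
    qed
    also have "\<dots> = K / \<bar>Im s\<bar>" by (simp add: K_def add_divide_distrib)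
    finally show "\<bar>(\<Sum>n. Re (1 / (s - of_real (a n)) - 1 / (1 - of_real (a n)))) - (c - ln (cmod s) / 2)\<bar> \<le> K / \<bar>Im s\<bar>" .
  qed
qed


section \<open>Partial fractions of the logarithmic derivative of zeta'\<close>

text \<open>
  The entire function \<open>(s - 1)\<^sup>2 \<zeta>'(s)\<close>, written without the pole.
\<close>

definition zeta_deriv_num :: "complex \<Rightarrow> complex" where
  "zeta_deriv_num s = (s - 1) * deriv entire_zeta s - entire_zeta s"

text \<open>
  The point 1 is excluded because the value of \<open>zeta'\<close> there is meaningless.
\<close>

definition zeta'_zeros :: "(complex \<times> nat) set" where
  "zeta'_zeros = {(z, k). z \<noteq> 1 \<and> zeta' z = 0 \<and> k < nat (zorder zeta' z)}"

lemma zeta_deriv_num_holomorphic: "zeta_deriv_num holomorphic_on UNIV"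
  unfolding zeta_deriv_num_def
  by (intro holomorphic_intros holomorphic_deriv entire_zeta_holomorphic) auto

text \<open>The double pole of \<open>zeta'\<close> at 1 is cancelled and leaves a nonzero value, so
  1 can serve as the base point of the partial fractions.\<close>

lemma zeta_deriv_num_1: "zeta_deriv_num 1 = -1"
  by (simp add: zeta_deriv_num_def entire_zeta_1)

lemma zeta_deriv_num_eq:
  assumes s: "s \<noteq> 1"
  shows "zeta_deriv_num s = (s - 1)\<^sup>2 * zeta' s"
proof -
  have Z: "(entire_zeta has_field_derivative deriv entire_zeta s) (at s)"
    using entire_zeta_holomorphic by (rule holomorphic_derivI) auto
  have "((\<lambda>s. entire_zeta s / (s - 1)) has_field_derivative
      (deriv entire_zeta s * (s - 1) - entire_zeta s * 1) / ((s - 1) * (s - 1))) (at s)"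
    using s by (intro DERIV_divide Z) (auto intro!: derivative_eq_intros)
  hence "(zeta has_field_derivative
      (deriv entire_zeta s * (s - 1) - entire_zeta s * 1) / ((s - 1) * (s - 1))) (at s)"
    by (rule has_field_derivative_transform_within_open[of _ _ _ "- {1}"]) (use s in \<open>auto simp: zeta_conv_entire\<close>)
  hence "zeta' s = (deriv entire_zeta s * (s - 1) - entire_zeta s * 1) / ((s - 1) * (s - 1))"
    by (rule DERIV_imp_deriv)
  thus ?thesis using s by (simp add: zeta_deriv_num_def power2_eq_square)
qed

lemma zeta'_holomorphic: "zeta' holomorphic_on - {1}"
  by (intro holomorphic_deriv zeta_holomorphic) auto

lemma zeta_DERIV: "s \<noteq> 1 \<Longrightarrow> (zeta has_field_derivative zeta' s) (at s)"
  using zeta_holomorphic by (intro holomorphic_derivI[of _ "-{1}"]) auto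

lemma zeta'_DERIV: "s \<noteq> 1 \<Longrightarrow> (zeta' has_field_derivative zeta'' s) (at s)"
  using zeta'_holomorphic by (intro holomorphic_derivI[of _ "-{1}"]) auto

lemma zeta'_not_identically_0: "\<exists>w\<in>-{1}. zeta' w \<noteq> 0"
proof -
  have "isCont zeta_deriv_num 1"
    using zeta_deriv_num_holomorphic by (metis UNIV_I continuous_on_eq_continuous_at holomorphic_on_imp_continuous_on open_UNIV)
  hence "zeta_deriv_num \<midarrow>1\<rightarrow> -1" by (simp add: isCont_def zeta_deriv_num_1)
  hence "\<forall>\<^sub>F w in at 1. zeta_deriv_num w \<noteq> 0" by (rule tendsto_imp_eventually_ne) simp
  moreover have "\<forall>\<^sub>F w in at (1::complex). w \<noteq> 1" by (simp add: eventually_at_filter)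
  ultimately have "\<forall>\<^sub>F w in at 1. zeta_deriv_num w \<noteq> 0 \<and> w \<noteq> 1" by eventually_elim auto
  hence "\<exists>w. zeta_deriv_num w \<noteq> 0 \<and> w \<noteq> 1" by (intro eventually_happens'[of "at 1"]) auto
  thus ?thesis by (auto simp: zeta_deriv_num_eq)
qed

lemma zeta'_zero_factor:
  assumes z: "z \<noteq> 1" "zeta' z = 0"
  obtains r g where "r > 0" "ball z r \<subseteq> - {1}" "g holomorphic_on ball z r" "g z \<noteq> 0"
    "\<And>w. w \<in> ball z r \<Longrightarrow> zeta' w = g w * (w - z) ^ nat (zorder zeta' z)" "zorder zeta' z > 0"
proof -
  have "(if zeta' z = 0 then zorder zeta' z > 0 else zorder zeta' z = 0) \<and>
      (\<exists>r. r>0 \<and> cball z r \<subseteq> - {1} \<and> zor_poly zeta' z holomorphic_on cball z r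
    \<and> (\<forall>w\<in>cball z r. zeta' w  = zor_poly zeta' z w * (w-z) ^ nat (zorder zeta' z)  \<and> zor_poly zeta' z w \<noteq>0))"
    by (rule zorder_exist_zero[OF zeta'_holomorphic]) (use z zeta'_not_identically_0 in \<open>auto intro: connected_punctured_universe\<close>)
  then obtain r where "r>0" "cball z r \<subseteq> - {1}" "zor_poly zeta' z holomorphic_on cball z r"
    "\<forall>w\<in>cball z r. zeta' w  = zor_poly zeta' z w * (w-z) ^ nat (zorder zeta' z)  \<and> zor_poly zeta' z w \<noteq>0"
    "zorder zeta' z > 0"
    using z by auto
  thus ?thesis
    by (intro that[of r "zor_poly zeta' z"])
       (auto intro: holomorphic_on_subset[of _ "cball z r"] simp: subset_iff less_imp_le)
qed

text \<open>Near \<open>z - 1\<close> the two functions differ by a shift and the factor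
  \<open>w\<^sup>2\<close>, which is nonzero at \<open>z - 1\<close>.\<close>

lemma zorder_zeta_deriv_num:
  assumes z: "z \<noteq> 1" "zeta' z = 0"
  shows "zorder (\<lambda>w. zeta_deriv_num (1 + w)) (z - 1) = zorder zeta' z"
proof -
  obtain r g where g: "r > 0" "ball z r \<subseteq> - {1}" "g holomorphic_on ball z r" "g z \<noteq> 0"
    "\<And>w. w \<in> ball z r \<Longrightarrow> zeta' w = g w * (w - z) ^ nat (zorder zeta' z)" "zorder zeta' z > 0"
    by (rule zeta'_zero_factor[OF z]) blast
  show ?thesis
  proof (rule zorder_eqI[of "ball (z - 1) r" _ "\<lambda>w. w\<^sup>2 * g (1 + w)"])
    have sub: "1 + w \<in> ball z r" if "w \<in> ball (z - 1) r" for w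
      using that by (simp add: dist_norm algebra_simps)
    have "(g \<circ> (\<lambda>w. 1 + w)) holomorphic_on ball (z - 1) r"
      by (rule holomorphic_on_compose_gen[OF _ g(3)]) (use sub in \<open>auto intro!: holomorphic_intros\<close>)
    thus "(\<lambda>w. w\<^sup>2 * g (1 + w)) holomorphic_on ball (z - 1) r"
      unfolding o_def by (intro holomorphic_intros)
    fix w assume w: "w \<in> ball (z - 1) r"
    from sub[OF w] g(2) have "1 + w \<noteq> 1" by auto
    thus "zeta_deriv_num (1 + w) = w\<^sup>2 * g (1 + w) * (w - (z - 1)) powi zorder zeta' z"
      using g(5)[OF sub[OF w]] g(6) by (simp add: zeta_deriv_num_eq power_int_def algebra_simps)
  qed (use g z in auto)
qed

text \<open>Cauchy's estimate on unit circles for the derivative, then a shift by 1. Either enlarges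
  \<open>1 + cmod s\<close> at most to twice its size, which costs a factor 3 in the exponent since
  \<open>2 powr (3/2) \<le> 3\<close>.\<close>

lemma zeta_deriv_num_growth:
  obtains C where "entire_growth (\<lambda>w. zeta_deriv_num (1 + w)) C"
proof -
  obtain C :: real where C: "C > 0" "\<And>s. cmod (entire_zeta s) \<le> exp (C * (1 + cmod s) powr (3/2))"
    using entire_zeta_growth by blast
  have two: "(2 * X) powr (3/2) \<le> 3 * X powr (3/2)" if "X \<ge> 0" for X :: real
  proof -
    have "(2::real) powr (3/2) = 2 powr (1 + 1/2)" by simp
    also have "\<dots> = 2 * sqrt 2" unfolding powr_add by (simp add: powr_half_sqrt)
    also have "\<dots> \<le> 2 * (3 / 2)" by (intro mult_left_mono real_le_lsqrt) (auto simp: power2_eq_square)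
    finally have "(2::real) powr (3/2) \<le> 3" by simp
    thus ?thesis using that by (simp add: powr_mult mult_right_mono)
  qed
  have le: "X \<le> X powr (3/2)" if "X \<ge> 1" for X :: real
    using powr_mono[of 1 "3/2" X] that by simp
  have Zd: "cmod (deriv entire_zeta s) \<le> exp (3 * C * (1 + cmod s) powr (3/2))" for s
  proof -
    have "cmod ((deriv ^^ 1) entire_zeta s) \<le> fact 1 * exp (3 * C * (1 + cmod s) powr (3/2)) / 1 ^ 1"
    proof (rule Cauchy_inequality)
      show "entire_zeta holomorphic_on ball s 1" "continuous_on (cball s 1) entire_zeta"
        using entire_zeta_holomorphic by (auto intro: holomorphic_on_subset holomorphic_on_imp_continuous_on)
      fix x assume x: "cmod (s - x) = 1"
      have "cmod x \<le> cmod s + 1" using norm_triangle_ineq2[of x s] x by (simp add: norm_minus_commute)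
      hence "1 + cmod x \<le> 2 * (1 + cmod s)" using norm_ge_zero[of s] by argo
      hence "(1 + cmod x) powr (3/2) \<le> (2 * (1 + cmod s)) powr (3/2)"
        by (intro powr_mono2) auto
      also have "\<dots> \<le> 3 * (1 + cmod s) powr (3/2)" by (rule two) simp
      finally have "C * (1 + cmod x) powr (3/2) \<le> C * (3 * (1 + cmod s) powr (3/2))"
        using C(1) by (intro mult_left_mono) auto
      thus "cmod (entire_zeta x) \<le> exp (3 * C * (1 + cmod s) powr (3/2))"
        using C(2)[of x] by (simp add: mult_ac) (meson exp_le_cancel_iff order_trans)
    qed auto
    thus ?thesis by simp
  qed
  have N: "cmod (zeta_deriv_num s) \<le> exp ((3 * C + 2) * (1 + cmod s) powr (3/2))" for s
  proof -
    define T where "T = (1 + cmod s) powr (3/2)"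
    have T: "1 + cmod s \<le> T" unfolding T_def by (rule le) simp
    have "cmod (zeta_deriv_num s) \<le> cmod (s - 1) * cmod (deriv entire_zeta s) + cmod (entire_zeta s)"
      unfolding zeta_deriv_num_def norm_mult[symmetric] by (rule norm_triangle_ineq4)
    also have "\<dots> \<le> (1 + cmod s) * exp (3 * C * T) + 1 * exp (3 * C * T)"
    proof (intro add_mono mult_mono)
      show "cmod (s - 1) \<le> 1 + cmod s" using norm_triangle_ineq4[of s 1] by simp
      have "T \<ge> 0" by (simp add: T_def)
      hence "C * T \<le> 3 * C * T" using C(1) by simp
      thus "cmod (entire_zeta s) \<le> 1 * exp (3 * C * T)" using C(2)[of s] unfolding T_def
        by (simp add: order_trans)
    qed (use Zd[of s] in \<open>auto simp: T_def\<close>)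
    also have "\<dots> = (1 + (1 + cmod s)) * exp (3 * C * T)" by (simp add: algebra_simps)
    also have "\<dots> \<le> exp (1 + cmod s) * exp (3 * C * T)" by (intro mult_right_mono exp_ge_add_one_self) auto
    also have "1 + cmod s \<le> 2 * T" using T norm_ge_zero[of s] by argo
    hence "exp (1 + cmod s) * exp (3 * C * T) \<le> exp (2 * T) * exp (3 * C * T)" by (intro mult_right_mono) auto
    also have "\<dots> = exp ((3 * C + 2) * T)" by (simp add: exp_add[symmetric] algebra_simps)
    finally show ?thesis by (simp add: T_def)
  qed
  have "entire_growth (\<lambda>w. zeta_deriv_num (1 + w)) (3 * (3 * C + 2))"
  proof
    have "(zeta_deriv_num \<circ> (\<lambda>w. 1 + w)) holomorphic_on UNIV"
      by (rule holomorphic_on_compose_gen[OF _ zeta_deriv_num_holomorphic]) (auto intro!: holomorphic_intros)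
    thus "(\<lambda>w. zeta_deriv_num (1 + w)) holomorphic_on UNIV" by (simp add: o_def)
    show "zeta_deriv_num (1 + 0) \<noteq> 0" by (simp add: zeta_deriv_num_1)
    show "0 < 3 * (3 * C + 2)" using C by simp
    fix w
    have "(1 + cmod (1 + w)) powr (3/2) \<le> (2 * (1 + cmod w)) powr (3/2)"
    proof (rule powr_mono2)
      have "cmod (1 + w) \<le> 1 + cmod w" using norm_triangle_ineq[of 1 w] by simp
      thus "1 + cmod (1 + w) \<le> 2 * (1 + cmod w)" using norm_ge_zero[of w] by argo
    qed auto
    moreover have "(2 * (1 + cmod w)) powr (3/2) \<le> 3 * (1 + cmod w) powr (3/2)" by (rule two) simp
    ultimately have "(3 * C + 2) * (1 + cmod (1 + w)) powr (3/2) \<le> (3 * C + 2) * (3 * (1 + cmod w) powr (3/2))"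
      using C(1) by (intro mult_left_mono) auto
    hence "exp ((3 * C + 2) * (1 + cmod (1 + w)) powr (3/2)) \<le> exp ((3 * C + 2) * (3 * (1 + cmod w) powr (3/2)))"
      by (subst exp_le_cancel_iff)
    thus "cmod (zeta_deriv_num (1 + w)) \<le> exp (3 * (3 * C + 2) * (1 + cmod w) powr (3/2))"
      using N[of "1 + w"] by (simp only: mult_ac)
  qed
  thus ?thesis by (rule that)
qed

lemma bij_zeta'_zeros:
  "bij_betw (\<lambda>(z, k). (z - 1, k)) zeta'_zeros (zeros_with_mult (\<lambda>w. zeta_deriv_num (1 + w)))"
proof (rule bij_betwI[of _ _ _ "\<lambda>(z, k). (z + 1, k)"])
  show "(\<lambda>(z, k). (z - 1, k)) \<in> zeta'_zeros \<rightarrow> zeros_with_mult (\<lambda>w. zeta_deriv_num (1 + w))"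
    by (auto simp: zeta'_zeros_def zeros_with_mult_def zorder_zeta_deriv_num zeta_deriv_num_eq)
  show "(\<lambda>(z, k). (z + 1, k)) \<in> zeros_with_mult (\<lambda>w. zeta_deriv_num (1 + w)) \<rightarrow> zeta'_zeros"
  proof (safe)
    fix w k assume *: "(w, k) \<in> zeros_with_mult (\<lambda>w. zeta_deriv_num (1 + w))"
    hence w: "w + 1 \<noteq> 1" using zeta_deriv_num_1 by (auto simp: zeros_with_mult_def)
    hence "zeta' (w + 1) = 0" using * zeta_deriv_num_eq[of "w + 1"] by (auto simp: zeros_with_mult_def add.commute)
    thus "(w + 1, k) \<in> zeta'_zeros"
      using * w zorder_zeta_deriv_num[OF w] by (auto simp: zeros_with_mult_def zeta'_zeros_def)
  qed
qed auto

lemma zeta'_zeros_inverse_square_summable: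
  "(\<lambda>p. 1 / (cmod (fst p - 1))\<^sup>2) summable_on zeta'_zeros"
proof -
  obtain C where "entire_growth (\<lambda>w. zeta_deriv_num (1 + w)) C" by (rule zeta_deriv_num_growth)
  hence "(\<lambda>p. 1 / (cmod (fst p))\<^sup>2) summable_on zeros_with_mult (\<lambda>w. zeta_deriv_num (1 + w))"
    by (rule entire_growth.zeros_inverse_square_summable)
  thus ?thesis
    by (subst (asm) summable_on_reindex_bij_betw[OF bij_zeta'_zeros, symmetric]) (simp add: case_prod_unfold)
qed

text \<open>The partial fractions for the function recentred at 1. The term
  \<open>2 / (s - 1)\<close> stems from the factor \<open>(s - 1)\<^sup>2\<close>, and
  \<open>c\<close> is the logarithmic derivative at the base point.\<close>

lemma zeta''_over_zeta'_has_sum: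
  obtains c where "\<And>s. s \<noteq> 1 \<Longrightarrow> zeta' s \<noteq> 0 \<Longrightarrow>
    ((\<lambda>p. 1 / (s - fst p) + 1 / (fst p - 1)) has_sum (zeta'' s / zeta' s + 2 / (s - 1) - c)) zeta'_zeros"
proof -
  define G where "G = (\<lambda>w. zeta_deriv_num (1 + w))"
  obtain C where G: "entire_growth G C" unfolding G_def by (rule zeta_deriv_num_growth)
  show ?thesis
  proof (rule that[of "deriv G 0 / G 0"])
    fix s assume s: "s \<noteq> 1" "zeta' s \<noteq> 0"
    have Gs: "G (s - 1) = (s - 1)\<^sup>2 * zeta' s" using s by (simp add: G_def zeta_deriv_num_eq)
    hence "G (s - 1) \<noteq> 0" using s by simp
    from entire_growth.logderiv_has_sum[OF G this]
    have "((\<lambda>p. 1 / (s - 1 - fst p) + 1 / fst p) has_sum (deriv G (s - 1) / G (s - 1) - deriv G 0 / G 0)) (zeros_with_mult G)" .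
    hence *: "((\<lambda>p. 1 / (s - fst p) + 1 / (fst p - 1)) has_sum (deriv G (s - 1) / G (s - 1) - deriv G 0 / G 0)) zeta'_zeros"
      by (subst (asm) has_sum_reindex_bij_betw[OF bij_zeta'_zeros[folded G_def], symmetric]) (simp add: case_prod_unfold)
    have "((\<lambda>w. w\<^sup>2 * zeta' (1 + w)) has_field_derivative (2 * (s - 1) * zeta' (1 + (s - 1)) + (s - 1)\<^sup>2 * zeta'' (1 + (s - 1)))) (at (s - 1))"
      using s by (auto intro!: derivative_eq_intros zeta'_DERIV[THEN DERIV_chain2])
    hence "(G has_field_derivative (2 * (s - 1) * zeta' (1 + (s - 1)) + (s - 1)\<^sup>2 * zeta'' (1 + (s - 1)))) (at (s - 1))"
      by (rule has_field_derivative_transform_within_open[of _ _ _ "- {0}"]) (use s in \<open>auto simp: G_def zeta_deriv_num_eq\<close>)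
    hence dG: "deriv G (s - 1) = 2 * (s - 1) * zeta' s + (s - 1)\<^sup>2 * zeta'' s"
      using DERIV_imp_deriv by fastforce
    have "deriv G (s - 1) / G (s - 1) = zeta'' s / zeta' s + 2 / (s - 1)"
    proof -
      have *: "(2 * a * b + a\<^sup>2 * c) / (a\<^sup>2 * b) = c / b + 2 / a" if "a \<noteq> 0" "b \<noteq> 0" for a b c :: complex
        using that by (simp add: field_simps power2_eq_square)
      show ?thesis unfolding Gs dG by (rule *) (use s in auto)
    qed
    thus "((\<lambda>p. 1 / (s - fst p) + 1 / (fst p - 1)) has_sum (zeta'' s / zeta' s + 2 / (s - 1) - deriv G 0 / G 0)) zeta'_zeros"
      using * by simp
  qed
qed


section \<open>Behaviour for Re s tending to infinity\<close>

text \<open>Limits along this filter are uniform in the imaginary part, so they hold along the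
  diagonals and yield zero-free half planes.\<close>

abbreviation right_end :: "complex filter" where
  "right_end \<equiv> filtercomap Re at_top"

lemma eventually_right_end: "eventually P right_end \<longleftrightarrow> (\<exists>K. \<forall>s. Re s \<ge> K \<longrightarrow> P s)"
  by (simp add: eventually_filtercomap_at_top_linorder)

lemma Re_right_end: "filterlim Re at_top right_end"
  by (rule filterlim_filtercomap)

text \<open>Cauchy's inequality on unit circles, all of which lie far to the right once the centre
  does.\<close>

lemma deriv_tendsto_0_right_end:
  assumes h: "h holomorphic_on {s. Re s > K}" and lim: "(h \<longlongrightarrow> 0) right_end"
  shows "(deriv h \<longlongrightarrow> 0) right_end"
proof (rule tendstoI)
  fix e :: real assume e: "e > 0"
  have "\<forall>\<^sub>F s in right_end. dist (h s) 0 < e / 2" using lim e by (intro tendstoD) auto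
  then obtain K1 where K1: "\<And>s. Re s \<ge> K1 \<Longrightarrow> cmod (h s) < e / 2"
    by (auto simp: eventually_right_end)
  show "\<forall>\<^sub>F s in right_end. dist (deriv h s) 0 < e"
    unfolding eventually_right_end
  proof (intro exI allI impI)
    fix s :: complex assume s: "Re s \<ge> max K K1 + 2"
    have near: "Re w \<ge> max K K1 + 1" if "dist s w \<le> 1" for w
      using that abs_Re_le_cmod[of "s - w"] s by (simp add: dist_norm)
    have sub: "cball s 1 \<subseteq> {s. Re s > K}" using near by fastforce
    have "cmod ((deriv ^^ 1) h s) \<le> fact 1 * (e / 2) / 1 ^ 1"
    proof (rule Cauchy_inequality)
      have "h holomorphic_on cball s 1" by (rule holomorphic_on_subset[OF h sub])
      thus "h holomorphic_on ball s 1" "continuous_on (cball s 1) h"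
        by (auto intro: holomorphic_on_subset[OF _ ball_subset_cball] holomorphic_on_imp_continuous_on)
      fix x assume "cmod (s - x) = 1"
      hence "Re x \<ge> K1" using near[of x] by (simp add: dist_norm)
      thus "cmod (h x) \<le> e / 2" using K1[of x] by simp
    qed auto
    thus "dist (deriv h s) 0 < e" using e by simp
  qed
qed

lemma powr_minus_Re_right_end: "((\<lambda>s. 2 powr (- Re s)) \<longlongrightarrow> (0::real)) right_end"
proof -
  have "((\<lambda>x. 2 powr (- x)) \<longlongrightarrow> (0::real)) at_top" by real_asymp
  from filterlim_compose[OF this Re_right_end] show ?thesis .
qed

text \<open>The relative error of the second Dirichlet term:
  \<open>zeta s = 1 + 2 powr (- s) * (1 + zeta_tail s)\<close>.\<close>

definition zeta_tail :: "complex \<Rightarrow> complex" where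
  "zeta_tail s = 2 powr s * (zeta s - 1) - 1"

lemma zeta_tail_holomorphic: "zeta_tail holomorphic_on {s. Re s > 1}"
  unfolding zeta_tail_def
  by (intro holomorphic_intros holomorphic_on_subset[OF zeta_holomorphic]) auto

lemma zeta_tail_tendsto: "(zeta_tail \<longlongrightarrow> 0) right_end"
proof -
  define c where "c = (\<Sum>n. real (n + 3) powr (- 2))"
  have sc: "summable (\<lambda>n. real (n + 3) powr (- 2))"
    using summable_ignore_initial_segment[of "\<lambda>n. real n powr (- 2)" 3] by (simp add: summable_real_powr_iff)
  have bound: "cmod (zeta_tail s) \<le> 9 * c * (2 / 3) powr Re s" if s: "Re s \<ge> 2" for s
  proof -
    have "(\<lambda>n. of_nat (Suc (n + 2)) powr (- s)) sums (zeta s - (\<Sum>n<2. of_nat (Suc n) powr (- s)))"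
      using s by (intro sums_split_initial_segment zeta_sums) auto
    hence sm: "(\<lambda>n. of_nat (n + 3) powr (- s)) sums (zeta s - 1 - 2 powr (- s))"
      by (simp add: numeral_2_eq_2 numeral_3_eq_3 algebra_simps)
    \<comment> \<open>A power with exponent -2 is kept for summability; the rest decreases in the
      base, so it is at most its value at 3. This also explains the factor
      \<open>9 = 3\<^sup>2\<close> above.\<close>
    have le: "norm (of_nat (n + 3) powr (- s)) \<le> real (n + 3) powr (- 2) * 3 powr (2 - Re s)" for n
    proof -
      have "norm (of_nat (n + 3) powr (- s)) = real (n + 3) powr (- Re s)"
        by (subst norm_powr_real_powr) auto
      also have "\<dots> = real (n + 3) powr (- 2) * real (n + 3) powr (2 - Re s)"
        by (simp add: powr_add[symmetric])
      also have "\<dots> \<le> real (n + 3) powr (- 2) * 3 powr (2 - Re s)"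
        using s by (intro mult_left_mono powr_mono2') auto
      finally show ?thesis .
    qed
    have "cmod (zeta s - 1 - 2 powr (- s)) \<le> (\<Sum>n. real (n + 3) powr (- 2) * 3 powr (2 - Re s))"
      unfolding sums_unique[OF sm] by (rule norm_suminf_le[OF le summable_mult2[OF sc]])
    also have "\<dots> = c * 3 powr (2 - Re s)" unfolding c_def by (rule suminf_mult2[OF sc, symmetric])
    finally have 1: "cmod (zeta s - 1 - 2 powr (- s)) \<le> c * 3 powr (2 - Re s)" .
    have "zeta_tail s = 2 powr s * (zeta s - 1 - 2 powr (- s))"
      by (simp add: zeta_tail_def algebra_simps powr_minus)
    hence "cmod (zeta_tail s) = 2 powr Re s * cmod (zeta s - 1 - 2 powr (- s))"
      by (simp add: norm_mult norm_powr_real_powr)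
    also have "\<dots> \<le> 2 powr Re s * (c * 3 powr (2 - Re s))" using 1 by (intro mult_left_mono) auto
    also have "\<dots> = 9 * c * (2 / 3) powr Re s" by (simp add: powr_diff powr_divide)
    finally show ?thesis .
  qed
  have "((\<lambda>x. 9 * c * (2 / 3) powr x) \<longlongrightarrow> (0::real)) at_top" by real_asymp
  from filterlim_compose[OF this Re_right_end]
  have lim: "((\<lambda>s. 9 * c * (2 / 3) powr Re s) \<longlongrightarrow> 0) right_end" .
  show ?thesis by (rule Lim_null_comparison[OF _ lim]) (use bound in \<open>auto simp: eventually_right_end\<close>)
qed

lemma deriv_two_powr_minus_times:
  assumes f: "f holomorphic_on {s. Re s > 1}" and s: "Re s > 1"
  shows "deriv (\<lambda>s. 2 powr (- s) * f s) s = 2 powr (- s) * (deriv f s - of_real (ln 2) * f s)"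
proof -
  have "(f has_field_derivative deriv f s) (at s)"
    using f s by (intro holomorphic_derivI[of _ "{s. Re s > 1}"] open_halfspace_Re_gt) auto
  moreover have "((\<lambda>s. 2 powr (- s)) has_field_derivative 2 powr (- s) * Ln 2 * (- 1)) (at s)"
    by (rule DERIV_cong, rule DERIV_chain2[where f = "\<lambda>w. 2 powr w" and g = uminus, OF has_field_derivative_powr_right])
       (auto intro!: derivative_eq_intros)
  ultimately have "((\<lambda>s. 2 powr (- s) * f s) has_field_derivative
      2 powr (- s) * Ln 2 * (- 1) * f s + deriv f s * 2 powr (- s)) (at s)" by (intro DERIV_mult)
  moreover have "Ln (2::complex) = of_real (ln 2)" using Ln_of_real[of 2] by simp
  ultimately show ?thesis by (intro DERIV_imp_deriv) (simp add: algebra_simps)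
qed

lemma deriv_add_const_left:
  fixes f :: "complex \<Rightarrow> complex"
  shows "deriv (\<lambda>s. c + f s) s = deriv f s"
proof -
  have "((\<lambda>s. c + f s) has_field_derivative D) (at s) \<longleftrightarrow> (f has_field_derivative D) (at s)" for D
    using DERIV_add[OF DERIV_const, of f D s UNIV c] DERIV_add[OF DERIV_const, of "\<lambda>s. c + f s" D s UNIV "- c"] by auto
  thus ?thesis unfolding deriv_def by simp
qed

lemma deriv_cong_half_plane:
  assumes "\<And>s. Re s > K \<Longrightarrow> f s = g s" "Re s > K"
  shows "deriv f s = deriv g s"
  by (rule deriv_cong_ev)
     (use assms in \<open>auto intro!: eventually_nhds_in_open[of "{s. Re s > K}" s, THEN eventually_mono] open_halfspace_Re_gt\<close>)

text \<open>After the factor \<open>2 powr (- s)\<close> is taken out of \<open>zeta - 1\<close>,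
  \<open>zeta'\<close> and \<open>zeta''\<close>, the cofactors \<open>u\<close>, \<open>v\<close>,
  \<open>w\<close> tend to 1, \<open>- ln 2\<close> and \<open>(ln 2)\<^sup>2\<close>, since each
  differentiation multiplies by \<open>- ln 2\<close> up to a vanishing term.\<close>

lemma zeta_right_end:
  shows "(zeta \<longlongrightarrow> 1) right_end"
    and "((\<lambda>s. zeta' s / zeta s) \<longlongrightarrow> 0) right_end"
    and "((\<lambda>s. zeta'' s / zeta' s) \<longlongrightarrow> - of_real (ln 2)) right_end"
    and "\<forall>\<^sub>F s in right_end. zeta s \<noteq> 0"
    and "\<forall>\<^sub>F s in right_end. zeta' s \<noteq> 0"
    and "\<forall>\<^sub>F s in right_end. zeta'' s \<noteq> 0"
proof -
  define u where "u = (\<lambda>s. 1 + zeta_tail s)"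
  define v where "v = (\<lambda>s. deriv u s - of_real (ln 2) * u s)"
  define w where "w = (\<lambda>s. deriv v s - of_real (ln 2) * v s)"
  have hu: "u holomorphic_on {s. Re s > 1}" unfolding u_def
    using zeta_tail_holomorphic by (intro holomorphic_intros)
  have hv: "v holomorphic_on {s. Re s > 1}" unfolding v_def
    using hu by (intro holomorphic_intros holomorphic_deriv open_halfspace_Re_gt)
  have z: "zeta s = 1 + 2 powr (- s) * u s" for s
    by (simp add: u_def zeta_tail_def powr_minus field_simps)
  have z': "zeta' s = 2 powr (- s) * v s" if s: "Re s > 1" for s
  proof -
    have "zeta' s = deriv (\<lambda>s. 1 + 2 powr (- s) * u s) s" using z by (intro arg_cong2[where f = deriv]) auto
    also have "\<dots> = deriv (\<lambda>s. 2 powr (- s) * u s) s"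
      by (rule deriv_add_const_left)
    also have "\<dots> = 2 powr (- s) * v s" unfolding v_def by (rule deriv_two_powr_minus_times[OF hu s])
    finally show ?thesis .
  qed
  have z'': "zeta'' s = 2 powr (- s) * w s" if s: "Re s > 1" for s
  proof -
    have "zeta'' s = deriv (\<lambda>s. 2 powr (- s) * v s) s" using z' s by (intro deriv_cong_half_plane[of 1]) auto
    also have "\<dots> = 2 powr (- s) * w s" unfolding w_def by (rule deriv_two_powr_minus_times[OF hv s])
    finally show ?thesis .
  qed
  have "(u \<longlongrightarrow> 1 + 0) right_end" unfolding u_def by (intro tendsto_intros zeta_tail_tendsto)
  hence lu: "(u \<longlongrightarrow> 1) right_end" by simp
  have du: "(deriv u \<longlongrightarrow> 0) right_end"
  proof -
    have "deriv u s = deriv zeta_tail s" for s unfolding u_def by (rule deriv_add_const_left)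
    hence "deriv u = deriv zeta_tail" by auto
    thus ?thesis using deriv_tendsto_0_right_end[OF zeta_tail_holomorphic zeta_tail_tendsto] by simp
  qed
  have "(v \<longlongrightarrow> 0 - of_real (ln 2) * 1) right_end" unfolding v_def by (intro tendsto_intros du lu)
  hence lv: "(v \<longlongrightarrow> - of_real (ln 2)) right_end" by simp
  have dv: "(deriv v \<longlongrightarrow> 0) right_end"
  proof -
    have "((\<lambda>s. of_real (ln 2) + v s) \<longlongrightarrow> of_real (ln 2) + (- of_real (ln 2))) right_end" by (intro tendsto_intros lv)
    hence "((\<lambda>s. of_real (ln 2) + v s) \<longlongrightarrow> 0) right_end" by simp
    hence "(deriv (\<lambda>s. of_real (ln 2) + v s) \<longlongrightarrow> 0) right_end"
      by (rule deriv_tendsto_0_right_end[rotated]) (use hv in \<open>auto intro!: holomorphic_intros\<close>)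
    moreover have "deriv (\<lambda>s. of_real (ln 2) + v s) = deriv v" by (rule ext) (rule deriv_add_const_left)
    ultimately show ?thesis by (simp only:)
  qed
  have lw: "(w \<longlongrightarrow> 0 - of_real (ln 2) * (- of_real (ln 2))) right_end"
    unfolding w_def by (intro tendsto_intros dv lv)
  have p0: "((\<lambda>s::complex. 2 powr (- s)) \<longlongrightarrow> (0::complex)) right_end"
    by (rule tendsto_norm_zero_cancel) (use powr_minus_Re_right_end in \<open>simp add: norm_powr_real_powr\<close>)
  have ev1: "\<forall>\<^sub>F s in right_end. Re s > 1" unfolding eventually_right_end by (intro exI[of _ 2]) auto
  have "((\<lambda>s. 1 + 2 powr (- s) * u s) \<longlongrightarrow> 1 + 0 * 1) right_end" by (intro tendsto_intros p0 lu)
  thus l: "(zeta \<longlongrightarrow> 1) right_end" unfolding z[symmetric] by simp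
  have "((\<lambda>s. 2 powr (- s) * v s) \<longlongrightarrow> 0 * (- of_real (ln 2))) right_end" by (intro tendsto_intros p0 lv)
  hence "((\<lambda>s. 2 powr (- s) * v s) \<longlongrightarrow> 0) right_end" by simp
  hence "(zeta' \<longlongrightarrow> 0) right_end"
    by (rule Lim_transform_eventually) (use ev1 z' in \<open>auto elim!: eventually_mono\<close>)
  from tendsto_divide[OF this l] show "((\<lambda>s. zeta' s / zeta s) \<longlongrightarrow> 0) right_end" by simp
  have ln2: "complex_of_real (ln 2) \<noteq> 0" by simp
  have "((\<lambda>s. w s / v s) \<longlongrightarrow> (0 - of_real (ln 2) * (- of_real (ln 2))) / (- of_real (ln 2))) right_end"
    by (intro tendsto_divide lw lv) simp
  hence "((\<lambda>s. w s / v s) \<longlongrightarrow> - of_real (ln 2)) right_end" by (simp add: minus_divide_right[symmetric])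
  thus "((\<lambda>s. zeta'' s / zeta' s) \<longlongrightarrow> - of_real (ln 2)) right_end"
    by (rule Lim_transform_eventually) (use ev1 z' z'' in \<open>auto elim!: eventually_mono\<close>)
  show "\<forall>\<^sub>F s in right_end. zeta s \<noteq> 0" by (rule tendsto_imp_eventually_ne[OF l]) simp
  have "\<forall>\<^sub>F s in right_end. v s \<noteq> 0" by (rule tendsto_imp_eventually_ne[OF lv]) simp
  with ev1 show "\<forall>\<^sub>F s in right_end. zeta' s \<noteq> 0" by eventually_elim (simp add: z')
  have "\<forall>\<^sub>F s in right_end. w s \<noteq> 0" by (rule tendsto_imp_eventually_ne[OF lw]) simp
  with ev1 show "\<forall>\<^sub>F s in right_end. zeta'' s \<noteq> 0" by eventually_elim (simp add: z'')
qed

text \<open>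
  In the functional equation write \<open>\<zeta>(s) = A(s) sin (\<pi> s / 2)\<close>; then \<open>A'(s) / A(s)\<close> is minus this function at \<open>1 - s\<close>.
\<close>

definition log_deriv_A :: "complex \<Rightarrow> complex" where
  "log_deriv_A w = Digamma w + zeta' w / zeta w - of_real (ln (2 * pi))"

lemma Digamma_minus_Ln_right_end: "((\<lambda>w. Digamma w - Ln w) \<longlongrightarrow> 0) right_end"
proof -
  have "((\<lambda>x::real. 1 / (x - 1)) \<longlongrightarrow> 0) at_top" by real_asymp
  from filterlim_compose[OF this Re_right_end]
  have lim: "((\<lambda>w. 1 / (Re w - 1)) \<longlongrightarrow> 0) right_end" .
  show ?thesis
    by (rule Lim_null_comparison[OF _ lim])
       (auto simp: eventually_right_end intro!: exI[of _ 2] Digamma_minus_Ln_Re)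
qed

lemma log_deriv_A_minus_Ln: "((\<lambda>w. log_deriv_A w - Ln w + of_real (ln (2 * pi))) \<longlongrightarrow> 0) right_end"
  using tendsto_add[OF Digamma_minus_Ln_right_end zeta_right_end(2)]
  by (simp add: log_deriv_A_def algebra_simps)

text \<open>\<open>log_deriv_A w\<close> is \<open>Ln w - ln (2 * pi)\<close> plus a remainder that
  tends to 0 together with its derivative. Thus it is large, with derivative bounded by 1; the
  values 10 and 1 suffice for locating the zeros below.\<close>

lemma log_deriv_A_bounds:
  obtains K k' where "K \<ge> 2" "\<And>w. Re w > K \<Longrightarrow> zeta w \<noteq> 0" "\<And>w. Re w > K \<Longrightarrow> Re (log_deriv_A w) \<ge> 10"
    "\<And>w. Re w > K \<Longrightarrow> (log_deriv_A has_field_derivative k' w) (at w)"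
    "\<And>w. Re w > K \<Longrightarrow> cmod (k' w) \<le> 1"
proof -
  define r where "r = (\<lambda>w. log_deriv_A w - Ln w + of_real (ln (2 * pi)))"
  obtain K0 where K0: "\<And>w. Re w \<ge> K0 \<Longrightarrow> zeta w \<noteq> 0"
    using zeta_right_end(4) unfolding eventually_right_end by blast
  define K1 where "K1 = max 2 K0"
  have hk: "log_deriv_A holomorphic_on {w. Re w > K1}" unfolding log_deriv_A_def
  proof (intro holomorphic_on_add holomorphic_on_diff holomorphic_on_divide holomorphic_on_const)
    show "zeta holomorphic_on {w. Re w > K1}"
      by (rule holomorphic_on_subset[OF zeta_holomorphic]) (force simp: K1_def)
    show "zeta' holomorphic_on {w. Re w > K1}"
      by (rule holomorphic_on_subset[OF zeta'_holomorphic]) (force simp: K1_def)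
    show "Digamma holomorphic_on {w. Re w > K1}"
      by (rule holomorphic_on_Polygamma) (auto simp: K1_def elim!: nonpos_Ints_cases)
  qed (auto simp: K1_def K0)
  have hL: "Ln holomorphic_on {w. Re w > K1}"
    by (intro holomorphic_intros) (auto simp: K1_def complex_nonpos_Reals_iff)
  have hr: "r holomorphic_on {w. Re w > K1}" unfolding r_def
    by (intro holomorphic_intros hk hL)
  have lr: "(r \<longlongrightarrow> 0) right_end" unfolding r_def by (rule log_deriv_A_minus_Ln)
  have "\<forall>\<^sub>F w in right_end. dist (deriv r w) 0 < 1 / 2"
    by (intro tendstoD deriv_tendsto_0_right_end[OF hr lr]) auto
  then obtain K2 where K2: "\<And>w. Re w \<ge> K2 \<Longrightarrow> cmod (deriv r w) < 1 / 2" by (auto simp: eventually_right_end)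
  have "\<forall>\<^sub>F w in right_end. dist (r w) 0 < 1" using lr by (rule tendstoD) auto
  then obtain K3 where K3: "\<And>w. Re w \<ge> K3 \<Longrightarrow> cmod (r w) < 1" by (auto simp: eventually_right_end)
  \<comment> \<open>The exponential makes \<open>ln (cmod w) - ln (2 * pi)\<close> at least 11, of
    which the remainder takes away at most 1.\<close>
  define K where "K = max (max K1 K2) (max K3 (exp (11 + ln (2 * pi))))"
  show ?thesis
  proof (rule that[of K "\<lambda>w. 1 / w + deriv r w"])
    show "K \<ge> 2" by (simp add: K_def K1_def)
    fix w assume "Re w > K"
    hence w: "Re w > K1" "Re w > K2" "Re w > K3" "Re w > exp (11 + ln (2 * pi))" "Re w > 2" "Re w \<ge> K0"
      by (auto simp: K_def K1_def)
    show "zeta w \<noteq> 0" using K0 w by auto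
    have w0: "w \<noteq> 0" using w by auto
    have eq: "log_deriv_A w = r w + Ln w - of_real (ln (2 * pi))" by (simp add: r_def)
    have "exp (11 + ln (2 * pi)) \<le> cmod w" using w complex_Re_le_cmod[of w] by linarith
    hence "11 + ln (2 * pi) \<le> ln (cmod w)" using w0 by (subst ln_ge_iff) auto
    moreover have "Re (r w) \<ge> - 1" using K3[of w] w abs_Re_le_cmod[of "r w"] by simp
    ultimately show "Re (log_deriv_A w) \<ge> 10" unfolding eq using w0 by (simp add: Re_Ln)
    have "((\<lambda>w. r w + Ln w - of_real (ln (2 * pi))) has_field_derivative deriv r w + 1 / w - 0) (at w)"
    proof (intro DERIV_diff DERIV_add DERIV_const)
      show "(r has_field_derivative deriv r w) (at w)"
        using hr w by (intro holomorphic_derivI[of _ "{w. Re w > K1}"] open_halfspace_Re_gt) auto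
      show "(Ln has_field_derivative 1 / w) (at w)"
        using w has_field_derivative_Ln[of w] by (simp add: complex_nonpos_Reals_iff inverse_eq_divide)
    qed
    thus "(log_deriv_A has_field_derivative 1 / w + deriv r w) (at w)"
      by (simp add: r_def add.commute)
    have "cmod (1 / w) \<le> 1 / 2" using w complex_Re_le_cmod[of w] by (simp add: norm_divide divide_simps)
    thus "cmod (1 / w + deriv r w) \<le> 1"
      using K2[of w] w norm_triangle_ineq[of "1 / w" "deriv r w"] by simp
  qed
qed


section \<open>Zeros of zeta' in a left half plane\<close>

lemma sin_ge_half:
  fixes t :: real
  assumes t: "0 \<le> t" "t \<le> pi / 2"
  shows "t / 2 \<le> sin t"
proof (cases "t \<le> pi / 3")
  case True
  have "(\<lambda>t. sin t - t / 2) 0 \<le> (\<lambda>t. sin t - t / 2) t"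
  proof (rule DERIV_nonneg_imp_nondecreasing[OF t(1)])
    fix x assume x: "0 \<le> x" "x \<le> t"
    have "cos (pi / 3) \<le> cos x" using x True by (intro cos_monotone_0_pi_le) auto
    hence "0 \<le> cos x - 1 / 2" by (simp add: cos_60)
    moreover have "((\<lambda>t. sin t - t / 2) has_real_derivative cos x - 1 / 2) (at x)"
      by (auto intro!: derivative_eq_intros)
    ultimately show "\<exists>y. ((\<lambda>t. sin t - t / 2) has_real_derivative y) (at x) \<and> 0 \<le> y" by blast
  qed
  thus ?thesis by simp
next
  case False
  have "sin (pi / 3) \<le> sin t" using False t by (intro sin_monotone_2pi_le) auto
  hence "sqrt 3 / 2 \<le> sin t" by (simp add: sin_60)
  moreover have "8 / 5 \<le> sqrt (3::real)" by (rule real_le_rsqrt) (simp add: power2_eq_square)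
  moreover have "pi < 3.2" using pi_approx by simp
  ultimately show ?thesis using t by argo
qed

text \<open>\<open>(cmod (sin z))\<^sup>2\<close> is the sum of the squares of \<open>sin x\<close>
  and \<open>sinh y\<close>, and each is at least half its argument in modulus.\<close>

lemma norm_le_2_norm_sin:
  assumes z: "\<bar>Re z\<bar> \<le> pi / 2"
  shows "cmod z \<le> 2 * cmod (sin z)"
proof -
  define x where "x = Re z"
  define y where "y = Im z"
  define E where "E = exp y"
  have E: "E > 0" by (simp add: E_def)
  have Ei: "exp (- y) = 1 / E" by (simp add: E_def exp_minus inverse_eq_divide)
  have eq: "(cmod (sin z))\<^sup>2 = (sin x)\<^sup>2 + ((E - 1 / E) / 2)\<^sup>2"
  proof -
    have "(cmod (sin z))\<^sup>2 = (sin x * (E + 1 / E) / 2)\<^sup>2 + (cos x * (E - 1 / E) / 2)\<^sup>2"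
      unfolding cmod_power2 Re_sin Im_sin x_def[symmetric] y_def[symmetric] E_def[symmetric] Ei ..
    also have "\<dots> = (sin x)\<^sup>2 * ((E + 1 / E) / 2)\<^sup>2 + (cos x)\<^sup>2 * ((E - 1 / E) / 2)\<^sup>2"
      by (simp add: power_mult_distrib power_divide)
    also have "((E + 1 / E) / 2)\<^sup>2 = 1 + ((E - 1 / E) / 2)\<^sup>2" using E by (simp add: power2_eq_square field_simps)
    also have "(sin x)\<^sup>2 * (1 + ((E - 1 / E) / 2)\<^sup>2) + (cos x)\<^sup>2 * ((E - 1 / E) / 2)\<^sup>2 =
       (sin x)\<^sup>2 + ((sin x)\<^sup>2 + (cos x)\<^sup>2) * ((E - 1 / E) / 2)\<^sup>2"
      by (simp only: distrib_left distrib_right mult_1_right add.assoc)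
    finally show ?thesis by simp
  qed
  have "\<bar>x\<bar> / 2 \<le> \<bar>sin x\<bar>"
    using sin_ge_half[of "\<bar>x\<bar>"] z by (cases "x \<ge> 0") (auto simp: x_def)
  hence "(\<bar>x\<bar> / 2)\<^sup>2 \<le> \<bar>sin x\<bar>\<^sup>2" by (intro power_mono) auto
  hence 1: "(x / 2)\<^sup>2 \<le> (sin x)\<^sup>2" by (simp add: power_divide)
  have sh: "t / 2 \<le> (exp t - exp (- t)) / 2" if "t \<ge> 0" for t :: real
  proof -
    have "1 + t \<le> exp t" by (rule exp_ge_add_one_self)
    moreover have "exp (- t) \<le> 1" using that by simp
    ultimately show ?thesis by argo
  qed
  have "\<bar>y\<bar> / 2 \<le> \<bar>(E - 1 / E) / 2\<bar>"
    using sh[of "\<bar>y\<bar>"] by (cases "y \<ge> 0") (auto simp: E_def exp_minus inverse_eq_divide)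
  hence "(\<bar>y\<bar> / 2)\<^sup>2 \<le> \<bar>(E - 1 / E) / 2\<bar>\<^sup>2" by (intro power_mono) auto
  hence 2: "(y / 2)\<^sup>2 \<le> ((E - 1 / E) / 2)\<^sup>2" by (simp add: power_divide)
  have "(cmod z)\<^sup>2 = 4 * ((x / 2)\<^sup>2 + (y / 2)\<^sup>2)" by (simp add: cmod_power2 x_def y_def power_divide)
  also have "\<dots> \<le> 4 * (cmod (sin z))\<^sup>2" unfolding eq using 1 2 by (intro mult_left_mono add_mono) auto
  also have "\<dots> = (2 * cmod (sin z))\<^sup>2" by (simp add: power_mult_distrib)
  finally show ?thesis by (rule power2_le_imp_le) simp
qed

text \<open>This is \<open>Re (cot z)\<close> times \<open>(cmod (sin z))\<^sup>2\<close>, so the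
  sign of \<open>Re (cot z)\<close> depends on \<open>Re z\<close> only.\<close>

lemma Re_cos_cnj_sin: "Re (cos z * cnj (sin z)) = sin (2 * Re z) / 2"
proof -
  define E where "E = exp (Im z)"
  have E: "E > 0" by (simp add: E_def)
  have Ei: "exp (- Im z) = 1 / E" by (simp add: E_def exp_minus inverse_eq_divide)
  have "Re (cos z * cnj (sin z)) = cos (Re z) * (E + 1 / E) / 2 * (sin (Re z) * (E + 1 / E) / 2)
      + (sin (Re z) * (1 / E - E) / 2) * (cos (Re z) * (E - 1 / E) / 2)"
    by (simp add: Re_sin Im_sin Re_cos Im_cos E_def[symmetric] Ei add.commute)
  also have "\<dots> = sin (Re z) * cos (Re z)" using E by (simp add: field_simps)
  finally show ?thesis by (simp add: sin_double)
qed

lemma sin_pi_pos_imp_even_floor: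
  fixes x :: real
  assumes "sin (pi * x) > 0"
  obtains m :: int where "2 * of_int m < x" "x < 2 * of_int m + 1"
proof -
  define m where "m = \<lfloor>x / 2\<rfloor>"
  define y where "y = x - 2 * of_int m"
  have m: "of_int m \<le> x / 2" "x / 2 < of_int m + 1" unfolding m_def by linarith+
  have y: "0 \<le> y" "y < 2" using m by (auto simp: y_def)
  have "pi * x = pi * y + 2 * pi * of_int m" by (simp add: y_def algebra_simps)
  hence s: "sin (pi * y) > 0" using assms by (simp add: sin_add)
  have "y \<noteq> 0" using s by auto
  moreover have "y < 1"
  proof (rule ccontr)
    assume "\<not> y < 1"
    hence "sin (pi * (y - 1)) \<ge> 0" using y by (intro sin_ge_zero) auto
    thus False using s by (simp add: algebra_simps sin_diff)
  qed
  ultimately show ?thesis using y by (intro that[of m]) (auto simp: y_def)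
qed

text \<open>
  For \<open>Re s < 1 - K\<close> one has \<open>\<zeta>' = A W\<close>, and a zero of \<open>W\<close> is a point where \<open>cot (\<pi> s / 2)\<close> equals the large,
  slowly varying quantity \<open>2 h(s) / \<pi>\<close>. As \<open>Re h > 0\<close>, this confines \<open>Re s\<close> to the intervals \<open>(2 m, 2 m + 1)\<close>,
  and within one such strip two zeros coincide because the cotangent varies faster than \<open>h\<close>.
\<close>

locale left_half_plane =
  fixes K :: real and k' :: "complex \<Rightarrow> complex"
  assumes K2: "K \<ge> 2" and zeta_nz: "\<And>w. Re w > K \<Longrightarrow> zeta w \<noteq> 0"
    and Re_k: "\<And>w. Re w > K \<Longrightarrow> Re (log_deriv_A w) \<ge> 10"
    and deriv_k: "\<And>w. Re w > K \<Longrightarrow> (log_deriv_A has_field_derivative k' w) (at w)"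
    and norm_k': "\<And>w. Re w > K \<Longrightarrow> cmod (k' w) \<le> 1"
begin

definition h :: "complex \<Rightarrow> complex" where "h s = log_deriv_A (1 - s)"

definition A :: "complex \<Rightarrow> complex" where
  "A s = 2 * of_real (2 * pi) powr (s - 1) * Gamma (1 - s) * zeta (1 - s)"

definition W :: "complex \<Rightarrow> complex" where
  "W s = of_real (pi / 2) * cos (of_real (pi / 2) * s) - h s * sin (of_real (pi / 2) * s)"

definition W' :: "complex \<Rightarrow> complex" where
  "W' s = - ((of_real (pi / 2))\<^sup>2 * sin (of_real (pi / 2) * s)) - of_real (pi / 2) * h s * cos (of_real (pi / 2) * s)
     + k' (1 - s) * sin (of_real (pi / 2) * s)"

lemma open_left: "open {s. Re s < 1 - K}"
  by (rule open_halfspace_Re_lt)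

lemma zeta_left_eq: "Re s < 1 - K \<Longrightarrow> zeta s = A s * sin (of_real (pi / 2) * s)"
  using K2 by (subst zeta_functional_equation) (auto simp: A_def)

lemma one_minus_not_nonpos_Int:
  assumes "Re s < 1 - K"
  shows "1 - s \<notin> \<int>\<^sub>\<le>\<^sub>0"
proof
  assume "1 - s \<in> \<int>\<^sub>\<le>\<^sub>0"
  then obtain n where n: "1 - s = of_int n" "n \<le> 0" by (auto elim: nonpos_Ints_cases)
  have "Re (1 - s) = of_int n" unfolding n(1) by simp
  thus False using n(2) assms K2 by simp
qed

lemma A_nonzero: "Re s < 1 - K \<Longrightarrow> A s \<noteq> 0"
  using K2 zeta_nz[of "1 - s"] one_minus_not_nonpos_Int[of s] by (auto simp: A_def Gamma_eq_zero_iff)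

lemma h_deriv: "Re s < 1 - K \<Longrightarrow> (h has_field_derivative - k' (1 - s)) (at s)"
proof -
  assume "Re s < 1 - K"
  hence "((\<lambda>s. log_deriv_A (1 - s)) has_field_derivative k' (1 - s) * (- 1)) (at s)"
    by (intro DERIV_chain2[OF deriv_k]) (auto intro!: derivative_eq_intros)
  thus ?thesis by (simp add: h_def[abs_def])
qed

lemma A_deriv:
  assumes s: "Re s < 1 - K"
  shows "(A has_field_derivative - h s * A s) (at s)"
proof -
  have nI: "1 - s \<notin> \<int>\<^sub>\<le>\<^sub>0" using s by (rule one_minus_not_nonpos_Int)
  have z1: "1 - s \<noteq> 1" using s K2 by auto
  have znz: "zeta (1 - s) \<noteq> 0" using s by (intro zeta_nz) auto
  have d1: "((\<lambda>s. of_real (2 * pi) powr (s - 1)) has_field_derivative of_real (2 * pi) powr (s - 1) * of_real (ln (2 * pi))) (at s)"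
  proof -
    have "((\<lambda>s. of_real (2 * pi) powr (s - 1)) has_field_derivative Ln (of_real (2 * pi)) * of_real (2 * pi) powr (s - 1) * 1) (at s)"
      by (rule DERIV_cong, rule DERIV_chain2[where f = "\<lambda>w. of_real (2 * pi) powr w" and g = "\<lambda>s. s - 1", OF has_field_derivative_powr_right])
         (auto intro!: derivative_eq_intros)
    moreover have "Ln (of_real (2 * pi)) = of_real (ln (2 * pi))" by (rule Ln_of_real) simp
    ultimately show ?thesis by (simp add: mult.commute)
  qed
  have d2: "((\<lambda>s. Gamma (1 - s)) has_field_derivative (Gamma (1 - s) * Digamma (1 - s)) * (- 1)) (at s)"
    by (rule DERIV_chain2[where f = Gamma and g = "\<lambda>s. 1 - s", OF has_field_derivative_Gamma[OF nI]])
       (auto intro!: derivative_eq_intros)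
  have d3: "((\<lambda>s. zeta (1 - s)) has_field_derivative zeta' (1 - s) * (- 1)) (at s)"
    by (rule DERIV_chain2[where f = zeta and g = "\<lambda>s. 1 - s", OF zeta_DERIV[OF z1]])
       (auto intro!: derivative_eq_intros)
  define P where "P = of_real (2 * pi) powr (s - 1)"
  define G where "G = Gamma (1 - s)"
  have "(A has_field_derivative ((0 * P + P * of_real (ln (2 * pi)) * 2) * G + G * Digamma (1 - s) * (- 1) * (2 * P)) * zeta (1 - s)
       + zeta' (1 - s) * (- 1) * (2 * P * G)) (at s)"
    unfolding A_def[abs_def] P_def G_def by (intro DERIV_mult d1 d2 d3 DERIV_const)
  moreover have "((0 * P + P * of_real (ln (2 * pi)) * 2) * G + G * Digamma (1 - s) * (- 1) * (2 * P)) * zeta (1 - s)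
       + zeta' (1 - s) * (- 1) * (2 * P * G) = - h s * A s"
    unfolding h_def log_deriv_A_def A_def P_def[symmetric] G_def[symmetric] using znz by (simp add: field_simps)
  ultimately show ?thesis by simp
qed

lemma zeta'_left:
  assumes s: "Re s < 1 - K"
  shows "zeta' s = A s * W s"
proof -
  have "((\<lambda>s. A s * sin (of_real (pi / 2) * s)) has_field_derivative
     - h s * A s * sin (of_real (pi / 2) * s) + cos (of_real (pi / 2) * s) * of_real (pi / 2) * A s) (at s)"
    by (intro DERIV_mult A_deriv s) (auto intro!: derivative_eq_intros)
  hence "(zeta has_field_derivative - h s * A s * sin (of_real (pi / 2) * s) + cos (of_real (pi / 2) * s) * of_real (pi / 2) * A s) (at s)"
    by (rule has_field_derivative_transform_within_open[OF _ open_left]) (use s zeta_left_eq in auto)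
  thus ?thesis by (subst DERIV_imp_deriv) (auto simp: W_def algebra_simps)
qed

lemma W_deriv:
  assumes s: "Re s < 1 - K"
  shows "(W has_field_derivative W' s) (at s)"
proof -
  have "((\<lambda>s. of_real (pi / 2) * cos (of_real (pi / 2) * s) - h s * sin (of_real (pi / 2) * s)) has_field_derivative
     of_real (pi / 2) * (- sin (of_real (pi / 2) * s) * of_real (pi / 2)) -
     (- k' (1 - s) * sin (of_real (pi / 2) * s) + cos (of_real (pi / 2) * s) * of_real (pi / 2) * h s)) (at s)"
    by (intro DERIV_diff DERIV_mult h_deriv s DERIV_cmult) (auto intro!: derivative_eq_intros)
  thus ?thesis unfolding W_def[abs_def] W'_def by (simp add: algebra_simps power2_eq_square)
qed

lemma zeta''_left:
  assumes s: "Re s < 1 - K"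
  shows "zeta'' s = A s * (W' s - h s * W s)"
proof -
  have "((\<lambda>s. A s * W s) has_field_derivative - h s * A s * W s + W' s * A s) (at s)"
    by (intro DERIV_mult A_deriv W_deriv s)
  hence "(zeta' has_field_derivative - h s * A s * W s + W' s * A s) (at s)"
    by (rule has_field_derivative_transform_within_open[OF _ open_left]) (use s zeta'_left in auto)
  thus ?thesis by (subst DERIV_imp_deriv) (auto simp: algebra_simps)
qed

lemma norm_h: "Re s < 1 - K \<Longrightarrow> cmod (h s) \<ge> 10"
  using Re_k[of "1 - s"] abs_Re_le_cmod[of "h s"] by (simp add: h_def)

lemma zero_facts:
  assumes s: "Re s < 1 - K" and z: "zeta' s = 0"
  shows "of_real (pi / 2) * cos (of_real (pi / 2) * s) = h s * sin (of_real (pi / 2) * s)"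
    and "sin (of_real (pi / 2) * s) \<noteq> 0" and "sin (pi * Re s) > 0"
    and "(cmod (sin (of_real (pi / 2) * s)))\<^sup>2 \<le> 1 / 39"
proof -
  define S where "S = sin (of_real (pi / 2) * s)"
  define D where "D = cos (of_real (pi / 2) * s)"
  have W0: "of_real (pi / 2) * D = h s * S"
    using z A_nonzero[OF s] by (simp add: zeta'_left[OF s] W_def S_def D_def)
  thus "of_real (pi / 2) * cos (of_real (pi / 2) * s) = h s * sin (of_real (pi / 2) * s)" by (simp add: S_def D_def)
  have SD: "S\<^sup>2 + D\<^sup>2 = 1" by (simp add: S_def D_def)
  show S0: "sin (of_real (pi / 2) * s) \<noteq> 0"
  proof
    assume "sin (of_real (pi / 2) * s) = 0"
    hence "S = 0" by (simp add: S_def)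
    moreover from this W0 have "D = 0" by simp
    ultimately show False using SD by simp
  qed
  \<comment> \<open>Multiplying by the conjugate sine makes the real part of the zero equation
    comparable: the right side becomes \<open>Re (h s)\<close> times a positive number.\<close>
  have "of_real (pi / 2) * (D * cnj S) = h s * (S * cnj S)" using W0 by (simp add: mult.assoc[symmetric])
  hence "Re (of_real (pi / 2) * (D * cnj S)) = Re (h s * of_real ((cmod S)\<^sup>2))" by (simp only: complex_norm_square)
  moreover have "Re (of_real r * X) = r * Re X" "Re (X * of_real r) = Re X * r" for r X by simp_all
  ultimately have "pi / 2 * Re (D * cnj S) = Re (h s) * (cmod S)\<^sup>2" by (simp only:)
  moreover have "Re (h s) \<ge> 10" using Re_k[of "1 - s"] s by (simp add: h_def)
  hence "Re (h s) * (cmod S)\<^sup>2 > 0" using S0 by (simp add: S_def)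
  ultimately have "pi / 2 * Re (D * cnj S) > 0" by (simp only:)
  hence "Re (D * cnj S) > 0" by (rule zero_less_mult_pos) simp
  thus "sin (pi * Re s) > 0" unfolding S_def D_def Re_cos_cnj_sin by simp
  \<comment> \<open>\<open>q\<close> is the cotangent at the zero, so
    \<open>S\<^sup>2 * (1 + q\<^sup>2) = 1\<close>. From \<open>cmod (h s) \<ge> 10\<close> and
    \<open>10 / (pi / 2) \<ge> sqrt 40\<close> follows
    \<open>cmod (1 + q\<^sup>2) \<ge> 39\<close>.\<close>
  define q where "q = h s / of_real (pi / 2)"
  have "D = q * S" using W0 by (simp add: q_def field_simps)
  hence "S\<^sup>2 * (1 + q\<^sup>2) = 1" using SD by (simp add: power_mult_distrib algebra_simps)
  hence n: "(cmod S)\<^sup>2 * cmod (1 + q\<^sup>2) = 1" by (metis norm_mult norm_one norm_power)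
  have "cmod q = cmod (h s) / (pi / 2)" by (simp add: q_def norm_divide)
  moreover have "sqrt 40 * (pi / 2) \<le> 10"
  proof -
    have "sqrt 40 \<le> 6.33" by (rule real_le_lsqrt) (auto simp: power2_eq_square)
    moreover have "pi / 2 \<le> 1.571" using pi_approx by simp
    ultimately have "sqrt 40 * (pi / 2) \<le> 6.33 * 1.571" by (intro mult_mono) auto
    also have "\<dots> \<le> (10::real)" by simp
    finally show ?thesis .
  qed
  ultimately have "pi * sqrt 40 \<le> pi * cmod q" using norm_h[OF s] by (simp add: field_simps)
  hence "sqrt 40 \<le> cmod q" by simp
  hence "(sqrt 40)\<^sup>2 \<le> (cmod q)\<^sup>2" by (intro power_mono) auto
  hence "40 \<le> cmod (q\<^sup>2)" by (simp add: norm_power)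
  moreover have "cmod (q\<^sup>2) \<le> cmod (1 + q\<^sup>2) + 1" using norm_triangle_ineq4[of "1 + q\<^sup>2" 1] by simp
  ultimately have "39 \<le> cmod (1 + q\<^sup>2)" by simp
  hence "(cmod S)\<^sup>2 * 39 \<le> (cmod S)\<^sup>2 * cmod (1 + q\<^sup>2)" by (intro mult_left_mono) auto
  hence "(cmod S)\<^sup>2 * 39 \<le> 1" using n by (simp only:)
  thus "(cmod (sin (of_real (pi / 2) * s)))\<^sup>2 \<le> 1 / 39" by (simp add: S_def)
qed

text \<open>Combining the zero equations at \<open>s\<close> and \<open>t\<close> expresses the sine
  of the difference by \<open>h t - h s\<close> times two sines. The left side is at least a
  constant times \<open>cmod (s - t)\<close>, the right side at most
  \<open>cmod (s - t) / 39\<close>, as \<open>h\<close> is 1-Lipschitz and the sines are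
  small.\<close>

lemma zero_unique:
  assumes s: "Re s < 1 - K" "zeta' s = 0" and t: "Re t < 1 - K" "zeta' t = 0"
    and close: "\<bar>Re s - Re t\<bar> \<le> 1"
  shows "s = t"
proof -
  let ?a = "complex_of_real (pi / 2)"
  note zs = zero_facts[OF s] and zt = zero_facts[OF t]
  have "?a * sin (?a * (s - t)) = sin (?a * s) * (?a * cos (?a * t)) - (?a * cos (?a * s)) * sin (?a * t)"
  proof -
    have sd: "sin (?a * (s - t)) = sin (?a * s) * cos (?a * t) - cos (?a * s) * sin (?a * t)"
      by (simp only: right_diff_distrib sin_diff)
    show ?thesis unfolding sd by (simp only: right_diff_distrib mult_ac)
  qed
  also have "\<dots> = (h t - h s) * (sin (?a * s) * sin (?a * t))"
    unfolding zs(1) zt(1) by (simp only: left_diff_distrib mult_ac)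
  finally have eq: "?a * sin (?a * (s - t)) = (h t - h s) * (sin (?a * s) * sin (?a * t))" .
  have hl: "cmod (h t - h s) \<le> 1 * cmod (t - s)"
  proof (rule field_differentiable_bound[of "{s. Re s < 1 - K}" h "\<lambda>s. - k' (1 - s)"])
    show "convex {s. Re s < 1 - K}" by (rule convex_halfspace_Re_lt)
    fix z assume "z \<in> {s. Re s < 1 - K}"
    hence z: "Re z < 1 - K" by simp
    show "(h has_field_derivative - k' (1 - z)) (at z within {s. Re s < 1 - K})"
      by (rule has_field_derivative_at_within[OF h_deriv[OF z]])
    show "cmod (- k' (1 - z)) \<le> 1" using z norm_k'[of "1 - z"] by simp
  qed (use s t in auto)
  have ss: "cmod (sin (?a * s) * sin (?a * t)) \<le> 1 / 39"
  proof -
    have "cmod (sin (?a * s)) * cmod (sin (?a * t)) \<le> ((cmod (sin (?a * s)))\<^sup>2 + (cmod (sin (?a * t)))\<^sup>2) / 2"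
      using sum_squares_bound[of "cmod (sin (?a * s))" "cmod (sin (?a * t))"] by simp
    also have "\<dots> \<le> (1 / 39 + 1 / 39) / 2" using zs(4) zt(4) by (intro divide_right_mono add_mono) auto
    finally show ?thesis by (simp add: norm_mult)
  qed
  have "cmod (?a * (s - t)) \<le> 2 * cmod (sin (?a * (s - t)))"
  proof (rule norm_le_2_norm_sin)
    have "Re (?a * (s - t)) = pi / 2 * (Re s - Re t)" by simp
    also have "\<bar>\<dots>\<bar> = pi / 2 * \<bar>Re s - Re t\<bar>" by (simp add: abs_mult)
    also have "\<dots> \<le> pi / 2 * 1" using close by (intro mult_left_mono) auto
    finally show "\<bar>Re (?a * (s - t))\<bar> \<le> pi / 2" by simp
  qed
  hence "pi / 2 * cmod (?a * (s - t)) \<le> 2 * (pi / 2 * cmod (sin (?a * (s - t))))" by simp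
  also have "pi / 2 * cmod (sin (?a * (s - t))) = cmod (?a * sin (?a * (s - t)))" by (simp add: norm_mult)
  also have "\<dots> = cmod (h t - h s) * cmod (sin (?a * s) * sin (?a * t))" unfolding eq by (simp add: norm_mult)
  also have "2 * (cmod (h t - h s) * cmod (sin (?a * s) * sin (?a * t))) \<le> 2 * (1 * cmod (t - s) * (1 / 39))"
    using hl ss by (intro mult_left_mono mult_mono) auto
  finally have *: "pi / 2 * (pi / 2 * cmod (s - t)) \<le> 2 / 39 * cmod (s - t)"
    by (simp add: norm_mult norm_minus_commute)
  have "1 * 1 \<le> pi / 2 * (pi / 2)" using pi_ge_two by (intro mult_mono) auto
  hence "1 * cmod (s - t) \<le> pi / 2 * (pi / 2) * cmod (s - t)" by (intro mult_right_mono) auto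
  with * have "1 * cmod (s - t) \<le> 2 / 39 * cmod (s - t)" by (simp only: mult.assoc)
  hence "cmod (s - t) \<le> 0" by simp
  thus ?thesis by simp
qed

text \<open>At a zero, \<open>zeta''\<close> is \<open>A\<close> times \<open>W'\<close>, and the
  zero equation turns \<open>W'\<close> into a sine times
  \<open>k' - (pi / 2)\<^sup>2 - h\<^sup>2\<close>. The square of \<open>h\<close>, at least 100 in
  modulus, outweighs the rest.\<close>

lemma zero_simple:
  assumes s: "Re s < 1 - K" "zeta' s = 0"
  shows "zorder zeta' s = 1"
proof -
  note zs = zero_facts[OF s]
  have "of_real (pi / 2) * h s * cos (of_real (pi / 2) * s) = (h s)\<^sup>2 * sin (of_real (pi / 2) * s)"
    using arg_cong[OF zs(1), of "\<lambda>x. h s * x"] by (simp add: power2_eq_square mult_ac)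
  hence W': "W' s = (k' (1 - s) - (of_real (pi / 2))\<^sup>2 - (h s)\<^sup>2) * sin (of_real (pi / 2) * s)"
    by (simp add: W'_def algebra_simps)
  have W: "W s = 0" using s zeta'_left[OF s(1)] A_nonzero[OF s(1)] by simp
  have "k' (1 - s) - (of_real (pi / 2))\<^sup>2 - (h s)\<^sup>2 \<noteq> 0"
  proof
    assume "k' (1 - s) - (of_real (pi / 2))\<^sup>2 - (h s)\<^sup>2 = 0"
    hence "(h s)\<^sup>2 = k' (1 - s) - (of_real (pi / 2))\<^sup>2" by simp
    hence "cmod ((h s)\<^sup>2) \<le> cmod (k' (1 - s)) + cmod ((of_real (pi / 2))\<^sup>2)" by (metis norm_triangle_ineq4)
    also have "\<dots> \<le> 1 + (pi / 2)\<^sup>2" using norm_k'[of "1 - s"] s by (simp add: norm_power)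
    also have "(pi / 2)\<^sup>2 \<le> 2\<^sup>2" using pi_less_4 by (intro power_mono) auto
    finally have "(cmod (h s))\<^sup>2 \<le> 5" by (simp add: norm_power)
    moreover have "10\<^sup>2 \<le> (cmod (h s))\<^sup>2" using norm_h[OF s(1)] by (intro power_mono) auto
    ultimately show False by simp
  qed
  hence "zeta'' s \<noteq> 0" using zeta''_left[OF s(1)] A_nonzero[OF s(1)] W W' zs(2) by simp
  thus ?thesis
    using s K2 by (intro zorder_zero_eqI[OF zeta'_holomorphic]) auto
qed

end

lemma zeta'_cnj:
  assumes "s \<noteq> 1"
  shows "zeta' (cnj s) = cnj (zeta' s)"
proof -
  have "cnj s \<noteq> 1" using assms by (metis complex_cnj_cnj complex_cnj_one)
  have "((cnj \<circ> zeta \<circ> cnj) has_field_derivative cnj (zeta' s)) (at (cnj s))"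
    using has_field_derivative_cnj_cnj[of zeta "zeta' s" "cnj s"] zeta_DERIV[OF assms] by simp
  moreover have "cnj \<circ> zeta \<circ> cnj = zeta" by (auto simp: zeta_cnj)
  ultimately show ?thesis by (simp add: DERIV_imp_deriv)
qed

context left_half_plane
begin

text \<open>Rolle's theorem between two consecutive trivial zeros of \<open>zeta\<close>; applied to
  the real part, it suffices because \<open>zeta'\<close> is real on the real axis.\<close>

lemma zero_exists:
  fixes n :: nat
  assumes n: "- 2 * real n + 2 < 1 - K"
  shows "\<exists>x. - 2 * real n < x \<and> x < - 2 * real n + 2 \<and> zeta' (of_real x) = 0"
proof -
  have z0: "zeta (of_real (- 2 * real m)) = 0" if "- 2 * real m < 1 - K" for m
  proof -
    have "of_real (pi / 2) * of_real (- 2 * real m) = complex_of_real (- (real m * pi))" by simp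
    hence "sin (of_real (pi / 2) * of_real (- 2 * real m)) = complex_of_real (sin (- (real m * pi)))"
      by (simp only: sin_of_real)
    thus ?thesis using zeta_left_eq[of "of_real (- 2 * real m)"] that by simp
  qed
  define f where "f = (\<lambda>x. Re (zeta (of_real x)))"
  have nz: "complex_of_real x \<noteq> 1" if "x \<le> - 2 * real n + 2" for x using that n K2 by auto
  have df: "(f has_real_derivative Re (zeta' (of_real x))) (at x)" if "x \<le> - 2 * real n + 2" for x
  proof -
    have "(zeta has_field_derivative zeta' (of_real x)) (at (of_real x))" using nz[OF that] by (rule zeta_DERIV)
    hence "((\<lambda>x. zeta (of_real x)) has_vector_derivative zeta' (of_real x)) (at x)"
      by (rule has_vector_derivative_real_field)
    thus ?thesis unfolding f_def
      by (simp add: has_real_derivative_iff_has_vector_derivative has_vector_derivative_complex_iff)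
  qed
  have "n \<noteq> 0" using n K2 by auto
  then obtain m where m: "n = Suc m" by (cases n) auto
  have e: "- 2 * real n + 2 = - 2 * real m" by (simp add: m)
  have "f (- 2 * real n) = 0" "f (- 2 * real n + 2) = 0"
    unfolding f_def using z0[of n] z0[of m] n e by auto
  hence "\<exists>z. - 2 * real n < z \<and> z < - 2 * real n + 2 \<and> (\<lambda>d. Re (zeta' (of_real z)) * d) = (\<lambda>v. 0)"
  proof (intro Rolle_deriv)
    show "continuous_on {- 2 * real n..- 2 * real n + 2} f"
      by (rule DERIV_continuous_on[OF has_field_derivative_at_within[OF df]]) auto
    fix x assume "- 2 * real n < x" "x < - 2 * real n + 2"
    thus "(f has_derivative (\<lambda>d. Re (zeta' (of_real x)) * d)) (at x)"
      using df[of x] by (simp add: has_field_derivative_def)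
  qed auto
  then obtain x where x: "- 2 * real n < x" "x < - 2 * real n + 2" and r: "(\<lambda>d. Re (zeta' (of_real x)) * d) = (\<lambda>v. 0)" by blast
  have "Re (zeta' (of_real x)) = 0" using fun_cong[OF r, of 1] by simp
  note x = x this
  have "cnj (zeta' (of_real x)) = zeta' (of_real x)" using zeta'_cnj[OF nz[of x]] x by simp
  hence "Im (zeta' (of_real x)) = 0" by (simp add: complex_eq_iff)
  with x show ?thesis by (auto simp: complex_eq_iff)
qed

end

lemma left_half_plane_exists: obtains K k' where "left_half_plane K k'"
proof -
  obtain K k' where "K \<ge> 2" "\<And>w. Re w > K \<Longrightarrow> zeta w \<noteq> 0" "\<And>w. Re w > K \<Longrightarrow> Re (log_deriv_A w) \<ge> 10"
    "\<And>w. Re w > K \<Longrightarrow> (log_deriv_A has_field_derivative k' w) (at w)"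
    "\<And>w. Re w > K \<Longrightarrow> cmod (k' w) \<le> 1"
    using log_deriv_A_bounds by metis
  hence "left_half_plane K k'" by unfold_locales
  thus ?thesis by (rule that)
qed

text \<open>Rolle gives a real zero between consecutive even integers, and the sign of
  \<open>sin (pi * Re s)\<close> moves it into the left half of that interval. Every zero has its
  real part in such a half, hence within distance 1 of the real part of a known one, and uniqueness
  identifies the two.\<close>

lemma zeta'_left_zeros:
  obtains N :: nat and a :: "nat \<Rightarrow> real" where "N \<ge> 1"
    "\<And>n. - 2 * real (n + N) \<le> a n" "\<And>n. a n \<le> - 2 * real (n + N) + 1"
    "\<And>n. zeta' (of_real (a n)) = 0" "\<And>n. zorder zeta' (of_real (a n)) = 1"
    "\<And>s. zeta' s = 0 \<Longrightarrow> Re s < - 2 * real N + 2 \<Longrightarrow> s \<in> range (\<lambda>n. of_real (a n))"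
proof -
  obtain K k' where "left_half_plane K k'" by (rule left_half_plane_exists)
  then interpret left_half_plane K k' .
  obtain N :: nat where N0: "real N > K + 2" using reals_Archimedean2 by blast
  have N: "- 2 * real N + 2 < 1 - K" "N \<ge> 1" using N0 K2 by (simp, linarith)
  have "\<exists>x. - 2 * real (n + N) < x \<and> x < - 2 * real (n + N) + 1 \<and> zeta' (of_real x) = 0" for n
  proof -
    have nN: "- 2 * real (n + N) + 2 < 1 - K" using N by simp
    then obtain x where x: "- 2 * real (n + N) < x" "x < - 2 * real (n + N) + 2" "zeta' (of_real x) = 0"
      using zero_exists[OF nN] by blast
    have "sin (pi * Re (of_real x)) > 0" using x nN by (intro zero_facts(3)) auto
    then obtain m :: int where m: "2 * of_int m < x" "x < 2 * of_int m + 1"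
      by (auto elim: sin_pi_pos_imp_even_floor)
    have "real_of_int (2 * m) < real_of_int (- 2 * int (n + N) + 2)" "real_of_int (- 2 * int (n + N)) < real_of_int (2 * m + 1)"
      using m x by simp_all
    hence "m = - int (n + N)" unfolding of_int_less_iff by presburger
    hence "x < - 2 * real (n + N) + 1" using m by simp
    thus ?thesis using x by blast
  qed
  then obtain a where a: "\<And>n. - 2 * real (n + N) < a n" "\<And>n. a n < - 2 * real (n + N) + 1"
    "\<And>n. zeta' (of_real (a n)) = 0" by metis
  have aK: "a n < 1 - K" for n using a(2)[of n] N by simp
  show ?thesis
  proof (rule that[of N a])
    show "zorder zeta' (of_real (a n)) = 1" for n using a(3) aK by (intro zero_simple) auto
    fix s assume s: "zeta' s = 0" "Re s < - 2 * real N + 2"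
    hence sK: "Re s < 1 - K" using N by simp
    then obtain m :: int where m: "2 * of_int m < Re s" "Re s < 2 * of_int m + 1"
      using zero_facts(3)[OF sK s(1)] by (auto elim: sin_pi_pos_imp_even_floor)
    have "real_of_int (2 * m) < real_of_int (- 2 * int N + 2)" using m s by simp
    \<comment> \<open>So the strip of \<open>s\<close> is one of those occupied by the sequence
      \<open>a\<close>, namely at the index \<open>- m - N\<close>.\<close>
    hence mN: "m \<le> - int N" unfolding of_int_less_iff by presburger
    define n where "n = nat (- m - int N)"
    have "real_of_int m = - real (n + N)" using mN by (simp add: n_def)
    hence "\<bar>Re s - Re (of_real (a n))\<bar> \<le> 1" using m a(1,2)[of n] by simp
    hence "s = of_real (a n)" by (intro zero_unique[OF sK s(1) _ a(3)]) (use aK in simp)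
    thus "s \<in> range (\<lambda>n. of_real (a n))" by blast
  qed (use a N in \<open>auto simp: less_imp_le\<close>)
qed


section \<open>The asymptotic expansion of zeta''/zeta'\<close>

definition left_diag :: "real \<Rightarrow> complex" where "left_diag x = Complex (- x) x"
definition right_diag :: "real \<Rightarrow> complex" where "right_diag x = Complex x x"

text \<open>In the upper half plane \<open>E = exp (\<i> * pi * s / 2)\<close> decays, and the
  cotangent is a rational function of its square.\<close>

lemma cot_left_diag:
  "((\<lambda>x. cos (of_real (pi / 2) * left_diag x) / sin (of_real (pi / 2) * left_diag x)) \<longlongrightarrow> - \<i>) at_top"
  "\<forall>\<^sub>F x in at_top. sin (of_real (pi / 2) * left_diag x) \<noteq> 0"
proof -
  define E where "E = (\<lambda>x. exp (\<i> * (of_real (pi / 2) * left_diag x)))"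
  have nE: "cmod (E x) = exp (- (pi / 2 * x))" for x
    by (simp add: E_def norm_exp_eq_Re left_diag_def)
  have "((\<lambda>x. exp (- (pi / 2 * x))) \<longlongrightarrow> (0::real)) at_top" by real_asymp
  hence E0: "(E \<longlongrightarrow> 0) at_top" by (intro tendsto_norm_zero_cancel[of E]) (simp add: nE)
  have nz: "E x \<noteq> 0" for x by (simp add: E_def)
  have s: "sin (of_real (pi / 2) * left_diag x) = (E x - 1 / E x) / (2 * \<i>)" for x
    unfolding sin_exp_eq E_def exp_minus by (simp add: inverse_eq_divide)
  have c: "cos (of_real (pi / 2) * left_diag x) = (E x + 1 / E x) / 2" for x
    unfolding cos_exp_eq E_def exp_minus by (simp add: inverse_eq_divide)
  have ne1: "(E x)\<^sup>2 \<noteq> 1" if "x > 0" for x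
  proof
    assume "(E x)\<^sup>2 = 1"
    hence "(cmod (E x))\<^sup>2 = 1" by (metis norm_one norm_power)
    moreover have "cmod (E x) < 1" using that by (simp add: nE)
    hence "(cmod (E x))\<^sup>2 < 1" by (simp add: power_less_one_iff)
    ultimately show False by simp
  qed
  have eq: "\<i> * ((E x)\<^sup>2 + 1) / ((E x)\<^sup>2 - 1) = cos (of_real (pi / 2) * left_diag x) / sin (of_real (pi / 2) * left_diag x)"
    if "x > 0" for x
  proof -
    have "E x + 1 / E x = ((E x)\<^sup>2 + 1) / E x" "E x - 1 / E x = ((E x)\<^sup>2 - 1) / E x"
      using nz[of x] by (simp_all add: field_simps power2_eq_square)
    moreover have "(P / e / 2) / (Q / e / (2 * \<i>)) = \<i> * P / Q" if "e \<noteq> 0" for P Q e :: complex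
      using that by (cases "Q = 0") (auto simp: field_simps)
    ultimately show ?thesis unfolding s c using nz[of x] by simp
  qed
  have "((\<lambda>x. \<i> * ((E x)\<^sup>2 + 1) / ((E x)\<^sup>2 - 1)) \<longlongrightarrow> \<i> * (0\<^sup>2 + 1) / (0\<^sup>2 - 1)) at_top"
    by (intro tendsto_intros E0) auto
  hence "((\<lambda>x. \<i> * ((E x)\<^sup>2 + 1) / ((E x)\<^sup>2 - 1)) \<longlongrightarrow> - \<i>) at_top" by simp
  thus "((\<lambda>x. cos (of_real (pi / 2) * left_diag x) / sin (of_real (pi / 2) * left_diag x)) \<longlongrightarrow> - \<i>) at_top"
    by (rule Lim_transform_eventually) (rule eventually_mono[OF eventually_gt_at_top[of 0]], rule eq)
  show "\<forall>\<^sub>F x in at_top. sin (of_real (pi / 2) * left_diag x) \<noteq> 0"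
    using eventually_gt_at_top[of 0]
  proof eventually_elim
    case (elim x)
    have "E x - 1 / E x = ((E x)\<^sup>2 - 1) / E x" using nz[of x] by (simp add: field_simps power2_eq_square)
    thus ?case unfolding s using ne1[OF elim] nz[of x] by simp
  qed
qed

text \<open>Here \<open>zeta'' / zeta'\<close> is \<open>W' / W - h\<close>. The first quotient
  tends to the purely imaginary \<open>- \<i> * pi / 2\<close>, so the real part is governed by
  \<open>- Re h\<close>, which behaves like \<open>- ln (x * sqrt 2) + ln (2 * pi)\<close>.\<close>

lemma zeta''_over_zeta'_left_diag:
  shows "((\<lambda>x. Re (zeta'' (left_diag x) / zeta' (left_diag x)) + ln (x * sqrt 2)) \<longlongrightarrow> ln (2 * pi)) at_top"
    and "\<forall>\<^sub>F x in at_top. zeta' (left_diag x) \<noteq> 0"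
proof -
  obtain K k' where "left_half_plane K k'" by (rule left_half_plane_exists)
  then interpret left_half_plane K k' .
  define T where "T = (\<lambda>x. cos (of_real (pi / 2) * left_diag x) / sin (of_real (pi / 2) * left_diag x))"
  define H where "H = (\<lambda>x. h (left_diag x))"
  define D where "D = (\<lambda>x. k' (1 - left_diag x))"
  have T: "(T \<longlongrightarrow> - \<i>) at_top" unfolding T_def by (rule cot_left_diag)
  have Re1: "Re (1 - left_diag x) = 1 + x" for x by (simp add: left_diag_def)
  have fw: "filterlim (\<lambda>x. 1 - left_diag x) right_end at_top"
    unfolding filterlim_filtercomap_iff o_def Re1 by real_asymp
  have evK: "\<forall>\<^sub>F x in at_top. Re (left_diag x) < 1 - K"
    using eventually_gt_at_top[of K] by eventually_elim (simp add: left_diag_def)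
  have "((\<lambda>x. log_deriv_A (1 - left_diag x) - Ln (1 - left_diag x) + of_real (ln (2 * pi))) \<longlongrightarrow> 0) at_top"
    using filterlim_compose[OF log_deriv_A_minus_Ln fw] .
  hence "((\<lambda>x. Re (log_deriv_A (1 - left_diag x) - Ln (1 - left_diag x) + of_real (ln (2 * pi)))) \<longlongrightarrow> Re 0) at_top"
    by (rule tendsto_Re)
  moreover have "\<forall>\<^sub>F x in at_top. Re (log_deriv_A (1 - left_diag x) - Ln (1 - left_diag x) + of_real (ln (2 * pi)))
      = Re (H x) - ln (sqrt ((1 + x)\<^sup>2 + x\<^sup>2)) + ln (2 * pi)"
    using eventually_gt_at_top[of 0]
  proof eventually_elim
    case (elim x)
    have "1 - left_diag x \<noteq> 0" using Re1[of x] elim by (metis add_pos_pos less_irrefl zero_complex.sel(1) zero_less_one)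
    moreover have "cmod (1 - left_diag x) = sqrt ((1 + x)\<^sup>2 + x\<^sup>2)" by (simp add: cmod_def left_diag_def)
    ultimately show ?case by (simp add: H_def h_def Re_Ln)
  qed
  ultimately have "((\<lambda>x. Re (H x) - ln (sqrt ((1 + x)\<^sup>2 + x\<^sup>2)) + ln (2 * pi)) \<longlongrightarrow> 0) at_top"
    using Lim_transform_eventually by fastforce
  moreover have "((\<lambda>x::real. ln (sqrt ((1 + x)\<^sup>2 + x\<^sup>2)) - ln (x * sqrt 2)) \<longlongrightarrow> 0) at_top"
  proof -
    have "((\<lambda>x::real. ln (sqrt ((1 + x)\<^sup>2 + x\<^sup>2)) - (ln x + ln 2 / 2)) \<longlongrightarrow> 0) at_top"
      by (real_asymp simp: ln_sqrt)
    thus ?thesis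
      by (rule Lim_transform_eventually)
         (rule eventually_mono[OF eventually_gt_at_top[of 0]], simp add: ln_mult ln_sqrt)
  qed
  ultimately have "((\<lambda>x. Re (H x) - ln (sqrt ((1 + x)\<^sup>2 + x\<^sup>2)) + ln (2 * pi) + (ln (sqrt ((1 + x)\<^sup>2 + x\<^sup>2)) - ln (x * sqrt 2))) \<longlongrightarrow> 0 + 0) at_top"
    by (rule tendsto_add)
  hence RH: "((\<lambda>x. Re (H x) - ln (x * sqrt 2) + ln (2 * pi)) \<longlongrightarrow> 0) at_top" by (simp add: algebra_simps)
  have "filterlim (\<lambda>x::real. ln (x * sqrt 2) - ln (2 * pi)) at_top at_top" by real_asymp
  from filterlim_tendsto_add_at_top[OF RH this]
  have "filterlim (\<lambda>x. Re (H x)) at_top at_top" by simp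
  hence "filterlim (\<lambda>x. cmod (H x)) at_top at_top"
    by (rule filterlim_at_top_mono) (auto intro!: always_eventually complex_Re_le_cmod)
  hence Hinf: "filterlim H at_infinity at_top" by (simp add: filterlim_at_infinity_conv_norm_at_top)
  hence iH: "((\<lambda>x. 1 / H x) \<longlongrightarrow> 0) at_top"
    using filterlim_compose[OF tendsto_inverse_0 Hinf] by (simp add: inverse_eq_divide)
  have DH: "((\<lambda>x. D x / H x) \<longlongrightarrow> 0) at_top"
  proof (rule Lim_null_comparison[OF _ tendsto_norm_zero[OF iH]])
    show "\<forall>\<^sub>F x in at_top. norm (D x / H x) \<le> norm (1 / H x)"
      using evK
    proof eventually_elim
      case (elim x)
      hence "cmod (D x) \<le> 1" unfolding D_def by (intro norm_k') simp
      thus ?case by (simp add: norm_divide divide_right_mono)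
    qed
  qed
  \<comment> \<open>\<open>W' / W\<close> with numerator and denominator divided by the sine and by
    \<open>h\<close>, so that every ingredient has a limit.\<close>
  define Q where "Q = (\<lambda>x. (- (of_real (pi / 2))\<^sup>2 * (1 / H x) - of_real (pi / 2) * T x + D x / H x) / (of_real (pi / 2) * T x * (1 / H x) - 1))"
  have "(Q \<longlongrightarrow> (- (of_real (pi / 2))\<^sup>2 * 0 - of_real (pi / 2) * (- \<i>) + 0) / (of_real (pi / 2) * (- \<i>) * 0 - 1)) at_top"
    unfolding Q_def by (intro tendsto_intros iH T DH) auto
  from tendsto_Re[OF this] have Q: "((\<lambda>x. Re (Q x)) \<longlongrightarrow> 0) at_top" by simp
  have "((\<lambda>x. of_real (pi / 2) * T x * (1 / H x)) \<longlongrightarrow> of_real (pi / 2) * (- \<i>) * 0) at_top" by (intro tendsto_intros iH T)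
  hence ev1: "\<forall>\<^sub>F x in at_top. of_real (pi / 2) * T x * (1 / H x) \<noteq> 1" by (intro tendsto_imp_eventually_ne) auto
  have "\<forall>\<^sub>F x in at_top. H x \<noteq> 0" using Hinf by (metis filterlim_at_infinity_imp_eventually_ne)
  with evK cot_left_diag(2) ev1 have key: "\<forall>\<^sub>F x in at_top. zeta' (left_diag x) \<noteq> 0 \<and> zeta'' (left_diag x) / zeta' (left_diag x) = Q x - H x"
  proof eventually_elim
    case (elim x)
    define S where "S = sin (of_real (pi / 2) * left_diag x)"
    define p where "p = complex_of_real (pi / 2)"
    have S: "S \<noteq> 0" using elim by (simp add: S_def)
    have C: "cos (of_real (pi / 2) * left_diag x) = T x * S" using S by (simp add: T_def S_def)
    have W: "W (left_diag x) = S * H x * (p * T x * (1 / H x) - 1)"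
    proof -
      have "W (left_diag x) = p * (T x * S) - H x * S"
        by (simp only: W_def C p_def H_def S_def)
      also have "\<dots> = S * H x * (p * T x * (1 / H x) - 1)" using elim by (simp add: field_simps)
      finally show ?thesis .
    qed
    hence W0: "W (left_diag x) \<noteq> 0" using elim S by (simp add: p_def)
    have W': "W' (left_diag x) = S * H x * (- p\<^sup>2 * (1 / H x) - p * T x + D x / H x)"
    proof -
      have "W' (left_diag x) = - (p\<^sup>2 * S) - p * H x * (T x * S) + D x * S"
        by (simp only: W'_def C p_def H_def S_def D_def)
      also have "\<dots> = S * H x * (- p\<^sup>2 * (1 / H x) - p * T x + D x / H x)" using elim by (simp add: field_simps)
      finally show ?thesis .
    qed
    have "W' (left_diag x) / W (left_diag x) = Q x"
      unfolding W W' Q_def p_def[symmetric] using S elim by simp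
    moreover have "zeta'' (left_diag x) / zeta' (left_diag x) = W' (left_diag x) / W (left_diag x) - H x"
      using zeta''_left[OF elim(1)] zeta'_left[OF elim(1)] A_nonzero[OF elim(1)] W0
      by (simp add: H_def diff_divide_distrib)
    ultimately show ?case using zeta'_left[OF elim(1)] A_nonzero[OF elim(1)] W0 by simp
  qed
  thus "\<forall>\<^sub>F x in at_top. zeta' (left_diag x) \<noteq> 0" by eventually_elim auto
  have "((\<lambda>x. Re (Q x) - (Re (H x) - ln (x * sqrt 2) + ln (2 * pi)) + ln (2 * pi)) \<longlongrightarrow> 0 - 0 + ln (2 * pi)) at_top"
    by (intro tendsto_intros Q RH)
  hence "((\<lambda>x. Re (Q x) - (Re (H x) - ln (x * sqrt 2) + ln (2 * pi)) + ln (2 * pi)) \<longlongrightarrow> ln (2 * pi)) at_top" by simp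
  thus "((\<lambda>x. Re (zeta'' (left_diag x) / zeta' (left_diag x)) + ln (x * sqrt 2)) \<longlongrightarrow> ln (2 * pi)) at_top"
    by (rule Lim_transform_eventually) (use key in \<open>auto elim!: eventually_mono\<close>)
qed

lemma nonreal_zeros_eq: "nonreal_zeros = {p \<in> zeta'_zeros. Im (fst p) \<noteq> 0}"
  by (auto simp: nonreal_zeros_def zeta'_zeros_def)

lemma zeta_deriv_num_not_constant: "\<not> zeta_deriv_num constant_on UNIV"
proof
  assume "zeta_deriv_num constant_on UNIV"
  then obtain c where c: "\<And>z. zeta_deriv_num z = c" by (auto simp: constant_on_def)
  obtain N :: nat and a :: "nat \<Rightarrow> real" where "N \<ge> 1" "\<And>n. a n \<le> - 2 * real (n + N) + 1"
    "\<And>n. zeta' (of_real (a n)) = 0"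
    using zeta'_left_zeros by metis
  hence "zeta_deriv_num (of_real (a 0)) = 0" using \<open>\<And>n. a n \<le> _\<close>[of 0] by (subst zeta_deriv_num_eq) auto
  thus False using c zeta_deriv_num_1 by (metis neg_0_equal_iff_equal zero_neq_one)
qed

lemma finite_zeta'_zeros_bounded: "finite {p \<in> zeta'_zeros. cmod (fst p) \<le> B}"
proof -
  have "finite {z \<in> cball 0 B. zeta_deriv_num z = 0}"
    by (rule holomorphic_compact_finite_zeros[OF zeta_deriv_num_holomorphic _ _ _ _ zeta_deriv_num_not_constant]) auto
  hence "finite (Sigma {z \<in> cball 0 B. zeta_deriv_num z = 0} (\<lambda>z. {..<nat (zorder zeta' z)}))" by auto
  thus ?thesis
    by (rule finite_subset[rotated]) (auto simp: zeta'_zeros_def zeta_deriv_num_eq)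
qed


section \<open>The sum over the non-real zeros\<close>

definition nonreal_sum :: "complex \<Rightarrow> real" where
  "nonreal_sum s = (\<Sum>\<^sub>\<infinity>p\<in>nonreal_zeros. Re (1 / (s - fst p)))"

text \<open>Zeros of \<open>zeta'\<close> far to the left are real, and there are none far to the
  right.\<close>

lemma nonreal_zeros_Re_bounded:
  obtains B where "B > 0" "\<And>p. p \<in> nonreal_zeros \<Longrightarrow> \<bar>Re (fst p)\<bar> \<le> B"
proof -
  obtain N :: nat and a :: "nat \<Rightarrow> real" where N:
    "\<And>s. zeta' s = 0 \<Longrightarrow> Re s < - 2 * real N + 2 \<Longrightarrow> s \<in> range (\<lambda>n. of_real (a n))"
    using zeta'_left_zeros by metis
  obtain B0 where B0: "\<And>s. Re s \<ge> B0 \<Longrightarrow> zeta' s \<noteq> 0"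
    using zeta_right_end(5) unfolding eventually_right_end by blast
  show ?thesis
  proof (rule that[of "max (2 * real N + 2) (max B0 1)"])
    fix p assume "p \<in> nonreal_zeros"
    hence p: "zeta' (fst p) = 0" "Im (fst p) \<noteq> 0" by (auto simp: nonreal_zeros_def)
    have "Re (fst p) < B0" using B0 p(1) by (meson not_le)
    moreover have "\<not> Re (fst p) < - 2 * real N + 2" using N[OF p(1)] p(2) by auto
    ultimately show "\<bar>Re (fst p)\<bar> \<le> max (2 * real N + 2) (max B0 1)" by auto
  qed auto
qed

lemma Re_sum_parts_summable:
  assumes s: "s \<noteq> 1" "zeta' s \<noteq> 0" and A: "A \<subseteq> zeta'_zeros"
  shows "(\<lambda>p. Re (1 / (s - fst p) + 1 / (fst p - 1))) summable_on A"
proof -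
  obtain c where "\<And>s. s \<noteq> 1 \<Longrightarrow> zeta' s \<noteq> 0 \<Longrightarrow>
    ((\<lambda>p. 1 / (s - fst p) + 1 / (fst p - 1)) has_sum (zeta'' s / zeta' s + 2 / (s - 1) - c)) zeta'_zeros"
    using zeta''_over_zeta'_has_sum by blast
  from has_sum_Re[OF this[OF s]] have "(\<lambda>p. Re (1 / (s - fst p) + 1 / (fst p - 1))) summable_on zeta'_zeros"
    by (rule has_sum_imp_summable)
  thus ?thesis using A by (rule summable_on_subset)
qed

text \<open>The real part is \<open>Re (\<lambda>' - 1)\<close> over the squared modulus, with a
  numerator bounded on the strip. This permits splitting off the compensating terms.\<close>

lemma nonreal_const_summable: "(\<lambda>p. Re (1 / (fst p - 1))) summable_on nonreal_zeros"
proof -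
  obtain B where B: "B > 0" "\<And>p. p \<in> nonreal_zeros \<Longrightarrow> \<bar>Re (fst p)\<bar> \<le> B"
    using nonreal_zeros_Re_bounded by blast
  have "(\<lambda>p. (B + 1) * (1 / (cmod (fst p - 1))\<^sup>2)) summable_on nonreal_zeros"
    by (intro summable_on_cmult_right summable_on_subset[OF zeta'_zeros_inverse_square_summable])
       (auto simp: nonreal_zeros_eq)
  hence "(\<lambda>p. norm (Re (1 / (fst p - 1)))) summable_on nonreal_zeros"
  proof (rule summable_on_comparison_test)
    fix p assume p: "p \<in> nonreal_zeros"
    have "norm (Re (1 / (fst p - 1))) = \<bar>Re (fst p - 1)\<bar> / (cmod (fst p - 1))\<^sup>2"
      by (simp add: Re_divide cmod_power2 abs_divide)
    also have "\<dots> \<le> (B + 1) / (cmod (fst p - 1))\<^sup>2"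
      using B(2)[OF p] by (intro divide_right_mono) auto
    finally show "norm (Re (1 / (fst p - 1))) \<le> (B + 1) * (1 / (cmod (fst p - 1))\<^sup>2)" by simp
  qed auto
  thus ?thesis by (rule abs_summable_summable)
qed

lemma nonreal_sum_summable:
  assumes s: "s \<noteq> 1" "zeta' s \<noteq> 0"
  shows "(\<lambda>p. Re (1 / (s - fst p))) summable_on nonreal_zeros"
proof -
  have "(\<lambda>p. Re (1 / (s - fst p) + 1 / (fst p - 1)) + (- 1) * Re (1 / (fst p - 1))) summable_on nonreal_zeros"
    by (intro summable_on_add Re_sum_parts_summable[OF s] summable_on_cmult_right nonreal_const_summable)
       (auto simp: nonreal_zeros_eq)
  thus ?thesis by simp
qed

text \<open>The zeros fall into the non-real ones, the left sequence \<open>a\<close>, and finitely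
  many remaining real ones. The last group and the term \<open>2 / (s - 1)\<close> contribute
  \<open>O(1 / \<bar>Im s\<bar>)\<close>, since a real point has distance at least
  \<open>\<bar>Im s\<bar>\<close> from \<open>s\<close>; everything independent of \<open>s\<close>
  goes into \<open>c\<close>.\<close>

lemma partial_fraction_asymp:
  obtains c K where "K > 0" "\<And>s. \<bar>Im s\<bar> \<ge> 2 \<Longrightarrow> zeta' s \<noteq> 0 \<Longrightarrow>
    \<bar>Re (zeta'' s / zeta' s) - nonreal_sum s - (c - ln (cmod s) / 2)\<bar> \<le> K / \<bar>Im s\<bar>"
proof -
  obtain c0 where c0: "\<And>s. s \<noteq> 1 \<Longrightarrow> zeta' s \<noteq> 0 \<Longrightarrow>
    ((\<lambda>p. 1 / (s - fst p) + 1 / (fst p - 1)) has_sum (zeta'' s / zeta' s + 2 / (s - 1) - c0)) zeta'_zeros"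
    using zeta''_over_zeta'_has_sum by blast
  obtain N :: nat and a :: "nat \<Rightarrow> real" where N: "N \<ge> 1"
    and a: "\<And>n. - 2 * real (n + N) \<le> a n" "\<And>n. a n \<le> - 2 * real (n + N) + 1"
    "\<And>n. zeta' (of_real (a n)) = 0" "\<And>n. zorder zeta' (of_real (a n)) = 1"
    "\<And>s. zeta' s = 0 \<Longrightarrow> Re s < - 2 * real N + 2 \<Longrightarrow> s \<in> range (\<lambda>n. of_real (a n))"
    using zeta'_left_zeros by metis
  obtain cA K1 where K1: "K1 > 0" "\<And>s. \<bar>Im s\<bar> \<ge> 2 \<Longrightarrow>
     summable (\<lambda>n. Re (1 / (s - of_real (a n)) - 1 / (1 - of_real (a n))))"
    "\<And>s. \<bar>Im s\<bar> \<ge> 2 \<Longrightarrow>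
     \<bar>(\<Sum>n. Re (1 / (s - of_real (a n)) - 1 / (1 - of_real (a n)))) - (cA - ln (cmod s) / 2)\<bar> \<le> K1 / \<bar>Im s\<bar>"
    by (rule real_zeros_sum_asymp[OF N a(1,2)]) blast
  obtain B0 where B0: "\<And>s. Re s \<ge> B0 \<Longrightarrow> zeta' s \<noteq> 0"
    using zeta_right_end(5) unfolding eventually_right_end by blast
  define R where "R = {p \<in> zeta'_zeros. Im (fst p) = 0 \<and> Re (fst p) \<ge> - 2 * real N + 2}"
  \<comment> \<open>The zeros of the sequence are simple, so only the index 0 occurs.\<close>
  define L where "L = (\<lambda>n. (complex_of_real (a n), 0 :: nat)) ` UNIV"
  have finR: "finite R"
  proof (rule finite_subset[OF _ finite_zeta'_zeros_bounded[of "max (2 * real N) \<bar>B0\<bar>"]])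
    show "R \<subseteq> {p \<in> zeta'_zeros. cmod (fst p) \<le> max (2 * real N) \<bar>B0\<bar>}"
    proof safe
      fix z k assume p: "(z, k) \<in> R"
      hence z: "zeta' z = 0" "Im z = 0" "Re z \<ge> - 2 * real N + 2" by (auto simp: R_def zeta'_zeros_def)
      have "Re z < B0" using B0 z(1) by (meson not_le)
      thus "cmod (fst (z, k)) \<le> max (2 * real N) \<bar>B0\<bar>" using z by (simp add: cmod_eq_Re)
      show "(z, k) \<in> zeta'_zeros" using p by (simp add: R_def)
    qed
  qed
  have injL: "inj (\<lambda>n. (complex_of_real (a n), 0 :: nat))"
  proof (rule injI)
    fix m n assume "(complex_of_real (a m), 0 :: nat) = (complex_of_real (a n), 0)"
    hence eq: "a m = a n" by simp
    show "m = n"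
    proof (rule ccontr)
      assume "m \<noteq> n"
      hence "real m \<ge> real n + 1 \<or> real n \<ge> real m + 1" by linarith
      thus False using a(1,2)[of m] a(1,2)[of n] eq by auto
    qed
  qed
  have La: "Re (fst p) < - 2 * real N + 2" "Im (fst p) = 0" if "p \<in> L" for p
    using that a(2) N by (auto simp: L_def) (smt (verit) of_nat_0_le_iff of_nat_add)
  have part: "zeta'_zeros = nonreal_zeros \<union> R \<union> L"
  proof
    show "zeta'_zeros \<subseteq> nonreal_zeros \<union> R \<union> L"
    proof
      fix p assume p: "p \<in> zeta'_zeros"
      obtain z k where zk: "p = (z, k)" by (cases p)
      have z: "zeta' z = 0" "k < nat (zorder zeta' z)" using p by (auto simp: zk zeta'_zeros_def)
      show "p \<in> nonreal_zeros \<union> R \<union> L"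
      proof (cases "Im z = 0 \<and> Re z < - 2 * real N + 2")
        case True
        then obtain n where n: "z = of_real (a n)" using a(5)[OF z(1)] by blast
        hence "k = 0" using z(2) a(4) by simp
        thus ?thesis using n zk by (auto simp: L_def)
      next
        case False
        thus ?thesis using p by (auto simp: nonreal_zeros_eq R_def zk)
      qed
    qed
    have "p \<in> zeta'_zeros" if "p \<in> L" for p
      using that a(3,4) La(1)[OF that] N by (auto simp: L_def zeta'_zeros_def)
    thus "nonreal_zeros \<union> R \<union> L \<subseteq> zeta'_zeros" by (auto simp: nonreal_zeros_eq R_def)
  qed
  have disj: "nonreal_zeros \<inter> R = {}" "(nonreal_zeros \<union> R) \<inter> L = {}"
    using La by (auto simp: nonreal_zeros_eq R_def) (metis fst_conv not_le)+
  define cN where "cN = (\<Sum>\<^sub>\<infinity>p\<in>nonreal_zeros. Re (1 / (fst p - 1)))"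
  define cR where "cR = (\<Sum>p\<in>R. Re (1 / (fst p - 1)))"
  define c where "c = cN + cR + cA + Re c0"
  define K where "K = K1 + real (card R) + 2"
  show ?thesis
  proof (rule that[of K c])
    show "K > 0" using K1 by (simp add: K_def)
    fix s assume s: "\<bar>Im s\<bar> \<ge> 2" "zeta' s \<noteq> 0"
    have s1: "s \<noteq> 1" using s by auto
    define f where "f = (\<lambda>p::complex \<times> nat. Re (1 / (s - fst p) + 1 / (fst p - 1)))"
    have "(f has_sum Re (zeta'' s / zeta' s + 2 / (s - 1) - c0)) zeta'_zeros"
      unfolding f_def by (rule has_sum_Re[OF c0[OF s1 s(2)]])
    hence tot: "infsum f zeta'_zeros = Re (zeta'' s / zeta' s + 2 / (s - 1) - c0)" by (rule infsumI)
    have sub: "f summable_on X" if "X \<subseteq> zeta'_zeros" for X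
      unfolding f_def by (rule Re_sum_parts_summable[OF s1 s(2) that])
    have "infsum f zeta'_zeros = infsum f nonreal_zeros + infsum f R + infsum f L"
      unfolding part using part disj
      by (subst infsum_Un_disjoint; (subst infsum_Un_disjoint)?) (auto intro!: sub)
    moreover have "infsum f nonreal_zeros = nonreal_sum s + cN"
    proof -
      have "infsum f nonreal_zeros = (\<Sum>\<^sub>\<infinity>p\<in>nonreal_zeros. Re (1 / (s - fst p)) + Re (1 / (fst p - 1)))"
        unfolding f_def by simp
      also have "\<dots> = nonreal_sum s + cN" unfolding nonreal_sum_def cN_def
        by (rule infsum_add[OF nonreal_sum_summable[OF s1 s(2)] nonreal_const_summable])
      finally show ?thesis .
    qed
    moreover have "infsum f R = (\<Sum>p\<in>R. Re (1 / (s - fst p))) + cR"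
      using finR by (simp add: f_def cR_def sum.distrib)
    moreover have "infsum f L = (\<Sum>n. Re (1 / (s - of_real (a n)) - 1 / (1 - of_real (a n))))"
    proof -
      have "f summable_on L" by (rule sub) (auto simp: part)
      hence "(f \<circ> (\<lambda>n. (complex_of_real (a n), 0 :: nat))) summable_on UNIV"
        unfolding L_def by (subst (asm) summable_on_reindex[OF injL])
      hence "((f \<circ> (\<lambda>n. (complex_of_real (a n), 0 :: nat))) has_sum infsum (f \<circ> (\<lambda>n. (complex_of_real (a n), 0 :: nat))) UNIV) UNIV"
        by simp
      hence "infsum (f \<circ> (\<lambda>n. (complex_of_real (a n), 0 :: nat))) UNIV = (\<Sum>n. (f \<circ> (\<lambda>n. (complex_of_real (a n), 0 :: nat))) n)"
        by (intro sums_unique has_sum_imp_sums)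
      moreover have "infsum f L = infsum (f \<circ> (\<lambda>n. (complex_of_real (a n), 0 :: nat))) UNIV"
        unfolding L_def by (rule infsum_reindex[OF injL])
      moreover have "(f \<circ> (\<lambda>n. (complex_of_real (a n), 0 :: nat))) n = Re (1 / (s - of_real (a n)) - 1 / (1 - of_real (a n)))" for n
      proof -
        have "1 / (complex_of_real (a n) - 1) = - (1 / (1 - complex_of_real (a n)))"
          by (metis minus_diff_eq minus_divide_right)
        thus ?thesis by (simp add: f_def)
      qed
      ultimately show ?thesis by simp
    qed
    ultimately have eq: "Re (zeta'' s / zeta' s) - nonreal_sum s - (c - ln (cmod s) / 2) =
       ((\<Sum>n. Re (1 / (s - of_real (a n)) - 1 / (1 - of_real (a n)))) - (cA - ln (cmod s) / 2))
       + (\<Sum>p\<in>R. Re (1 / (s - fst p))) - Re (2 / (s - 1))"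
      using tot by (simp add: c_def)
    have inv: "\<bar>Re (1 / (s - z))\<bar> \<le> 1 / \<bar>Im s\<bar>" if "Im z = 0" for z
    proof -
      have "\<bar>Re (1 / (s - z))\<bar> \<le> cmod (1 / (s - z))" by (rule abs_Re_le_cmod)
      also have "\<dots> = 1 / cmod (s - z)" by (simp add: norm_divide)
      also have "\<dots> \<le> 1 / \<bar>Im s\<bar>" using abs_Im_le_cmod[of "s - z"] that s by (intro divide_left_mono mult_pos_pos) auto
      finally show ?thesis .
    qed
    have "\<bar>\<Sum>p\<in>R. Re (1 / (s - fst p))\<bar> \<le> (\<Sum>p\<in>R. 1 / \<bar>Im s\<bar>)"
      by (rule order_trans[OF sum_abs sum_mono]) (auto intro!: inv simp: R_def)
    hence b1: "\<bar>\<Sum>p\<in>R. Re (1 / (s - fst p))\<bar> \<le> real (card R) / \<bar>Im s\<bar>" by simp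
    have "Re (2 / (s - 1)) = 2 * Re (1 / (s - 1))" by (simp add: Re_divide)
    hence b2: "\<bar>Re (2 / (s - 1))\<bar> \<le> 2 / \<bar>Im s\<bar>" using inv[of 1] by simp
    have "\<bar>X + Y - Z\<bar> \<le> x + y + z" if "\<bar>X\<bar> \<le> x" "\<bar>Y\<bar> \<le> y" "\<bar>Z\<bar> \<le> z" for X Y Z x y z :: real
      using that by linarith
    from this[OF K1(3)[OF s(1)] b1 b2]
    have "\<bar>Re (zeta'' s / zeta' s) - nonreal_sum s - (c - ln (cmod s) / 2)\<bar> \<le> K1 / \<bar>Im s\<bar> + real (card R) / \<bar>Im s\<bar> + 2 / \<bar>Im s\<bar>"
      unfolding eq .
    also have "\<dots> = K / \<bar>Im s\<bar>" by (simp add: K_def add_divide_distrib)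
    finally show "\<bar>Re (zeta'' s / zeta' s) - nonreal_sum s - (c - ln (cmod s) / 2)\<bar> \<le> K / \<bar>Im s\<bar>" .
  qed
qed

section \<open>Determination of the constant\<close>

lemma infsum_tendsto_0_dominated:
  fixes f :: "'b \<Rightarrow> 'a \<Rightarrow> real"
  assumes g: "g summable_on A" and bound: "\<forall>\<^sub>F x in F. \<forall>p\<in>A. \<bar>f x p\<bar> \<le> g p"
    and lim: "\<And>p. p \<in> A \<Longrightarrow> ((\<lambda>x. f x p) \<longlongrightarrow> 0) F"
  shows "((\<lambda>x. infsum (f x) A) \<longlongrightarrow> 0) F"
proof (rule tendstoI)
  fix e :: real assume e: "e > 0"
  obtain X where X: "finite X" "X \<subseteq> A" "dist (sum g X) (infsum g A) \<le> e / 4"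
    using has_sum_finite_approximation[of g A "infsum g A" "e / 4"] g e by auto
  have gX: "infsum g (A - X) \<le> e / 4"
  proof -
    have "infsum g A = infsum g X + infsum g (A - X)"
      using X g infsum_Un_disjoint[of g X "A - X"]
      by (metis Diff_disjoint Diff_partition Diff_subset summable_on_finite summable_on_subset)
    thus ?thesis using X by (simp add: dist_real_def)
  qed
  have "((\<lambda>x. \<Sum>p\<in>X. f x p) \<longlongrightarrow> (\<Sum>p\<in>X. 0)) F"
    using X by (intro tendsto_sum lim) auto
  hence "\<forall>\<^sub>F x in F. dist (\<Sum>p\<in>X. f x p) 0 < e / 2" using e by (intro tendstoD) auto
  with bound show "\<forall>\<^sub>F x in F. dist (infsum (f x) A) 0 < e"
  proof eventually_elim
    case (elim x)
    have fs: "(\<lambda>p. norm (f x p)) summable_on A"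
      by (rule summable_on_comparison_test[OF g]) (use elim in auto)
    hence fs': "f x summable_on A" by (rule abs_summable_summable)
    have split: "infsum (f x) A = sum (f x) X + infsum (f x) (A - X)"
      using X fs' infsum_Un_disjoint[of "f x" X "A - X"]
      by (metis Diff_disjoint Diff_partition Diff_subset infsum_finite summable_on_finite summable_on_subset)
    have fsX: "(\<lambda>p. norm (f x p)) summable_on (A - X)" by (rule summable_on_subset[OF fs]) auto
    have "\<bar>infsum (f x) (A - X)\<bar> \<le> (\<Sum>\<^sub>\<infinity>p\<in>A - X. norm (f x p))"
      using norm_infsum_bound[OF fsX] by simp
    also have "\<dots> \<le> infsum g (A - X)"
      by (rule infsum_mono[OF fsX summable_on_subset[OF g]]) (use elim in auto)
    finally show ?case using split gX elim(2) e by (simp add: dist_real_def)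
  qed
qed

text \<open>The diagonals are nearly mirror images with respect to the zero
  \<open>Complex b y\<close>, so the main parts of the two terms cancel and a factor
  \<open>2 * b\<close> remains. The first bound gives the limit of each term, the second a majorant
  independent of \<open>x\<close>.\<close>

lemma diag_term_bound:
  fixes b y x B :: real
  assumes b: "\<bar>b\<bar> \<le> B" and x: "x \<ge> 2 * B + 2" and y: "y \<noteq> 0"
  defines "t \<equiv> Re (1 / (right_diag x - Complex b y)) + Re (1 / (left_diag x - Complex b y))"
  shows "\<bar>t\<bar> \<le> 8 * B / (x\<^sup>2 / 4 + (x - y)\<^sup>2)" "\<bar>t\<bar> \<le> 96 * B * (1 / (cmod (Complex b y - 1))\<^sup>2)"
proof -
  define u where "u = x - y"
  have B0: "B \<ge> 0" using b by linarith
  have x0: "x > 0" using x B0 by simp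
  define D1 where "D1 = (x - b)\<^sup>2 + u\<^sup>2"
  define D2 where "D2 = (x + b)\<^sup>2 + u\<^sup>2"
  define Q where "Q = x\<^sup>2 / 4 + u\<^sup>2"
  have Q: "Q > 0" using x0 by (simp add: Q_def add_pos_nonneg)
  have "x / 2 \<le> x - b" "x / 2 \<le> x + b" using b x by auto
  hence "(x / 2)\<^sup>2 \<le> (x - b)\<^sup>2" "(x / 2)\<^sup>2 \<le> (x + b)\<^sup>2" using x0 by (intro power_mono; simp)+
  hence D: "Q \<le> D1" "Q \<le> D2" by (simp_all add: Q_def D1_def D2_def power_divide)
  have t: "t = (x - b) / D1 - (x + b) / D2"
  proof -
    have "(- x - b)\<^sup>2 = (x + b)\<^sup>2" by (simp add: power2_eq_square algebra_simps)
    thus ?thesis unfolding t_def D1_def D2_def u_def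
      by (simp add: Re_divide right_diag_def left_diag_def) (simp add: field_simps minus_divide_left)
  qed
  also have "\<dots> = (2 * b * (x\<^sup>2 - b\<^sup>2 - u\<^sup>2)) / (D1 * D2)"
  proof -
    have "D1 \<noteq> 0" "D2 \<noteq> 0" using D Q by auto
    hence "(x - b) / D1 - (x + b) / D2 = ((x - b) * D2 - (x + b) * D1) / (D1 * D2)" by (simp add: divide_simps)
    also have "(x - b) * D2 - (x + b) * D1 = 2 * b * (x\<^sup>2 - b\<^sup>2 - u\<^sup>2)"
      by (simp add: D1_def D2_def power2_eq_square algebra_simps)
    finally show ?thesis .
  qed
  finally have "\<bar>t\<bar> = 2 * \<bar>b\<bar> * \<bar>x\<^sup>2 - b\<^sup>2 - u\<^sup>2\<bar> / (D1 * D2)"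
    using D Q by (simp add: abs_mult)
  also have "\<dots> \<le> 2 * B * (4 * Q) / (Q * Q)"
  proof (intro frac_le mult_mono)
    have "b\<^sup>2 \<le> x\<^sup>2" using b x by (intro abs_le_square_iff[THEN iffD1]) auto
    thus "\<bar>x\<^sup>2 - b\<^sup>2 - u\<^sup>2\<bar> \<le> 4 * Q" by (simp add: Q_def abs_le_iff) (smt (verit) zero_le_power2)
  qed (use b D Q B0 in auto)
  also have "\<dots> = 8 * B / Q" using Q by simp
  finally have 1: "\<bar>t\<bar> \<le> 8 * B / Q" .
  thus "\<bar>t\<bar> \<le> 8 * B / (x\<^sup>2 / 4 + (x - y)\<^sup>2)" by (simp add: Q_def u_def)
  define E where "E = (cmod (Complex b y - 1))\<^sup>2"
  have E: "E = (b - 1)\<^sup>2 + y\<^sup>2" by (simp add: E_def cmod_power2)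
  show "\<bar>t\<bar> \<le> 96 * B * (1 / (cmod (Complex b y - 1))\<^sup>2)"
  proof -
    have E0: "E > 0" using y by (simp add: E add_nonneg_pos)
    have "(b - 1)\<^sup>2 \<le> x\<^sup>2" using b x by (intro abs_le_square_iff[THEN iffD1]) auto
    moreover have "y\<^sup>2 \<le> 2 * x\<^sup>2 + 2 * u\<^sup>2"
    proof -
      have "(x - u)\<^sup>2 + (x + u)\<^sup>2 = 2 * x\<^sup>2 + 2 * u\<^sup>2" by (simp add: power2_eq_square algebra_simps)
      moreover have "y\<^sup>2 = (x - u)\<^sup>2" "0 \<le> (x + u)\<^sup>2" by (simp_all add: u_def)
      ultimately show ?thesis by argo
    qed
    \<comment> \<open>\<open>E \<le> 3 * x\<^sup>2 + 2 * u\<^sup>2\<close>, and 12 offsets the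
      quarter in \<open>Q\<close>; hence \<open>96 = 8 * 12\<close>.\<close>
    ultimately have "E \<le> 12 * Q" unfolding E Q_def using zero_le_power2[of u] by argo
    hence "8 * B / Q \<le> 96 * B * (1 / E)" using Q E0 B0 by (simp add: divide_simps mult_mono algebra_simps)
    thus ?thesis using 1 by (simp add: E_def)
  qed
qed


lemma diag_nonzero:
  "\<forall>\<^sub>F x in at_top. right_diag x \<noteq> 1 \<and> zeta' (right_diag x) \<noteq> 0 \<and> left_diag x \<noteq> 1 \<and> zeta' (left_diag x) \<noteq> 0"
proof -
  have "filterlim right_diag right_end at_top"
    unfolding filterlim_filtercomap_iff o_def right_diag_def by (simp add: filterlim_ident)
  hence "\<forall>\<^sub>F x in at_top. zeta' (right_diag x) \<noteq> 0"
    by (rule eventually_compose_filterlim[OF zeta_right_end(5)])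
  with zeta''_over_zeta'_left_diag(2) eventually_gt_at_top[of 0] show ?thesis
    by eventually_elim (auto simp: left_diag_def right_diag_def complex_eq_iff)
qed

lemma nonreal_sum_diag_tendsto:
  "((\<lambda>x. nonreal_sum (right_diag x) + nonreal_sum (left_diag x)) \<longlongrightarrow> 0) at_top"
proof -
  obtain B where B: "B > 0" "\<And>p. p \<in> nonreal_zeros \<Longrightarrow> \<bar>Re (fst p)\<bar> \<le> B"
    using nonreal_zeros_Re_bounded by blast
  define f where "f = (\<lambda>x p. Re (1 / (right_diag x - fst (p::complex \<times> nat))) + Re (1 / (left_diag x - fst p)))"
  have Im: "Im (fst p) \<noteq> 0" if "p \<in> nonreal_zeros" for p using that by (auto simp: nonreal_zeros_def)
  have bd: "\<bar>f x p\<bar> \<le> 8 * B / (x\<^sup>2 / 4 + (x - Im (fst p))\<^sup>2)"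
    "\<bar>f x p\<bar> \<le> 96 * B * (1 / (cmod (fst p - 1))\<^sup>2)" if "p \<in> nonreal_zeros" "x \<ge> 2 * B + 2" for x p
    using diag_term_bound[OF B(2)[OF that(1)] that(2) Im[OF that(1)]] by (simp_all add: f_def)
  have "((\<lambda>x. infsum (f x) nonreal_zeros) \<longlongrightarrow> 0) at_top"
  proof (rule infsum_tendsto_0_dominated)
    show "(\<lambda>p. 96 * B * (1 / (cmod (fst p - 1))\<^sup>2)) summable_on nonreal_zeros"
      by (intro summable_on_cmult_right summable_on_subset[OF zeta'_zeros_inverse_square_summable])
         (auto simp: nonreal_zeros_eq)
    show "\<forall>\<^sub>F x in at_top. \<forall>p\<in>nonreal_zeros. \<bar>f x p\<bar> \<le> 96 * B * (1 / (cmod (fst p - 1))\<^sup>2)"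
      using eventually_ge_at_top[of "2 * B + 2"] by eventually_elim (use bd in blast)
    fix p assume p: "p \<in> nonreal_zeros"
    have lim: "((\<lambda>x::real. 8 * B / (x\<^sup>2 / 4)) \<longlongrightarrow> 0) at_top" by real_asymp
    show "((\<lambda>x. f x p) \<longlongrightarrow> 0) at_top"
    proof (rule Lim_null_comparison[OF _ lim])
      show "\<forall>\<^sub>F x in at_top. norm (f x p) \<le> 8 * B / (x\<^sup>2 / 4)"
        using eventually_ge_at_top[of "2 * B + 2"]
      proof eventually_elim
        case (elim x)
        have x: "x > 0" using elim B by simp
        have "norm (f x p) \<le> 8 * B / (x\<^sup>2 / 4 + (x - Im (fst p))\<^sup>2)" using bd(1)[OF p elim] by simp
        also have "\<dots> \<le> 8 * B / (x\<^sup>2 / 4)"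
          using x B by (intro divide_left_mono mult_pos_pos) (auto simp: add_pos_nonneg)
        finally show ?case .
      qed
    qed
  qed
  thus ?thesis
  proof (rule Lim_transform_eventually)
    show "\<forall>\<^sub>F x in at_top. infsum (f x) nonreal_zeros = nonreal_sum (right_diag x) + nonreal_sum (left_diag x)"
      using diag_nonzero
    proof eventually_elim
      case (elim x)
      show ?case unfolding f_def nonreal_sum_def
        by (rule infsum_add) (use elim in \<open>auto intro!: nonreal_sum_summable\<close>)
    qed
  qed
qed

text \<open>
  The constant of \<open>partial_fraction_asymp\<close> is determined by adding the asymptotics at \<open>x (1 + i)\<close> and \<open>x (-1 + i)\<close>.
\<close>

lemma zeta''_over_zeta'_asymp:
  obtains K where "K > 0" "\<And>s. \<bar>Im s\<bar> \<ge> 2 \<Longrightarrow> zeta' s \<noteq> 0 \<Longrightarrow>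
    \<bar>Re (zeta'' s / zeta' s) - nonreal_sum s - (ln pi / 2 - ln (cmod s) / 2)\<bar> \<le> K / \<bar>Im s\<bar>"
proof -
  obtain c K where K: "K > 0" "\<And>s. \<bar>Im s\<bar> \<ge> 2 \<Longrightarrow> zeta' s \<noteq> 0 \<Longrightarrow>
    \<bar>Re (zeta'' s / zeta' s) - nonreal_sum s - (c - ln (cmod s) / 2)\<bar> \<le> K / \<bar>Im s\<bar>"
    using partial_fraction_asymp by blast
  define X where "X = (\<lambda>s. Re (zeta'' s / zeta' s))"
  have fr: "filterlim right_diag right_end at_top"
    unfolding filterlim_filtercomap_iff o_def right_diag_def by (simp add: filterlim_ident)
  have "((\<lambda>x. X (right_diag x)) \<longlongrightarrow> Re (- of_real (ln 2))) at_top"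
    unfolding X_def by (intro tendsto_Re filterlim_compose[OF zeta_right_end(3) fr])
  hence l1: "((\<lambda>x. X (right_diag x)) \<longlongrightarrow> - ln 2) at_top" by simp
  have l2: "((\<lambda>x. X (left_diag x) + ln (x * sqrt 2)) \<longlongrightarrow> ln (2 * pi)) at_top"
    unfolding X_def by (rule zeta''_over_zeta'_left_diag(1))
  \<comment> \<open>The logarithm on the left diagonal cancels the two halves of
    \<open>ln (cmod s)\<close> in the expansion, so \<open>Y\<close> tends to \<open>2 * c\<close>.
    The known limits give \<open>- ln 2 + ln (2 * pi) = ln pi\<close>.\<close>
  define Y where "Y = (\<lambda>x. X (right_diag x) + (X (left_diag x) + ln (x * sqrt 2)) - (nonreal_sum (right_diag x) + nonreal_sum (left_diag x)))"
  have "(Y \<longlongrightarrow> - ln 2 + ln (2 * pi) - 0) at_top"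
    unfolding Y_def by (intro tendsto_intros l1 l2 nonreal_sum_diag_tendsto)
  moreover have "- ln 2 + ln (2 * pi) - 0 = ln pi" by (simp add: ln_mult)
  ultimately have Y1: "(Y \<longlongrightarrow> ln pi) at_top" by simp
  have "((\<lambda>x. Y x - 2 * c) \<longlongrightarrow> 0) at_top"
  proof (rule Lim_null_comparison)
    show "((\<lambda>x::real. 2 * K / x) \<longlongrightarrow> 0) at_top" by real_asymp
    show "\<forall>\<^sub>F x in at_top. norm (Y x - 2 * c) \<le> 2 * K / x"
      using diag_nonzero eventually_ge_at_top[of 2]
    proof eventually_elim
      case (elim x)
      have n: "cmod (right_diag x) = x * sqrt 2" "cmod (left_diag x) = x * sqrt 2"
        using elim by (auto simp: right_diag_def left_diag_def cmod_def real_sqrt_mult)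
      have "\<bar>X (right_diag x) - nonreal_sum (right_diag x) - (c - ln (x * sqrt 2) / 2)\<bar> \<le> K / x"
        using K(2)[of "right_diag x"] elim n unfolding X_def by (simp add: right_diag_def)
      moreover have "\<bar>X (left_diag x) - nonreal_sum (left_diag x) - (c - ln (x * sqrt 2) / 2)\<bar> \<le> K / x"
        using K(2)[of "left_diag x"] elim n unfolding X_def by (simp add: left_diag_def)
      moreover have "Y x - 2 * c = (X (right_diag x) - nonreal_sum (right_diag x) - (c - ln (x * sqrt 2) / 2))
          + (X (left_diag x) - nonreal_sum (left_diag x) - (c - ln (x * sqrt 2) / 2))"
        by (simp add: Y_def)
      moreover have "\<bar>A + B\<bar> \<le> 2 * r" if "\<bar>A\<bar> \<le> r" "\<bar>B\<bar> \<le> r" for A B r :: real using that by linarith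
      ultimately show ?case by (simp only: real_norm_def times_divide_eq_right[symmetric])
    qed
  qed
  hence "((\<lambda>x. (Y x - 2 * c) + 2 * c) \<longlongrightarrow> 0 + 2 * c) at_top" by (intro tendsto_intros)
  hence "(Y \<longlongrightarrow> 2 * c) at_top" by simp
  with Y1 have "2 * c = ln pi" using tendsto_unique by (metis trivial_limit_at_top_linorder)
  hence "c = ln pi / 2" by simp
  with K show ?thesis by (intro that[of K]) auto
qed

section \<open>Zeros of the second derivative and the final estimate\<close>

lemma finite_zeta''_zeros_bounded: "finite {s. s \<noteq> 1 \<and> zeta'' s = 0 \<and> cmod s \<le> B}"
proof -
  \<comment> \<open>Away from 1 this is \<open>(s - 1) ^ 3 * zeta'' s\<close>, made entire; the
    value 2 at 1 excludes the zero function.\<close>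
  define G where "G = (\<lambda>s. (s - 1) * deriv zeta_deriv_num s - 2 * zeta_deriv_num s)"
  have hol: "G holomorphic_on UNIV" unfolding G_def
    by (intro holomorphic_intros holomorphic_deriv zeta_deriv_num_holomorphic) auto
  have G1: "G 1 = 2" by (simp add: G_def zeta_deriv_num_1)
  have G0: "G s = 0" if s: "s \<noteq> 1" "zeta'' s = 0" for s
  proof -
    have "((\<lambda>s. (s - 1)\<^sup>2 * zeta' s) has_field_derivative (2 * (s - 1) * zeta' s + (s - 1)\<^sup>2 * zeta'' s)) (at s)"
      using s by (auto intro!: derivative_eq_intros zeta'_DERIV)
    hence "(zeta_deriv_num has_field_derivative (2 * (s - 1) * zeta' s + (s - 1)\<^sup>2 * zeta'' s)) (at s)"
      by (rule has_field_derivative_transform_within_open[of _ _ _ "- {1}"]) (use s in \<open>auto simp: zeta_deriv_num_eq\<close>)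
    hence "deriv zeta_deriv_num s = 2 * (s - 1) * zeta' s" using s(2) by (simp add: DERIV_imp_deriv)
    moreover have "zeta_deriv_num s = (s - 1)\<^sup>2 * zeta' s" by (rule zeta_deriv_num_eq[OF s(1)])
    ultimately show ?thesis by (simp only: G_def) (simp add: power2_eq_square)
  qed
  have "finite {s \<in> cball 0 B. G s = 0}"
  proof (cases "G constant_on UNIV")
    case True
    hence "G s = 2" for s using G1 by (auto simp: constant_on_def)
    thus ?thesis by simp
  next
    case False
    show ?thesis by (rule holomorphic_compact_finite_zeros[OF hol _ _ _ _ False]) auto
  qed
  thus ?thesis by (rule finite_subset[rotated]) (use G0 in auto)
qed

theorem theorem5:
  assumes "riemann_hypothesis"
  shows "\<exists>C>0. \<forall>\<rho>'' \<rho>' :: complex.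
    zeta'' \<rho>'' = 0 \<and> Re \<rho>'' > 1 / 2 \<and> Im \<rho>'' > 0 \<and> zeta' \<rho>'' \<noteq> 0 \<and>
    canonically_associated \<rho>'' \<rho>' \<longrightarrow>
      (\<lambda>(l, k). Re (1 / (\<rho>'' - l))) summable_on (nonreal_zeros - {(\<rho>', 0)}) \<and>
      \<bar>Re (1 / (\<rho>'' - \<rho>')) +
        (\<Sum>\<^sub>\<infinity>(l, k)\<in>nonreal_zeros - {(\<rho>', 0)}. Re (1 / (\<rho>'' - l)))
        - ln (Im \<rho>'' / pi) / 2\<bar> \<le> C / Im \<rho>''"
proof -
  obtain K where K: "K > 0" "\<And>s. \<bar>Im s\<bar> \<ge> 2 \<Longrightarrow> zeta' s \<noteq> 0 \<Longrightarrow>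
    \<bar>Re (zeta'' s / zeta' s) - nonreal_sum s - (ln pi / 2 - ln (cmod s) / 2)\<bar> \<le> K / \<bar>Im s\<bar>"
    using zeta''_over_zeta'_asymp by blast
  obtain B where B: "\<And>s. Re s \<ge> B \<Longrightarrow> zeta'' s \<noteq> 0"
    using zeta_right_end(6) unfolding eventually_right_end by blast
  \<comment> \<open>A finite set that contains every zero of \<open>zeta''\<close> with
    \<open>Re s > 1 / 2\<close> and \<open>0 < Im s < 2\<close>, because such a zero has
    \<open>Re s < B\<close>.\<close>
  define S where "S = {s. s \<noteq> 1 \<and> zeta'' s = 0 \<and> cmod s \<le> \<bar>B\<bar> + 2}"
  have finS: "finite S" unfolding S_def by (rule finite_zeta''_zeros_bounded)
  define d where "d = (\<lambda>s. nonreal_sum s - ln (Im s / pi) / 2)"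
  define M where "M = (\<Sum>s\<in>S. \<bar>d s\<bar>)"
  have M0: "M \<ge> 0" by (simp add: M_def sum_nonneg)
  define C where "C = K + \<bar>B\<bar> + 2 * M + 1"
  have main: "\<bar>d s\<bar> \<le> (K + \<bar>B\<bar> + 2 * M) / Im s"
    if s: "zeta'' s = 0" "Re s > 1 / 2" "Im s > 0" "zeta' s \<noteq> 0" "s \<noteq> 1" for s
  proof -
    have ReB: "Re s < B" using B s(1) by (meson not_le)
    have cm: "cmod s \<le> Re s + Im s" using cmod_le[of s] s by simp
    show ?thesis
    proof (cases "Im s \<ge> 2")
      case True
      have "\<bar>Re (zeta'' s / zeta' s) - nonreal_sum s - (ln pi / 2 - ln (cmod s) / 2)\<bar> \<le> K / Im s"
        using K(2)[of s] True s by simp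
      hence 1: "\<bar>nonreal_sum s - (ln (cmod s) - ln pi) / 2\<bar> \<le> K / Im s"
        using s by (simp add: abs_le_iff diff_divide_distrib)
      \<comment> \<open>\<open>cmod s\<close> exceeds \<open>Im s\<close> by at most
        \<open>Re s\<close>, which lies below \<open>B\<close>; so the exchange costs
        \<open>O(1 / Im s)\<close>.\<close>
      have "\<bar>ln (cmod s) - ln (Im s)\<bar> \<le> \<bar>cmod s - Im s\<bar> / Im s"
        using s abs_Im_le_cmod[of s] by (intro ln_diff_bound) auto
      also have "\<dots> \<le> \<bar>B\<bar> / Im s"
        using cm ReB abs_Im_le_cmod[of s] s by (intro divide_right_mono) auto
      finally have 2: "\<bar>ln (cmod s) - ln (Im s)\<bar> \<le> \<bar>B\<bar> / Im s" .
      have "ln (Im s / pi) = ln (Im s) - ln pi" using s by (simp add: ln_div)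
      hence "d s = (nonreal_sum s - (ln (cmod s) - ln pi) / 2) + (ln (cmod s) - ln (Im s)) / 2"
        by (simp add: d_def field_simps)
      moreover have "\<bar>P + Q / 2\<bar> \<le> p + q" if "\<bar>P\<bar> \<le> p" "\<bar>Q\<bar> \<le> q" for P Q p q :: real
        using that by linarith
      ultimately have "\<bar>d s\<bar> \<le> K / Im s + \<bar>B\<bar> / Im s" using 1 2 by (simp only:)
      also have "\<dots> \<le> (K + \<bar>B\<bar> + 2 * M) / Im s"
        unfolding add_divide_distrib[symmetric] using M0 s by (intro divide_right_mono) auto
      finally show ?thesis .
    next
      case False
      have "s \<in> S" using cm ReB False s by (auto simp: S_def)
      hence "\<bar>d s\<bar> \<le> M" unfolding M_def using finS by (intro member_le_sum) auto
      \<comment> \<open>For \<open>Im s < 2\<close> a constant bound already has the required form,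
        at the price of the factor 2.\<close>
      also have "M \<le> 2 * M / Im s" using False s M0 by (simp add: pos_le_divide_eq) (simp add: mult_left_mono mult.commute)
      also have "\<dots> \<le> (K + \<bar>B\<bar> + 2 * M) / Im s" using K s by (intro divide_right_mono) auto
      finally show ?thesis .
    qed
  qed
  show ?thesis
  proof (intro exI[of _ C] conjI allI impI)
    show "C > 0" using K M0 by (simp add: C_def add_pos_nonneg)
    fix s r :: complex
    assume "zeta'' s = 0 \<and> Re s > 1 / 2 \<and> Im s > 0 \<and> zeta' s \<noteq> 0 \<and> canonically_associated s r"
    hence s: "zeta'' s = 0" "Re s > 1 / 2" "Im s > 0" "zeta' s \<noteq> 0" "s \<noteq> 1" and r: "r \<noteq> 1" "zeta' r = 0"
      by (auto simp: canonically_associated_def)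
    define f where "f = (\<lambda>p :: complex \<times> nat. Re (1 / (s - fst p)))"
    have ff: "(\<lambda>(l, k). Re (1 / (s - l))) = f" by (simp add: f_def case_prod_unfold)
    have sm: "f summable_on nonreal_zeros" unfolding f_def by (rule nonreal_sum_summable[OF s(5,4)])
    thus sm': "(\<lambda>(l, k). Re (1 / (s - l))) summable_on (nonreal_zeros - {(r, 0)})"
      unfolding ff by (rule summable_on_subset) auto
    have ns: "infsum f nonreal_zeros = nonreal_sum s" by (simp add: f_def nonreal_sum_def)
    \<comment> \<open>A non-real \<open>r\<close> is the omitted occurrence, which the extra term
      restores exactly. A real \<open>r\<close> does not occur in \<open>nonreal_zeros\<close>, so
      its term is an addition of size at most \<open>1 / Im s\<close>; this is the
      \<open>+ 1\<close> in \<open>C\<close>.\<close>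
    have e: "\<bar>f (r, 0) + infsum f (nonreal_zeros - {(r, 0)}) - nonreal_sum s\<bar> \<le> 1 / Im s"
    proof (cases "Im r = 0")
      case True
      hence "nonreal_zeros - {(r, 0)} = nonreal_zeros" by (auto simp: nonreal_zeros_def)
      hence "\<bar>f (r, 0) + infsum f (nonreal_zeros - {(r, 0)}) - nonreal_sum s\<bar> = \<bar>f (r, 0)\<bar>" by (simp add: ns)
      also have "\<dots> \<le> cmod (1 / (s - r))" unfolding f_def fst_conv by (rule abs_Re_le_cmod)
      also have "\<dots> = 1 / cmod (s - r)" by (simp add: norm_divide)
      also have "\<dots> \<le> 1 / Im s" using abs_Im_le_cmod[of "s - r"] True s by (intro divide_left_mono mult_pos_pos) auto
      finally show ?thesis .
    next
      case False
      obtain R g where "zorder zeta' r > 0" by (rule zeta'_zero_factor[OF r]) blast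
      hence mem: "(r, 0) \<in> nonreal_zeros" using False r by (simp add: nonreal_zeros_def)
      have "infsum f nonreal_zeros = infsum f ({(r, 0)} \<union> (nonreal_zeros - {(r, 0)}))" using mem by (simp add: insert_absorb)
      also have "\<dots> = infsum f {(r, 0)} + infsum f (nonreal_zeros - {(r, 0)})"
        by (rule infsum_Un_disjoint) (use sm' ff in auto)
      finally show ?thesis using s by (simp add: ns)
    qed
    have "\<bar>f (r, 0) + infsum f (nonreal_zeros - {(r, 0)}) - ln (Im s / pi) / 2\<bar> \<le> 1 / Im s + (K + \<bar>B\<bar> + 2 * M) / Im s"
    proof -
      have "f (r, 0) + infsum f (nonreal_zeros - {(r, 0)}) - ln (Im s / pi) / 2 =
          (f (r, 0) + infsum f (nonreal_zeros - {(r, 0)}) - nonreal_sum s) + d s" by (simp add: d_def)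
      thus ?thesis using e main[OF s] by (simp only:)
    qed
    also have "\<dots> = C / Im s" by (simp add: C_def add_divide_distrib)
    finally show "\<bar>Re (1 / (s - r)) + (\<Sum>\<^sub>\<infinity>(l, k)\<in>nonreal_zeros - {(r, 0)}. Re (1 / (s - l))) - ln (Im s / pi) / 2\<bar> \<le> C / Im s"
      unfolding ff by (simp add: f_def)
  qed
qed

end
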